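(* Let $\beta>0$, $\mu\in\{-1,1\}$ and consider the cubic fractional NLS $$i\partial_t u-|D|^\beta u=\mu|u|^2u,\qquad (t,x)\in\mathbb{R}\times\mathbb{R}.$$ Let $s_{\rm crit}=\frac{1-\beta}{2}$. Suppose one of the following holds: (a) $0<\beta<1$ and $s<0$; (b) $1\le\beta<2$ and $s<s_{\rm crit}$; (c) $\beta=2$ and $s\le s_{\rm crit}$; (d) $\beta>2$ and $s<\frac{1-2\beta}{6}$. Then the equation has the norm inflation property in $H^s(\mathbb{R})$: for every sufficiently small $\varepsilon>0$ there exist $\phi\in H^\infty(\mathbb{R})$ with $\|\phi\|_{H^s}<\varepsilon$ and $0<T<\varepsilon$ such that the smooth solution $u$ with $u(0)=\phi$ exists on $[0,T]$ and $\|u(T)\|_{H^s}>\frac1\varepsilon$.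
   Context: $|D|^\beta$ is the Fourier multiplier with symbol $|\xi|^\beta$, $\widehat{|D|^\beta f}(\xi)=|\xi|^\beta\widehat f(\xi)$, $\widehat f(\xi)=\int e^{-ix\xi}f(x)dx$. $H^\infty=\bigcap_{\sigma>0}H^\sigma$, and $\|f\|_{H^s}=\frac{1}{\sqrt{2\pi}}\big(\int\langle\xi\rangle^{2s}|\widehat f|^2d\xi\big)^{1/2}$. *)

theory Defs
  imports "HOL-Analysis.Analysis"
begin

text \<open>Functions on the line are complex valued, real \<Rightarrow> complex.
  Convention: the Fourier transform is fhat(xi) = int exp(-i x xi) f(x) dx, so that
  f(x) = (1/(2 pi)) int exp(i x xi) fhat(xi) dxi.  A function belongs to H^infinity
  iff it is the inverse Fourier transform of a measurable g with
  (1+xi^2)^sigma |g|^2 integrable for every real sigma (such g is integrable,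
  so the inverse transform is an honest Lebesgue integral; the function is the
  continuous representative).\<close>

definition fourier_rep :: "(real \<Rightarrow> complex) \<Rightarrow> (real \<Rightarrow> complex) \<Rightarrow> bool" where
  "fourier_rep f g \<longleftrightarrow>
     g \<in> borel_measurable lborel \<and>
     (\<forall>\<sigma>::real. integrable lborel (\<lambda>\<xi>. (1 + \<xi>\<^sup>2) powr \<sigma> * (cmod (g \<xi>))\<^sup>2)) \<and>
     (\<forall>x. f x = (1 / (2 * pi)) *\<^sub>R (LINT \<xi>|lborel. cis (x * \<xi>) * g \<xi>))"

definition Hinf :: "(real \<Rightarrow> complex) set" where
  "Hinf = {f. \<exists>g. fourier_rep f g}"

text \<open>The Fourier transform of an H^infinity function (unique up to null sets).\<close>
definition fhat :: "(real \<Rightarrow> complex) \<Rightarrow> real \<Rightarrow> complex" where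
  "fhat f = (SOME g. fourier_rep f g)"

definition hs_norm :: "real \<Rightarrow> (real \<Rightarrow> complex) \<Rightarrow> real" where
  "hs_norm s f = (1 / sqrt (2 * pi)) *
     sqrt (LINT \<xi>|lborel. (1 + \<xi>\<^sup>2) powr s * (cmod (fhat f \<xi>))\<^sup>2)"

definition fracD :: "real \<Rightarrow> (real \<Rightarrow> complex) \<Rightarrow> real \<Rightarrow> complex" where
  "fracD \<beta> f x = (1 / (2 * pi)) *\<^sub>R
     (LINT \<xi>|lborel. cis (x * \<xi>) * complex_of_real (\<bar>\<xi>\<bar> powr \<beta>) * fhat f \<xi>)"

definition smooth_solution ::
  "real \<Rightarrow> real \<Rightarrow> real \<Rightarrow> (real \<Rightarrow> real \<Rightarrow> complex) \<Rightarrow> bool" where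
  "smooth_solution \<beta> \<mu> T u \<longleftrightarrow>
     (\<forall>t\<in>{0..T}. u t \<in> Hinf) \<and>
     (\<forall>\<sigma>::real. \<forall>t\<in>{0..T}.
        ((\<lambda>\<tau>. hs_norm \<sigma> (\<lambda>x. u \<tau> x - u t x)) \<longlongrightarrow> 0) (at t within {0..T})) \<and>
     (\<forall>t\<in>{0..T}. \<forall>x. \<exists>d::complex.
        ((\<lambda>\<tau>. u \<tau> x) has_vector_derivative d) (at t within {0..T}) \<and>
        \<i> * d - fracD \<beta> (u t) x =
          complex_of_real \<mu> * complex_of_real ((cmod (u t x))\<^sup>2) * u t x)"

end

(*
  On the Fourier side the equation is an integral equation with a trilinear convolution as
  nonlinearity.  The datum is R times the indicator of two intervals of length A at the high
  frequencies N and 2N, so its H^s norm is about R A^(1/2) N^s, which is small because s < 0.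
  Picard iteration converges as soon as T R^2 A^2 is small.  For T N^beta small the phases
  in the second iterate do not oscillate, hence the interaction N - 2N + N = 0 produces a
  contribution of size T R^3 A^2 on the low frequencies [0, A/2], where the datum vanishes
  and where <xi>^s is largest; all further iterates are smaller by the factor T R^2 A^2.
  Taking A, R, T to be suitable powers of N and letting N tend to infinity gives inflation:
  A = N^a with a < 1 for s > -1/2, and A = N for s <= -1/2, where s = -1/2 is
  won by a logarithm.
*)
theory Submission
  imports Defs "HOL-Probability.Levy" "HOL-Real_Asymp.Real_Asymp"
begin

section \<open>Uniqueness of the Fourier transform\<close>

text \<open>Since \<open>fhat\<close> is a choice among a.e. equal representatives, norms and
  |D|^\<beta> can be computed only once uniqueness of the Fourier transform is known. Smoothness
  needs every Sobolev norm on one common interval [0, T]; a weight exp(\<rho>|\<xi>|) gives this at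
  once. The datum lives on |\<xi>| \<le> 3N, so with \<rho> = 1/(3N) the weight costs only a factor
  e, uniformly in N. Convergence is not a contraction argument: a sequence of real majorants
  dominates the iterates and their increments pointwise in frequency, which also gives the pointwise
  remainder bound needed on [0, A/2]. Exponents: A = N^a, T ~ N^(-m), and R ~ N^(-s-a/2) fixes the
  size of the datum. Negligible phases need m \<ge> \<beta>, small T R^2 A^2 needs m \<ge> a - 2s,
  and the low frequencies get H^s norm about N^(a/2-3s-m) times that of an indicator of [0, A/2].
  For a = 1 and s < -1/2, m = \<beta> requires s < (1-2\<beta>)/6 and m = 1 - 2s requires s < -1/2;
  for s > -1/2 some a < 1 with m = a - 2s \<ge> \<beta> exists exactly when s <
  (1-\<beta>)/2.\<close>

lemma integrable_cis_mult:
  fixes g :: "real \<Rightarrow> complex"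
  assumes "integrable lborel g"
  shows "integrable lborel (\<lambda>\<xi>. cis (x * \<xi>) * g \<xi>)"
proof (rule Bochner_Integration.integrable_bound[OF assms])
  have [measurable]: "g \<in> borel_measurable borel"
    using borel_measurable_integrable[OF assms] by simp
  show "(\<lambda>\<xi>. cis (x * \<xi>) * g \<xi>) \<in> borel_measurable lborel"
    unfolding cis_conv_exp by measurable
qed (auto simp: norm_mult)

text \<open>Equality at x = 0 gives equal masses m. For m > 0 the functions divided by m are
  probability densities with equal characteristic functions, so Levy's uniqueness theorem identifies
  the measures and hence the densities a.e.; for m = 0 both functions vanish a.e.\<close>

lemma fourier_eq_imp_AE_eq_real:
  fixes p q :: "real \<Rightarrow> real"
  assumes p: "integrable lborel p" "\<And>\<xi>. p \<xi> \<ge> 0" and q: "integrable lborel q" "\<And>\<xi>. q \<xi> \<ge> 0"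
    and eq: "\<And>x. (LINT \<xi>|lborel. cis (x * \<xi>) * of_real (p \<xi>)) = (LINT \<xi>|lborel. cis (x * \<xi>) * of_real (q \<xi>))"
  shows "AE \<xi> in lborel. p \<xi> = q \<xi>"
proof -
  have pm [measurable]: "p \<in> borel_measurable borel" and qm [measurable]: "q \<in> borel_measurable borel"
    using p(1) q(1) by (auto dest: borel_measurable_integrable)
  define m where "m = integral\<^sup>L lborel p"
  have mq: "m = integral\<^sup>L lborel q"
    using eq[of 0] unfolding m_def by simp
  have m0: "m \<ge> 0" unfolding m_def using p(2) by (intro integral_nonneg_AE) auto
  show ?thesis
  proof (cases "m = 0")
    case True
    have "AE \<xi> in lborel. p \<xi> = 0"
      using integral_nonneg_eq_0_iff_AE[OF p(1)] p(2) True m_def by auto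
    moreover have "AE \<xi> in lborel. q \<xi> = 0"
      using integral_nonneg_eq_0_iff_AE[OF q(1)] q(2) True mq by auto
    ultimately show ?thesis by eventually_elim simp
  next
    case False
    then have mpos: "m > 0" using m0 by simp
    define D where "D = (\<lambda>r::real\<Rightarrow>real. density lborel (\<lambda>\<xi>. ennreal (r \<xi> / m)))"
    have dist: "real_distribution (D r)"
      if r: "integrable lborel r" "\<And>\<xi>. r \<xi> \<ge> 0" "integral\<^sup>L lborel r = m" for r
    proof -
      have [measurable]: "r \<in> borel_measurable borel" using r(1) by (auto dest: borel_measurable_integrable)
      have "emeasure (D r) (space (D r)) = (\<integral>\<^sup>+\<xi>. ennreal (r \<xi> / m) \<partial>lborel)"
        by (simp add: D_def emeasure_density)
      also have "\<dots> = ennreal (LINT \<xi>|lborel. r \<xi> / m)"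
        using r mpos by (intro nn_integral_eq_integral) auto
      also have "\<dots> = 1" using r(3) mpos by simp
      finally have "prob_space (D r)" by (rule prob_spaceI)
      then show ?thesis unfolding real_distribution_def real_distribution_axioms_def by (simp add: D_def)
    qed
    have ch: "char (D r) x = (LINT \<xi>|lborel. cis (x * \<xi>) * of_real (r \<xi>)) / of_real m"
      if r: "integrable lborel r" "\<And>\<xi>. r \<xi> \<ge> 0" for r x
    proof -
      have [measurable]: "r \<in> borel_measurable borel" using r(1) by (auto dest: borel_measurable_integrable)
      have "char (D r) x = (LINT \<xi>|lborel. (r \<xi> / m) *\<^sub>R iexp (x * \<xi>))"
        unfolding char_def D_def using r mpos by (intro integral_density) auto
      also have "\<dots> = (LINT \<xi>|lborel. (cis (x * \<xi>) * of_real (r \<xi>)) / of_real m)"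
        by (intro Bochner_Integration.integral_cong) (auto simp: cis_conv_exp scaleR_conv_of_real field_simps)
      finally show ?thesis by simp
    qed
    have "D p = D q"
      by (rule Levy_uniqueness) (use dist p q mq m_def eq ch in auto)
    then have "AE \<xi> in lborel. ennreal (p \<xi> / m) = ennreal (q \<xi> / m)"
      unfolding D_def by (intro sigma_finite_measure.density_unique[OF sigma_finite_lborel]) auto
    then show ?thesis
    proof eventually_elim
      case (elim \<xi>)
      then have "p \<xi> / m = q \<xi> / m" using p(2) q(2) mpos by (simp add: ennreal_inj)
      then show ?case using mpos by simp
    qed
  qed
qed

text \<open>The positive and the negative part have equal transforms, so by the nonnegative case
  they agree a.e.; since at each point one of them is 0, both are.\<close>

lemma fourier_zero_imp_AE_zero_real:
  fixes h :: "real \<Rightarrow> real"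
  assumes h: "integrable lborel h" and zero: "\<And>x. (LINT \<xi>|lborel. cis (x * \<xi>) * of_real (h \<xi>)) = 0"
  shows "AE \<xi> in lborel. h \<xi> = 0"
proof -
  have i1: "integrable lborel (\<lambda>\<xi>. max 0 (h \<xi>))" and i2: "integrable lborel (\<lambda>\<xi>. max 0 (- h \<xi>))"
    using h by auto
  have "AE \<xi> in lborel. max 0 (h \<xi>) = max 0 (- h \<xi>)"
  proof (rule fourier_eq_imp_AE_eq_real[OF i1 _ i2])
    fix x
    have "(LINT \<xi>|lborel. cis (x * \<xi>) * of_real (max 0 (h \<xi>))) - (LINT \<xi>|lborel. cis (x * \<xi>) * of_real (max 0 (- h \<xi>)))
       = (LINT \<xi>|lborel. cis (x * \<xi>) * of_real (max 0 (h \<xi>)) - cis (x * \<xi>) * of_real (max 0 (- h \<xi>)))"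
      using i1 i2 by (intro Bochner_Integration.integral_diff[symmetric] integrable_cis_mult integrable_of_real)
    also have "\<dots> = (LINT \<xi>|lborel. cis (x * \<xi>) * of_real (h \<xi>))"
      by (intro Bochner_Integration.integral_cong) (auto simp: max_def algebra_simps)
    finally show "(LINT \<xi>|lborel. cis (x * \<xi>) * of_real (max 0 (h \<xi>))) = (LINT \<xi>|lborel. cis (x * \<xi>) * of_real (max 0 (- h \<xi>)))"
      using zero by simp
  qed auto
  then show ?thesis by eventually_elim (auto simp: max_def split: if_splits)
qed

text \<open>The transform of \<open>cnj h\<close> at x is the conjugate of that of \<open>h\<close>
  at -x, so it vanishes as well; real and imaginary part are combinations of \<open>h\<close> and
  \<open>cnj h\<close> and fall under the real case.\<close>

lemma fourier_zero_imp_AE_zero: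
  fixes h :: "real \<Rightarrow> complex"
  assumes h: "integrable lborel h" and zero: "\<And>x. (LINT \<xi>|lborel. cis (x * \<xi>) * h \<xi>) = 0"
  shows "AE \<xi> in lborel. h \<xi> = 0"
proof -
  have conj: "(LINT \<xi>|lborel. cis (x * \<xi>) * cnj (h \<xi>)) = 0" for x
  proof -
    have "(LINT \<xi>|lborel. cis (x * \<xi>) * cnj (h \<xi>)) = (LINT \<xi>|lborel. cnj (cis ((- x) * \<xi>) * h \<xi>))"
      by (simp add: cis_cnj)
    also have "\<dots> = cnj (LINT \<xi>|lborel. cis ((- x) * \<xi>) * h \<xi>)"
      by (rule integral_bounded_linear[OF bounded_linear_cnj integrable_cis_mult[OF h]])
    finally show ?thesis using zero[of "- x"] by simp
  qed
  have ih: "integrable lborel (\<lambda>\<xi>. cnj (h \<xi>))" using h by simp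
  have "AE \<xi> in lborel. Re (h \<xi>) = 0"
  proof (rule fourier_zero_imp_AE_zero_real)
    fix x
    have "(LINT \<xi>|lborel. cis (x * \<xi>) * of_real (Re (h \<xi>)))
        = (LINT \<xi>|lborel. (cis (x * \<xi>) * h \<xi> + cis (x * \<xi>) * cnj (h \<xi>)) / 2)"
      by (intro Bochner_Integration.integral_cong) (auto simp: complex_eq_iff)
    also have "\<dots> = 0"
      using zero conj integrable_cis_mult[OF h] integrable_cis_mult[OF ih] by simp
    finally show "(LINT \<xi>|lborel. cis (x * \<xi>) * of_real (Re (h \<xi>))) = 0" .
  qed (use h in auto)
  moreover have "AE \<xi> in lborel. Im (h \<xi>) = 0"
  proof (rule fourier_zero_imp_AE_zero_real)
    fix x
    have "(LINT \<xi>|lborel. cis (x * \<xi>) * of_real (Im (h \<xi>)))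
        = (LINT \<xi>|lborel. (cis (x * \<xi>) * h \<xi> - cis (x * \<xi>) * cnj (h \<xi>)) / (2 * \<i>))"
      by (intro Bochner_Integration.integral_cong) (auto simp: complex_eq_iff)
    also have "\<dots> = 0"
      using zero conj integrable_cis_mult[OF h] integrable_cis_mult[OF ih] by simp
    finally show "(LINT \<xi>|lborel. cis (x * \<xi>) * of_real (Im (h \<xi>))) = 0" .
  qed (use h in auto)
  ultimately show ?thesis by eventually_elim (simp add: complex_eq_iff)
qed

lemma integrable_inverse_Suc_square: "integrable lborel (\<lambda>\<xi>::real. inverse (1 + \<xi>\<^sup>2))"
  using integrable_inverse_1_plus_square by (simp add: set_integrable_def einterval_def)

text \<open>Take \<sigma> = 1: by the inequality of means 2|g| \<le> 1/(1+\<xi>^2) +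
  (1+\<xi>^2)|g|^2, and both terms are integrable.\<close>

lemma fourier_rep_integrable:
  assumes "fourier_rep f g"
  shows "integrable lborel g"
proof -
  have gm [measurable]: "g \<in> borel_measurable lborel" and
    i: "integrable lborel (\<lambda>\<xi>. (1 + \<xi>\<^sup>2) powr 1 * (cmod (g \<xi>))\<^sup>2)"
    using assms unfolding fourier_rep_def by blast+
  have "integrable lborel (\<lambda>\<xi>. inverse (1 + \<xi>\<^sup>2) + (1 + \<xi>\<^sup>2) powr 1 * (cmod (g \<xi>))\<^sup>2)"
    using integrable_inverse_Suc_square i by simp
  then show ?thesis
  proof (rule Bochner_Integration.integrable_bound)
    show "AE \<xi> in lborel. norm (g \<xi>) \<le> norm (inverse (1 + \<xi>\<^sup>2) + (1 + \<xi>\<^sup>2) powr 1 * (cmod (g \<xi>))\<^sup>2)"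
    proof (intro AE_I2)
      fix \<xi> :: real
      define a where "a = sqrt (1 + \<xi>\<^sup>2)"
      define b where "b = cmod (g \<xi>)"
      have a: "a > 0" "a\<^sup>2 = 1 + \<xi>\<^sup>2" unfolding a_def by (auto simp: add_pos_nonneg)
      have b: "b \<ge> 0" by (simp add: b_def)
      have "(1/a - a * b)\<^sup>2 \<ge> 0" by simp
      then have "2 * b \<le> inverse (a\<^sup>2) + a\<^sup>2 * b\<^sup>2"
        using a(1) by (simp add: power2_eq_square algebra_simps inverse_eq_divide)
      then have "b \<le> inverse (a\<^sup>2) + a\<^sup>2 * b\<^sup>2" using b by linarith
      moreover have "(1 + \<xi>\<^sup>2) powr 1 = a\<^sup>2" using a by (simp add: add_nonneg_nonneg)
      ultimately show "norm (g \<xi>) \<le> norm (inverse (1 + \<xi>\<^sup>2) + (1 + \<xi>\<^sup>2) powr 1 * (cmod (g \<xi>))\<^sup>2)"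
        unfolding a(2) b_def by (simp add: a(2)[symmetric])
    qed
  qed measurable
qed

lemma fourier_rep_fhat: "fourier_rep f g \<Longrightarrow> fourier_rep f (fhat f)"
  unfolding fhat_def by (rule someI[of "fourier_rep f"])

text \<open>Two representatives of one function have the same inverse transform, so uniqueness
  applies to their difference. This is what makes \<open>hs_norm\<close> and \<open>fracD\<close>
  computable from an explicit \<open>g\<close> although \<open>fhat\<close> is a choice.\<close>

lemma fhat_AE:
  assumes "fourier_rep f g"
  shows "AE \<xi> in lborel. fhat f \<xi> = g \<xi>"
proof -
  note r = fourier_rep_fhat[OF assms]
  have i: "integrable lborel g" "integrable lborel (fhat f)"
    using assms r by (auto intro: fourier_rep_integrable)
  have "AE \<xi> in lborel. fhat f \<xi> - g \<xi> = 0"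
  proof (rule fourier_zero_imp_AE_zero)
    fix x
    have "(1 / (2 * pi)) *\<^sub>R (LINT \<xi>|lborel. cis (x * \<xi>) * g \<xi>) = (1 / (2 * pi)) *\<^sub>R (LINT \<xi>|lborel. cis (x * \<xi>) * fhat f \<xi>)"
      using assms r unfolding fourier_rep_def by metis
    then have "(LINT \<xi>|lborel. cis (x * \<xi>) * g \<xi>) = (LINT \<xi>|lborel. cis (x * \<xi>) * fhat f \<xi>)"
      by simp
    then show "(LINT \<xi>|lborel. cis (x * \<xi>) * (fhat f \<xi> - g \<xi>)) = 0"
      using integrable_cis_mult[OF i(1)] integrable_cis_mult[OF i(2)] by (simp add: right_diff_distrib)
  qed (use i in simp)
  then show ?thesis by eventually_elim simp
qed

lemma hs_norm_eq:
  assumes "fourier_rep f g"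
  shows "hs_norm s f = (1 / sqrt (2 * pi)) * sqrt (LINT \<xi>|lborel. (1 + \<xi>\<^sup>2) powr s * (cmod (g \<xi>))\<^sup>2)"
proof -
  have [measurable]: "g \<in> borel_measurable lborel" "fhat f \<in> borel_measurable lborel"
    using assms fourier_rep_fhat[OF assms] unfolding fourier_rep_def by blast+
  have "(LINT \<xi>|lborel. (1 + \<xi>\<^sup>2) powr s * (cmod (fhat f \<xi>))\<^sup>2) = (LINT \<xi>|lborel. (1 + \<xi>\<^sup>2) powr s * (cmod (g \<xi>))\<^sup>2)"
    by (rule integral_cong_AE) (use fhat_AE[OF assms] in auto)
  then show ?thesis unfolding hs_norm_def by simp
qed

lemma fracD_eq:
  assumes "fourier_rep f g"
  shows "fracD \<beta> f x = (1 / (2 * pi)) *\<^sub>R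
     (LINT \<xi>|lborel. cis (x * \<xi>) * complex_of_real (\<bar>\<xi>\<bar> powr \<beta>) * g \<xi>)"
proof -
  have [measurable]: "g \<in> borel_measurable lborel" "fhat f \<in> borel_measurable lborel"
    using assms fourier_rep_fhat[OF assms] unfolding fourier_rep_def by blast+
  have "(LINT \<xi>|lborel. cis (x * \<xi>) * complex_of_real (\<bar>\<xi>\<bar> powr \<beta>) * fhat f \<xi>)
      = (LINT \<xi>|lborel. cis (x * \<xi>) * complex_of_real (\<bar>\<xi>\<bar> powr \<beta>) * g \<xi>)"
  proof (rule integral_cong_AE)
    show "AE \<xi> in lborel. cis (x * \<xi>) * complex_of_real (\<bar>\<xi>\<bar> powr \<beta>) * fhat f \<xi> = cis (x * \<xi>) * complex_of_real (\<bar>\<xi>\<bar> powr \<beta>) * g \<xi>"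
      using fhat_AE[OF assms] by eventually_elim simp
  qed (unfold cis_conv_exp, measurable)
  then show ?thesis unfolding fracD_def by simp
qed

section \<open>Convolution and exponential decay\<close>

text \<open>Generic in the value type since the same operator acts on complex transforms and on
  their real majorants.\<close>

definition conv :: "(real \<Rightarrow> 'a) \<Rightarrow> (real \<Rightarrow> 'a) \<Rightarrow> real \<Rightarrow> 'a::{real_normed_field,banach,second_countable_topology}" where
  "conv f g \<xi> = (LINT \<eta>|lborel. f \<eta> * g (\<xi> - \<eta>))"

lemma lborel_integrable_reflect:
  fixes g :: "real \<Rightarrow> 'a::{banach,second_countable_topology}"
  shows "integrable lborel (\<lambda>\<eta>. g (\<xi> - \<eta>)) \<longleftrightarrow> integrable lborel g"
  using lborel_integrable_real_affine_iff[of "-1" g \<xi>] by simp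

lemma lborel_integral_reflect:
  fixes g :: "real \<Rightarrow> 'a::{banach,second_countable_topology}"
  shows "(LINT \<eta>|lborel. g (\<xi> - \<eta>)) = integral\<^sup>L lborel g"
  using lborel_integral_real_affine[of "-1" g \<xi>] by simp

lemma lborel_integrable_shift:
  fixes g :: "real \<Rightarrow> 'a::{banach,second_countable_topology}"
  shows "integrable lborel (\<lambda>\<xi>. g (\<xi> - \<eta>)) \<longleftrightarrow> integrable lborel g"
  using lborel_integrable_real_affine_iff[of 1 g "-\<eta>"] by simp

lemma lborel_integral_shift:
  fixes g :: "real \<Rightarrow> 'a::{banach,second_countable_topology}"
  shows "(LINT \<xi>|lborel. g (\<xi> - \<eta>)) = integral\<^sup>L lborel g"
  using lborel_integral_real_affine[of 1 g "-\<eta>"] by simp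

lemma conv_commute: "conv f g = conv g f"
proof
  fix \<xi>
  show "conv f g \<xi> = conv g f \<xi>"
    unfolding conv_def
    using lborel_integral_reflect[of "\<lambda>\<eta>. f \<eta> * g (\<xi> - \<eta>)" \<xi>] by (simp add: mult.commute)
qed

lemma borel_measurable_conv [measurable]:
  fixes f g :: "real \<Rightarrow> 'a::{real_normed_field,banach,second_countable_topology}"
  assumes [measurable]: "f \<in> borel_measurable borel" "g \<in> borel_measurable borel"
  shows "conv f g \<in> borel_measurable borel"
  unfolding conv_def by measurable

lemma integrable_imp_borel_measurable_borel:
  "integrable lborel f \<Longrightarrow> f \<in> borel_measurable borel"
  by (auto dest: borel_measurable_integrable)

lemma conv_integrand_integrable:
  fixes f g :: "real \<Rightarrow> 'a::{real_normed_field,banach,second_countable_topology}"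
  assumes f: "integrable lborel f" and g [measurable]: "g \<in> borel_measurable borel"
    and b: "\<And>\<xi>. norm (g \<xi>) \<le> B"
  shows "integrable lborel (\<lambda>\<eta>. f \<eta> * g (\<xi> - \<eta>))"
proof (rule Bochner_Integration.integrable_bound)
  note [measurable] = integrable_imp_borel_measurable_borel[OF f]
  show "integrable lborel (\<lambda>\<eta>. norm (f \<eta>) * B)" using f by simp
  show "(\<lambda>\<eta>. f \<eta> * g (\<xi> - \<eta>)) \<in> borel_measurable lborel" by measurable
  show "AE \<eta> in lborel. norm (f \<eta> * g (\<xi> - \<eta>)) \<le> norm (norm (f \<eta>) * B)"
  proof (intro AE_I2)
    fix \<eta>
    have "norm (f \<eta>) * norm (g (\<xi> - \<eta>)) \<le> norm (f \<eta>) * B" using b by (intro mult_left_mono) auto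
    then show "norm (f \<eta> * g (\<xi> - \<eta>)) \<le> norm (norm (f \<eta>) * B)" by (simp add: norm_mult)
  qed
qed

lemma conv_pair_integrable:
  fixes f g :: "real \<Rightarrow> 'a::{real_normed_field,banach,second_countable_topology}"
  assumes f: "integrable lborel f" and g: "integrable lborel g"
  shows "integrable (lborel \<Otimes>\<^sub>M lborel) (\<lambda>(\<eta>, \<xi>). f \<eta> * g (\<xi> - \<eta>))"
proof (rule lborel_pair.Fubini_integrable)
  note [measurable] = integrable_imp_borel_measurable_borel[OF f] integrable_imp_borel_measurable_borel[OF g]
  show "(\<lambda>(\<eta>, \<xi>). f \<eta> * g (\<xi> - \<eta>)) \<in> borel_measurable (lborel \<Otimes>\<^sub>M lborel)" by measurable
  have "(\<lambda>\<eta>. LINT \<xi>|lborel. norm (case (\<eta>, \<xi>) of (\<eta>, \<xi>) \<Rightarrow> f \<eta> * g (\<xi> - \<eta>)))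
      = (\<lambda>\<eta>. norm (f \<eta>) * (LINT \<xi>|lborel. norm (g \<xi>)))"
    using lborel_integral_shift[of "\<lambda>\<xi>. norm (g \<xi>)"] by (auto simp: norm_mult)
  then show "integrable lborel (\<lambda>\<eta>. LINT \<xi>|lborel. norm (case (\<eta>, \<xi>) of (\<eta>, \<xi>) \<Rightarrow> f \<eta> * g (\<xi> - \<eta>)))"
    using f by simp
  show "AE \<eta> in lborel. integrable lborel (\<lambda>\<xi>. case (\<eta>, \<xi>) of (\<eta>, \<xi>) \<Rightarrow> f \<eta> * g (\<xi> - \<eta>))"
    using g by (auto simp: lborel_integrable_shift)
qed

lemma integrable_conv:
  fixes f g :: "real \<Rightarrow> 'a::{real_normed_field,banach,second_countable_topology}"
  assumes f: "integrable lborel f" and g: "integrable lborel g"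
  shows "integrable lborel (conv f g)"
  using lborel_pair.integrable_snd[OF conv_pair_integrable[OF assms]] by (simp add: conv_def[abs_def])

lemma integral_conv:
  fixes f g :: "real \<Rightarrow> 'a::{real_normed_field,banach,second_countable_topology}"
  assumes f: "integrable lborel f" and g: "integrable lborel g"
  shows "integral\<^sup>L lborel (conv f g) = integral\<^sup>L lborel f * integral\<^sup>L lborel g"
proof -
  have "integral\<^sup>L lborel (conv f g) = (LINT \<eta>|lborel. (LINT \<xi>|lborel. f \<eta> * g (\<xi> - \<eta>)))"
    unfolding conv_def using conv_pair_integrable[OF assms] by (rule lborel_pair.Fubini_integral)
  also have "\<dots> = (LINT \<eta>|lborel. f \<eta> * integral\<^sup>L lborel g)"
    using f g by (simp add: lborel_integral_shift)
  also have "\<dots> = integral\<^sup>L lborel f * integral\<^sup>L lborel g"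
    using f g by simp
  finally show ?thesis .
qed

text \<open>The character splits as cis(x \<xi>) = cis(x \<eta>) cis(x (\<xi> - \<eta>)), so it can
  be distributed over the two factors, and the claim becomes the product formula for total
  integrals.\<close>

lemma fourier_conv:
  fixes f g :: "real \<Rightarrow> complex"
  assumes f: "integrable lborel f" and g: "integrable lborel g"
  shows "(LINT \<xi>|lborel. cis (x * \<xi>) * conv f g \<xi>) =
    (LINT \<xi>|lborel. cis (x * \<xi>) * f \<xi>) * (LINT \<xi>|lborel. cis (x * \<xi>) * g \<xi>)"
proof -
  have "cis (x * \<xi>) * conv f g \<xi> = conv (\<lambda>\<xi>. cis (x * \<xi>) * f \<xi>) (\<lambda>\<xi>. cis (x * \<xi>) * g \<xi>) \<xi>" for \<xi>
  proof -
    have "cis (x * \<xi>) * conv f g \<xi> = (LINT \<eta>|lborel. cis (x * \<xi>) * (f \<eta> * g (\<xi> - \<eta>)))"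
      unfolding conv_def by simp
    also have "\<dots> = (LINT \<eta>|lborel. (cis (x * \<eta>) * f \<eta>) * (cis (x * (\<xi> - \<eta>)) * g (\<xi> - \<eta>)))"
    proof (intro Bochner_Integration.integral_cong refl)
      fix \<eta>
      have "cis (x * \<xi>) = cis (x * \<eta>) * cis (x * (\<xi> - \<eta>))" by (simp add: cis_mult algebra_simps)
      then show "cis (x * \<xi>) * (f \<eta> * g (\<xi> - \<eta>)) = (cis (x * \<eta>) * f \<eta>) * (cis (x * (\<xi> - \<eta>)) * g (\<xi> - \<eta>))"
        by (simp add: ac_simps)
    qed
    finally show ?thesis unfolding conv_def .
  qed
  then show ?thesis
    using integral_conv[OF integrable_cis_mult[OF f] integrable_cis_mult[OF g], of x x] by simp
qed

text \<open>The weight \<open>exp (\<rho> * \<bar>\<xi>\<bar>)\<close> is submultiplicative, so this class is stable under convolution with one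
  fixed \<open>\<rho>\<close>; the weighted \<open>L\<^sup>1\<close> bound \<open>X\<close> governs convergence of the iteration, the weighted sup bound
  \<open>Y\<close> gives pointwise estimates, and together they control every Sobolev norm.\<close>

definition exp_decay :: "real \<Rightarrow> real \<Rightarrow> real \<Rightarrow> (real \<Rightarrow> 'a::{banach,second_countable_topology}) \<Rightarrow> bool" where
  "exp_decay \<rho> X Y f \<longleftrightarrow> f \<in> borel_measurable borel \<and>
     integrable lborel (\<lambda>\<xi>. exp (\<rho> * \<bar>\<xi>\<bar>) * norm (f \<xi>)) \<and>
     (LINT \<xi>|lborel. exp (\<rho> * \<bar>\<xi>\<bar>) * norm (f \<xi>)) \<le> X \<and>
     (\<forall>\<xi>. exp (\<rho> * \<bar>\<xi>\<bar>) * norm (f \<xi>) \<le> Y)"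

lemma exp_decay_nonneg:
  assumes "exp_decay \<rho> X Y f"
  shows "X \<ge> 0" "Y \<ge> 0"
proof -
  have "0 \<le> (LINT \<xi>|lborel. exp (\<rho> * \<bar>\<xi>\<bar>) * norm (f \<xi>))" by (intro integral_nonneg_AE) auto
  then show "X \<ge> 0" using assms unfolding exp_decay_def by linarith
  have "0 \<le> exp (\<rho> * \<bar>0\<bar>) * norm (f 0)" by simp
  then show "Y \<ge> 0" using assms unfolding exp_decay_def by (meson order_trans)
qed

lemma exp_weight_ge: "\<rho> \<ge> 0 \<Longrightarrow> (c::real) \<ge> 0 \<Longrightarrow> c \<le> exp (\<rho> * \<bar>\<xi>\<bar>) * c"
  using mult_right_mono[of 1 "exp (\<rho> * \<bar>\<xi>\<bar>)" c] by simp

lemma exp_decay_integrable: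
  assumes "exp_decay \<rho> X Y f" "\<rho> \<ge> 0"
  shows "integrable lborel f"
proof (rule Bochner_Integration.integrable_bound)
  show "integrable lborel (\<lambda>\<xi>. exp (\<rho> * \<bar>\<xi>\<bar>) * norm (f \<xi>))" using assms unfolding exp_decay_def by simp
  show "f \<in> borel_measurable lborel" using assms unfolding exp_decay_def by simp
  show "AE \<xi> in lborel. norm (f \<xi>) \<le> norm (exp (\<rho> * \<bar>\<xi>\<bar>) * norm (f \<xi>))"
    using exp_weight_ge[OF assms(2)] by (auto simp: norm_mult)
qed

lemma exp_decay_measurable: "exp_decay \<rho> X Y f \<Longrightarrow> f \<in> borel_measurable borel"
  unfolding exp_decay_def by simp

lemma exp_decay_bound: "exp_decay \<rho> X Y f \<Longrightarrow> norm (f \<xi>) \<le> Y * exp (- (\<rho> * \<bar>\<xi>\<bar>))"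
  unfolding exp_decay_def by (simp add: exp_minus field_simps)

lemma exp_decay_le: "exp_decay \<rho> X Y f \<Longrightarrow> \<rho> \<ge> 0 \<Longrightarrow> norm (f \<xi>) \<le> Y"
  using exp_weight_ge[of \<rho> "norm (f \<xi>)" \<xi>] unfolding exp_decay_def by (meson norm_ge_zero order_trans)

lemma norm_conv_le:
  fixes f g :: "real \<Rightarrow> 'a::{real_normed_field,banach,second_countable_topology}"
  shows "norm (conv f g \<xi>) \<le> conv (\<lambda>\<xi>. norm (f \<xi>)) (\<lambda>\<xi>. norm (g \<xi>)) \<xi>"
  unfolding conv_def using integral_norm_bound[of lborel "\<lambda>\<eta>. f \<eta> * g (\<xi> - \<eta>)"] by (simp add: norm_mult)

lemma conv_le_left:
  fixes f g :: "real \<Rightarrow> real"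
  assumes f: "integrable lborel f" "\<And>\<xi>. f \<xi> \<ge> 0" and g: "g \<in> borel_measurable borel" "\<And>\<xi>. \<bar>g \<xi>\<bar> \<le> B"
  shows "conv f g \<xi> \<le> integral\<^sup>L lborel f * B"
proof -
  have "conv f g \<xi> \<le> (LINT \<eta>|lborel. f \<eta> * B)"
    unfolding conv_def
  proof (rule integral_mono)
    show "integrable lborel (\<lambda>\<eta>. f \<eta> * g (\<xi> - \<eta>))" using f(1) g by (intro conv_integrand_integrable) auto
    show "integrable lborel (\<lambda>\<eta>. f \<eta> * B)" using f by simp
    fix \<eta> show "f \<eta> * g (\<xi> - \<eta>) \<le> f \<eta> * B" using f(2) g(2)[of "\<xi> - \<eta>"] by (intro mult_left_mono) auto
  qed
  then show ?thesis using f by simp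
qed

lemma exp_weight_conv_le:
  fixes f g :: "real \<Rightarrow> 'a::{real_normed_field,banach,second_countable_topology}"
  assumes \<rho>: "\<rho> \<ge> 0" and f: "exp_decay \<rho> X1 Y1 f" and g: "exp_decay \<rho> X2 Y2 g"
  shows "exp (\<rho> * \<bar>\<xi>\<bar>) * norm (conv f g \<xi>) \<le>
    conv (\<lambda>\<xi>. exp (\<rho> * \<bar>\<xi>\<bar>) * norm (f \<xi>)) (\<lambda>\<xi>. exp (\<rho> * \<bar>\<xi>\<bar>) * norm (g \<xi>)) \<xi>"
proof -
  note [measurable] = exp_decay_measurable[OF f] exp_decay_measurable[OF g]
  have "exp (\<rho> * \<bar>\<xi>\<bar>) * norm (conv f g \<xi>) \<le> exp (\<rho> * \<bar>\<xi>\<bar>) * conv (\<lambda>\<xi>. norm (f \<xi>)) (\<lambda>\<xi>. norm (g \<xi>)) \<xi>"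
    by (intro mult_left_mono norm_conv_le) auto
  also have "\<dots> = (LINT \<eta>|lborel. exp (\<rho> * \<bar>\<xi>\<bar>) * (norm (f \<eta>) * norm (g (\<xi> - \<eta>))))"
    unfolding conv_def by simp
  also have "\<dots> \<le> (LINT \<eta>|lborel. (exp (\<rho> * \<bar>\<eta>\<bar>) * norm (f \<eta>)) * (exp (\<rho> * \<bar>\<xi> - \<eta>\<bar>) * norm (g (\<xi> - \<eta>))))"
  proof (rule integral_mono)
    show "integrable lborel (\<lambda>\<eta>. exp (\<rho> * \<bar>\<xi>\<bar>) * (norm (f \<eta>) * norm (g (\<xi> - \<eta>))))"
      using exp_decay_integrable[OF f \<rho>] exp_decay_le[OF g \<rho>]
      by (intro integrable_mult_right conv_integrand_integrable[where B = Y2]) auto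
    show "integrable lborel (\<lambda>\<eta>. (exp (\<rho> * \<bar>\<eta>\<bar>) * norm (f \<eta>)) * (exp (\<rho> * \<bar>\<xi> - \<eta>\<bar>) * norm (g (\<xi> - \<eta>))))"
      using f g by (intro conv_integrand_integrable[where B = Y2 and g = "\<lambda>\<xi>. exp (\<rho> * \<bar>\<xi>\<bar>) * norm (g \<xi>)"])
        (auto simp: exp_decay_def)
    fix \<eta>
    have "\<rho> * \<bar>\<xi>\<bar> \<le> \<rho> * \<bar>\<eta>\<bar> + \<rho> * \<bar>\<xi> - \<eta>\<bar>"
      using \<rho> by (simp add: distrib_left[symmetric] mult_left_mono)
    then have "exp (\<rho> * \<bar>\<xi>\<bar>) \<le> exp (\<rho> * \<bar>\<eta>\<bar>) * exp (\<rho> * \<bar>\<xi> - \<eta>\<bar>)"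
      by (simp add: exp_add[symmetric])
    then have "exp (\<rho> * \<bar>\<xi>\<bar>) * (norm (f \<eta>) * norm (g (\<xi> - \<eta>))) \<le> (exp (\<rho> * \<bar>\<eta>\<bar>) * exp (\<rho> * \<bar>\<xi> - \<eta>\<bar>)) * (norm (f \<eta>) * norm (g (\<xi> - \<eta>)))"
      by (intro mult_right_mono) auto
    then show "exp (\<rho> * \<bar>\<xi>\<bar>) * (norm (f \<eta>) * norm (g (\<xi> - \<eta>))) \<le> (exp (\<rho> * \<bar>\<eta>\<bar>) * norm (f \<eta>)) * (exp (\<rho> * \<bar>\<xi> - \<eta>\<bar>) * norm (g (\<xi> - \<eta>)))"
      by (simp add: ac_simps)
  qed
  finally show ?thesis unfolding conv_def .
qed

text \<open>Young's inequality in the weighted norms: L1 with L1 for \<open>X\<close>, L1 with sup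
  for \<open>Y\<close>. The sup norm is charged to the second factor; commuting the convolution
  allows either factor to be charged.\<close>

lemma exp_decay_conv:
  fixes f g :: "real \<Rightarrow> 'a::{real_normed_field,banach,second_countable_topology}"
  assumes \<rho>: "\<rho> \<ge> 0" and f: "exp_decay \<rho> X1 Y1 f" and g: "exp_decay \<rho> X2 Y2 g"
  shows "exp_decay \<rho> (X1 * X2) (X1 * Y2) (conv f g)"
proof -
  let ?f = "\<lambda>\<xi>. exp (\<rho> * \<bar>\<xi>\<bar>) * norm (f \<xi>)" and ?g = "\<lambda>\<xi>. exp (\<rho> * \<bar>\<xi>\<bar>) * norm (g \<xi>)"
  note [measurable] = exp_decay_measurable[OF f] exp_decay_measurable[OF g]
  note nn = exp_decay_nonneg[OF f] exp_decay_nonneg[OF g]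
  note le = exp_weight_conv_le[OF assms]
  have fi: "integrable lborel ?f" "integral\<^sup>L lborel ?f \<le> X1" and gi: "integrable lborel ?g" "integral\<^sup>L lborel ?g \<le> X2" "\<And>\<xi>. ?g \<xi> \<le> Y2"
    using f g unfolding exp_decay_def by auto
  have c: "integrable lborel (conv ?f ?g)" by (rule integrable_conv[OF fi(1) gi(1)])
  have i: "integrable lborel (\<lambda>\<xi>. exp (\<rho> * \<bar>\<xi>\<bar>) * norm (conv f g \<xi>))"
    by (rule Bochner_Integration.integrable_bound[OF c]) (use le in \<open>auto intro: order_trans[OF _ abs_ge_self]\<close>)
  have "(LINT \<xi>|lborel. exp (\<rho> * \<bar>\<xi>\<bar>) * norm (conv f g \<xi>)) \<le> integral\<^sup>L lborel (conv ?f ?g)"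
    by (rule integral_mono[OF i c le])
  also have "\<dots> = integral\<^sup>L lborel ?f * integral\<^sup>L lborel ?g" by (rule integral_conv[OF fi(1) gi(1)])
  also have "\<dots> \<le> X1 * X2" using fi gi nn by (intro mult_mono) (auto intro: integral_nonneg_AE)
  finally have 1: "(LINT \<xi>|lborel. exp (\<rho> * \<bar>\<xi>\<bar>) * norm (conv f g \<xi>)) \<le> X1 * X2" .
  have 2: "exp (\<rho> * \<bar>\<xi>\<bar>) * norm (conv f g \<xi>) \<le> X1 * Y2" for \<xi>
  proof -
    have "conv ?f ?g \<xi> \<le> integral\<^sup>L lborel ?f * Y2"
      using fi gi by (intro conv_le_left) auto
    also have "\<dots> \<le> X1 * Y2" using fi nn by (intro mult_right_mono) auto
    finally show ?thesis using le[of \<xi>] by linarith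
  qed
  show ?thesis unfolding exp_decay_def using 1 2 i by auto
qed

lemma exp_decay_conv':
  fixes f g :: "real \<Rightarrow> 'a::{real_normed_field,banach,second_countable_topology}"
  assumes \<rho>: "\<rho> \<ge> 0" and f: "exp_decay \<rho> X1 Y1 f" and g: "exp_decay \<rho> X2 Y2 g"
  shows "exp_decay \<rho> (X1 * X2) (Y1 * X2) (conv f g)"
  using exp_decay_conv[OF \<rho> g f] by (simp add: conv_commute mult.commute)

text \<open>The majorant principle for a product: domination of values by \<open>F\<close>,
  \<open>G\<close> and of increments by the increments of \<open>F\<close>, \<open>G\<close> passes
  to the convolution. The three conclusions have the shape of the hypotheses, so the step can be
  repeated for a triple product.\<close>

lemma conv_compare:
  fixes f g f' g' :: "real \<Rightarrow> 'a::{real_normed_field,banach,second_countable_topology}" and F G F' G' :: "real \<Rightarrow> real"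
  assumes F: "integrable lborel F" and F': "integrable lborel F'"
    and G [measurable]: "G \<in> borel_measurable borel" and G' [measurable]: "G' \<in> borel_measurable borel"
    and B: "\<And>\<xi>. \<bar>G \<xi>\<bar> \<le> B" "\<And>\<xi>. \<bar>G' \<xi>\<bar> \<le> B"
    and [measurable]: "f \<in> borel_measurable borel" "f' \<in> borel_measurable borel" "g \<in> borel_measurable borel" "g' \<in> borel_measurable borel"
    and fF: "\<And>\<xi>. norm (f \<xi>) \<le> F \<xi>" "\<And>\<xi>. norm (f' \<xi>) \<le> F' \<xi>" "\<And>\<xi>. norm (f \<xi> - f' \<xi>) \<le> F \<xi> - F' \<xi>"
    and gG: "\<And>\<xi>. norm (g \<xi>) \<le> G \<xi>" "\<And>\<xi>. norm (g' \<xi>) \<le> G' \<xi>" "\<And>\<xi>. norm (g \<xi> - g' \<xi>) \<le> G \<xi> - G' \<xi>"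
  shows "norm (conv f g \<xi>) \<le> conv F G \<xi>" "norm (conv f' g' \<xi>) \<le> conv F' G' \<xi>"
    "norm (conv f g \<xi> - conv f' g' \<xi>) \<le> conv F G \<xi> - conv F' G' \<xi>"
proof -
  have "integrable lborel f"
    by (rule Bochner_Integration.integrable_bound[OF F]) (auto intro!: AE_I2 order_trans[OF fF(1)])
  moreover have "integrable lborel f'"
    by (rule Bochner_Integration.integrable_bound[OF F']) (auto intro!: AE_I2 order_trans[OF fF(2)])
  ultimately have fi: "integrable lborel f" "integrable lborel f'" .
  have gb: "\<And>\<xi>. norm (g \<xi>) \<le> B" "\<And>\<xi>. norm (g' \<xi>) \<le> B"
    using gG B by (meson abs_ge_self order_trans)+
  have i1: "integrable lborel (\<lambda>\<eta>. f \<eta> * g (\<xi> - \<eta>))" and i2: "integrable lborel (\<lambda>\<eta>. f' \<eta> * g' (\<xi> - \<eta>))"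
    and i3: "integrable lborel (\<lambda>\<eta>. F \<eta> * G (\<xi> - \<eta>))" and i4: "integrable lborel (\<lambda>\<eta>. F' \<eta> * G' (\<xi> - \<eta>))"
    by (rule conv_integrand_integrable[where B = B]; use fi F F' B gb in simp)+
  have nn: "F \<eta> \<ge> 0" "F' \<eta> \<ge> 0" "G \<eta> \<ge> 0" "G' \<eta> \<ge> 0" for \<eta>
    using fF gG by (meson norm_ge_zero order_trans)+
  show "norm (conv f g \<xi>) \<le> conv F G \<xi>"
    unfolding conv_def using fF gG nn by (intro Bochner_Integration.integral_norm_bound_integral i1 i3) (auto simp: norm_mult intro!: mult_mono)
  show "norm (conv f' g' \<xi>) \<le> conv F' G' \<xi>"
    unfolding conv_def using fF gG nn by (intro Bochner_Integration.integral_norm_bound_integral i2 i4) (auto simp: norm_mult intro!: mult_mono)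
  have "norm (LINT \<eta>|lborel. f \<eta> * g (\<xi> - \<eta>) - f' \<eta> * g' (\<xi> - \<eta>)) \<le> (LINT \<eta>|lborel. F \<eta> * G (\<xi> - \<eta>) - F' \<eta> * G' (\<xi> - \<eta>))"
  proof (rule Bochner_Integration.integral_norm_bound_integral)
    fix \<eta>
    \<comment> \<open>The same telescoping for the majorants is an identity, so the two bounds
      recombine to exactly F G - F' G' without loss.\<close>
    have "f \<eta> * g (\<xi> - \<eta>) - f' \<eta> * g' (\<xi> - \<eta>) = (f \<eta> - f' \<eta>) * g (\<xi> - \<eta>) + f' \<eta> * (g (\<xi> - \<eta>) - g' (\<xi> - \<eta>))"
      by (simp add: algebra_simps)
    then have "norm (f \<eta> * g (\<xi> - \<eta>) - f' \<eta> * g' (\<xi> - \<eta>)) \<le> norm (f \<eta> - f' \<eta>) * norm (g (\<xi> - \<eta>)) + norm (f' \<eta>) * norm (g (\<xi> - \<eta>) - g' (\<xi> - \<eta>))"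
      by (metis norm_mult norm_triangle_ineq)
    also have "\<dots> \<le> (F \<eta> - F' \<eta>) * G (\<xi> - \<eta>) + F' \<eta> * (G (\<xi> - \<eta>) - G' (\<xi> - \<eta>))"
      using fF gG nn order_trans[OF norm_ge_zero fF(3)] by (intro add_mono mult_mono) auto
    also have "\<dots> = F \<eta> * G (\<xi> - \<eta>) - F' \<eta> * G' (\<xi> - \<eta>)" by (simp add: algebra_simps)
    finally show "norm (f \<eta> * g (\<xi> - \<eta>) - f' \<eta> * g' (\<xi> - \<eta>)) \<le> F \<eta> * G (\<xi> - \<eta>) - F' \<eta> * G' (\<xi> - \<eta>)" .
  qed (use i1 i2 i3 i4 in auto)
  then show "norm (conv f g \<xi> - conv f' g' \<xi>) \<le> conv F G \<xi> - conv F' G' \<xi>"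
    unfolding conv_def using i1 i2 i3 i4 by simp
qed

lemma conv_tendsto:
  fixes f g :: "nat \<Rightarrow> real \<Rightarrow> complex"
  assumes F: "integrable lborel F" and B: "\<And>n \<xi>. norm (g n \<xi>) \<le> B"
    and [measurable]: "\<And>n. f n \<in> borel_measurable borel" "\<And>n. g n \<in> borel_measurable borel" "f' \<in> borel_measurable borel" "g' \<in> borel_measurable borel"
    and fF: "\<And>n \<xi>. norm (f n \<xi>) \<le> F \<xi>"
    and lim: "\<And>\<xi>. (\<lambda>n. f n \<xi>) \<longlonglongrightarrow> f' \<xi>" "\<And>\<xi>. (\<lambda>n. g n \<xi>) \<longlonglongrightarrow> g' \<xi>"
  shows "(\<lambda>n. conv (f n) (g n) \<xi>) \<longlonglongrightarrow> conv f' g' \<xi>"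
  unfolding conv_def
proof (rule integral_dominated_convergence[where w = "\<lambda>\<eta>. F \<eta> * B"])
  show "AE \<eta> in lborel. (\<lambda>n. f n \<eta> * g n (\<xi> - \<eta>)) \<longlonglongrightarrow> f' \<eta> * g' (\<xi> - \<eta>)"
    using lim by (auto intro!: tendsto_mult)
  fix n
  show "AE \<eta> in lborel. norm (f n \<eta> * g n (\<xi> - \<eta>)) \<le> F \<eta> * B"
    using fF B order_trans[OF norm_ge_zero fF] by (auto simp: norm_mult intro!: mult_mono)
qed (use F in auto)

lemma exp_decay_reflect:
  assumes "exp_decay \<rho> X Y f"
  shows "exp_decay \<rho> X Y (\<lambda>\<zeta>. f (- \<zeta>))"
proof -
  note [measurable] = exp_decay_measurable[OF assms]
  show ?thesis
    using assms lborel_integrable_reflect[of "\<lambda>\<xi>. exp (\<rho> * \<bar>\<xi>\<bar>) * norm (f \<xi>)" 0]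
      lborel_integral_reflect[of "\<lambda>\<xi>. exp (\<rho> * \<bar>\<xi>\<bar>) * norm (f \<xi>)" 0]
    unfolding exp_decay_def by (auto dest: spec[of _ "- _"])
qed

lemma exp_decay_mono:
  "exp_decay \<rho> X Y f \<Longrightarrow> X \<le> X' \<Longrightarrow> Y \<le> Y' \<Longrightarrow> exp_decay \<rho> X' Y' f"
  unfolding exp_decay_def by (meson order_trans)

lemma exp_decay_norm: "exp_decay \<rho> X Y f \<Longrightarrow> exp_decay \<rho> X Y (\<lambda>\<xi>. norm (f \<xi>))"
  unfolding exp_decay_def by auto

lemma exp_decay_dominated:
  assumes F: "exp_decay \<rho> X Y F" and f: "f \<in> borel_measurable borel" "\<And>\<xi>. norm (f \<xi>) \<le> norm (F \<xi>)"
  shows "exp_decay \<rho> X Y f"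
proof -
  note [measurable] = f(1)
  have le: "exp (\<rho> * \<bar>\<xi>\<bar>) * norm (f \<xi>) \<le> exp (\<rho> * \<bar>\<xi>\<bar>) * norm (F \<xi>)" for \<xi>
    using f by (intro mult_left_mono) auto
  have Fi: "integrable lborel (\<lambda>\<xi>. exp (\<rho> * \<bar>\<xi>\<bar>) * norm (F \<xi>))" using F by (simp add: exp_decay_def)
  have fi: "integrable lborel (\<lambda>\<xi>. exp (\<rho> * \<bar>\<xi>\<bar>) * norm (f \<xi>))"
    by (rule Bochner_Integration.integrable_bound[OF Fi]) (use le in auto)
  have "(LINT \<xi>|lborel. exp (\<rho> * \<bar>\<xi>\<bar>) * norm (f \<xi>)) \<le> (LINT \<xi>|lborel. exp (\<rho> * \<bar>\<xi>\<bar>) * norm (F \<xi>))"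
    by (rule integral_mono[OF fi Fi le])
  then show ?thesis using F fi f(1) le unfolding exp_decay_def by (meson order_trans)
qed

lemma exp_decay_add:
  assumes f: "exp_decay \<rho> X1 Y1 f" and g: "exp_decay \<rho> X2 Y2 g"
  shows "exp_decay \<rho> (X1 + X2) (Y1 + Y2) (\<lambda>\<xi>. f \<xi> + g \<xi>)"
proof -
  note [measurable] = exp_decay_measurable[OF f] exp_decay_measurable[OF g]
  have i: "integrable lborel (\<lambda>\<xi>. exp (\<rho> * \<bar>\<xi>\<bar>) * norm (f \<xi>))" "integrable lborel (\<lambda>\<xi>. exp (\<rho> * \<bar>\<xi>\<bar>) * norm (g \<xi>))"
    and l: "(LINT \<xi>|lborel. exp (\<rho> * \<bar>\<xi>\<bar>) * norm (f \<xi>)) \<le> X1" "(LINT \<xi>|lborel. exp (\<rho> * \<bar>\<xi>\<bar>) * norm (g \<xi>)) \<le> X2"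
    and y: "\<And>\<xi>. exp (\<rho> * \<bar>\<xi>\<bar>) * norm (f \<xi>) \<le> Y1" "\<And>\<xi>. exp (\<rho> * \<bar>\<xi>\<bar>) * norm (g \<xi>) \<le> Y2"
    using f g by (auto simp: exp_decay_def)
  have le: "exp (\<rho> * \<bar>\<xi>\<bar>) * norm (f \<xi> + g \<xi>) \<le> exp (\<rho> * \<bar>\<xi>\<bar>) * norm (f \<xi>) + exp (\<rho> * \<bar>\<xi>\<bar>) * norm (g \<xi>)" for \<xi>
    unfolding distrib_left[symmetric] by (intro mult_left_mono norm_triangle_ineq) auto
  have si: "integrable lborel (\<lambda>\<xi>. exp (\<rho> * \<bar>\<xi>\<bar>) * norm (f \<xi>) + exp (\<rho> * \<bar>\<xi>\<bar>) * norm (g \<xi>))"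
    using i by simp
  have fi: "integrable lborel (\<lambda>\<xi>. exp (\<rho> * \<bar>\<xi>\<bar>) * norm (f \<xi> + g \<xi>))"
    by (rule Bochner_Integration.integrable_bound[OF si]) (use le in auto)
  have "(LINT \<xi>|lborel. exp (\<rho> * \<bar>\<xi>\<bar>) * norm (f \<xi> + g \<xi>)) \<le> X1 + X2"
    using integral_mono[OF fi si le] i l by simp
  moreover have "exp (\<rho> * \<bar>\<xi>\<bar>) * norm (f \<xi> + g \<xi>) \<le> Y1 + Y2" for \<xi>
    using le[of \<xi>] y[of \<xi>] by linarith
  ultimately show ?thesis using fi unfolding exp_decay_def by auto
qed

lemma exp_decay_cmult:
  fixes f :: "real \<Rightarrow> real"
  assumes "exp_decay \<rho> X Y f" "c \<ge> 0"
  shows "exp_decay \<rho> (c * X) (c * Y) (\<lambda>\<xi>. c * f \<xi>)"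
proof -
  have e: "exp (\<rho> * \<bar>\<xi>\<bar>) * norm (c * f \<xi>) = c * (exp (\<rho> * \<bar>\<xi>\<bar>) * norm (f \<xi>))" for \<xi>
    using assms(2) by (simp add: abs_mult)
  show ?thesis using assms unfolding exp_decay_def e
    by (auto intro: mult_left_mono)
qed

text \<open>That is, the double integral of \<open>f \<eta> * g \<zeta> * h (\<xi> - \<eta> + \<zeta>)\<close>.\<close>

definition triconv :: "(real \<Rightarrow> 'a) \<Rightarrow> (real \<Rightarrow> 'a) \<Rightarrow> (real \<Rightarrow> 'a) \<Rightarrow> real \<Rightarrow> 'a::{real_normed_field,banach,second_countable_topology}" where
  "triconv f g h = conv f (conv (\<lambda>\<zeta>. g (- \<zeta>)) h)"

text \<open>One slot is measured in sup, the other two in L1, with a free choice of the slot. The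
  sup constants therefore enter linearly, and smallness conditions can be stated in L1 constants
  alone.\<close>

lemma exp_decay_triconv:
  assumes \<rho>: "\<rho> \<ge> 0" and f: "exp_decay \<rho> X1 Y1 f" and g: "exp_decay \<rho> X2 Y2 g" and h: "exp_decay \<rho> X3 Y3 h"
  shows "exp_decay \<rho> (X1 * (X2 * X3)) (Y1 * (X2 * X3)) (triconv f g h)"
    and "exp_decay \<rho> (X1 * (X2 * X3)) (X1 * (Y2 * X3)) (triconv f g h)"
    and "exp_decay \<rho> (X1 * (X2 * X3)) (X1 * (X2 * Y3)) (triconv f g h)"
  unfolding triconv_def
  using exp_decay_conv'[OF \<rho> f exp_decay_conv[OF \<rho> exp_decay_reflect[OF g] h]]
    exp_decay_conv[OF \<rho> f exp_decay_conv'[OF \<rho> exp_decay_reflect[OF g] h]]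
    exp_decay_conv[OF \<rho> f exp_decay_conv[OF \<rho> exp_decay_reflect[OF g] h]] by auto

lemma triconv_compare:
  fixes f g h f' g' h' :: "real \<Rightarrow> 'a::{real_normed_field,banach,second_countable_topology}" and F G H F' G' H' :: "real \<Rightarrow> real"
  assumes \<rho>: "\<rho> \<ge> 0" and F: "exp_decay \<rho> X Y F" "exp_decay \<rho> X Y F'" and G: "exp_decay \<rho> X Y G" "exp_decay \<rho> X Y G'"
    and H: "exp_decay \<rho> X Y H" "exp_decay \<rho> X Y H'"
    and m [measurable]: "f \<in> borel_measurable borel" "f' \<in> borel_measurable borel" "g \<in> borel_measurable borel"
      "g' \<in> borel_measurable borel" "h \<in> borel_measurable borel" "h' \<in> borel_measurable borel"
    and fF: "\<And>\<xi>. norm (f \<xi>) \<le> F \<xi>" "\<And>\<xi>. norm (f' \<xi>) \<le> F' \<xi>" "\<And>\<xi>. norm (f \<xi> - f' \<xi>) \<le> F \<xi> - F' \<xi>"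
    and gG: "\<And>\<xi>. norm (g \<xi>) \<le> G \<xi>" "\<And>\<xi>. norm (g' \<xi>) \<le> G' \<xi>" "\<And>\<xi>. norm (g \<xi> - g' \<xi>) \<le> G \<xi> - G' \<xi>"
    and hH: "\<And>\<xi>. norm (h \<xi>) \<le> H \<xi>" "\<And>\<xi>. norm (h' \<xi>) \<le> H' \<xi>" "\<And>\<xi>. norm (h \<xi> - h' \<xi>) \<le> H \<xi> - H' \<xi>"
  shows "norm (triconv f g h \<xi>) \<le> triconv F G H \<xi>"
    "norm (triconv f g h \<xi> - triconv f' g' h' \<xi>) \<le> triconv F G H \<xi> - triconv F' G' H' \<xi>"
proof -
  define gr gr' Gr Gr' where "gr = (\<lambda>\<zeta>. g (- \<zeta>))" and "gr' = (\<lambda>\<zeta>. g' (- \<zeta>))"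
    and "Gr = (\<lambda>\<zeta>. G (- \<zeta>))" and "Gr' = (\<lambda>\<zeta>. G' (- \<zeta>))"
  have mr: "gr \<in> borel_measurable borel" "gr' \<in> borel_measurable borel"
    unfolding gr_def gr'_def by measurable
  have Gr: "exp_decay \<rho> X Y Gr" "exp_decay \<rho> X Y Gr'"
    unfolding Gr_def Gr'_def using G[THEN exp_decay_reflect] by auto
  have gGr: "\<And>\<xi>. norm (gr \<xi>) \<le> Gr \<xi>" "\<And>\<xi>. norm (gr' \<xi>) \<le> Gr' \<xi>" "\<And>\<xi>. norm (gr \<xi> - gr' \<xi>) \<le> Gr \<xi> - Gr' \<xi>"
    unfolding gr_def gr'_def Gr_def Gr'_def using gG by auto
  have E: "exp_decay \<rho> (X * X) (X * Y) (conv Gr H)" "exp_decay \<rho> (X * X) (X * Y) (conv Gr' H')"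
    using exp_decay_conv[OF \<rho> Gr(1) H(1)] exp_decay_conv[OF \<rho> Gr(2) H(2)] by auto
  note inner = conv_compare[OF exp_decay_integrable[OF Gr(1) \<rho>] exp_decay_integrable[OF Gr(2) \<rho>]
    exp_decay_measurable[OF H(1)] exp_decay_measurable[OF H(2)]
    exp_decay_le[OF H(1) \<rho>, unfolded real_norm_def] exp_decay_le[OF H(2) \<rho>, unfolded real_norm_def] mr m(5,6) gGr hH]
  note outer = conv_compare[OF exp_decay_integrable[OF F(1) \<rho>] exp_decay_integrable[OF F(2) \<rho>]
    exp_decay_measurable[OF E(1)] exp_decay_measurable[OF E(2)]
    exp_decay_le[OF E(1) \<rho>, unfolded real_norm_def] exp_decay_le[OF E(2) \<rho>, unfolded real_norm_def] m(1,2)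
    borel_measurable_conv[OF mr(1) m(5)] borel_measurable_conv[OF mr(2) m(6)] fF inner]
  show "norm (triconv f g h \<xi>) \<le> triconv F G H \<xi>"
    "norm (triconv f g h \<xi> - triconv f' g' h' \<xi>) \<le> triconv F G H \<xi> - triconv F' G' H' \<xi>"
    unfolding triconv_def using outer(1,3)[of \<xi>] unfolding gr_def gr'_def Gr_def Gr'_def by auto
qed

lemma conv_diff_left:
  fixes f g f' :: "real \<Rightarrow> 'a::{real_normed_field,banach,second_countable_topology}"
  assumes "exp_decay \<rho> X Y f" "exp_decay \<rho> X1 Y1 f'" "exp_decay \<rho> X2 Y2 g" "\<rho> \<ge> 0"
  shows "conv (\<lambda>\<xi>. f \<xi> - f' \<xi>) g \<xi> = conv f g \<xi> - conv f' g \<xi>"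
  unfolding conv_def left_diff_distrib using assms
  by (intro Bochner_Integration.integral_diff conv_integrand_integrable[where B = Y2])
    (auto intro: exp_decay_integrable exp_decay_measurable exp_decay_le)

lemma conv_diff_right:
  fixes f g g' :: "real \<Rightarrow> 'a::{real_normed_field,banach,second_countable_topology}"
  assumes "exp_decay \<rho> X Y g" "exp_decay \<rho> X1 Y1 g'" "exp_decay \<rho> X2 Y2 f" "\<rho> \<ge> 0"
  shows "conv f (\<lambda>\<xi>. g \<xi> - g' \<xi>) \<xi> = conv f g \<xi> - conv f g' \<xi>"
  using conv_diff_left[OF assms] by (simp add: conv_commute)

text \<open>Telescoping over the three slots leaves three terms, each with the difference in one
  slot measured in sup and a factor \<open>X\<close> from each of the other two.\<close>

lemma triconv_diff_bound:
  fixes G G' :: "real \<Rightarrow> real"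
  assumes \<rho>: "\<rho> \<ge> 0" and G: "exp_decay \<rho> X Y G" "exp_decay \<rho> X Y G'" and D: "exp_decay \<rho> XD YD (\<lambda>\<xi>. G \<xi> - G' \<xi>)"
  shows "\<bar>triconv G G G \<xi> - triconv G' G' G' \<xi>\<bar> \<le> 3 * (X * X * YD)"
proof -
  define D' where "D' = (\<lambda>\<xi>. G \<xi> - G' \<xi>)"
  note Gr = G[THEN exp_decay_reflect]
  have D: "exp_decay \<rho> XD YD D'" using D by (simp add: D'_def)
  have c: "conv (\<lambda>\<zeta>. G (- \<zeta>)) G \<zeta> - conv (\<lambda>\<zeta>. G' (- \<zeta>)) G' \<zeta>
     = conv (\<lambda>\<zeta>. D' (- \<zeta>)) G \<zeta> + conv (\<lambda>\<zeta>. G' (- \<zeta>)) D' \<zeta>" for \<zeta>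
    unfolding D'_def
    using conv_diff_left[OF Gr(1) Gr(2) G(1) \<rho>, of \<zeta>] conv_diff_right[OF G(1) G(2) Gr(2) \<rho>, of \<zeta>] by simp
  note E1 = exp_decay_conv[OF \<rho> Gr(1) G(1)] and E2 = exp_decay_conv[OF \<rho> Gr(2) G(2)]
  note F1 = exp_decay_conv'[OF \<rho> exp_decay_reflect[OF D] G(1)] and F2 = exp_decay_conv[OF \<rho> Gr(2) D]
  have "triconv G G G \<xi> - triconv G' G' G' \<xi> = conv D' (conv (\<lambda>\<zeta>. G (- \<zeta>)) G) \<xi>
     + conv G' (\<lambda>\<zeta>. conv (\<lambda>\<zeta>. G (- \<zeta>)) G \<zeta> - conv (\<lambda>\<zeta>. G' (- \<zeta>)) G' \<zeta>) \<xi>"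
    unfolding triconv_def D'_def
    using conv_diff_left[OF G(1) G(2) E1 \<rho>, of \<xi>] conv_diff_right[OF E1 E2 G(2) \<rho>, of \<xi>] by simp
  moreover have "\<bar>conv D' (conv (\<lambda>\<zeta>. G (- \<zeta>)) G) \<xi>\<bar> \<le> YD * (X * X)"
    using exp_decay_le[OF exp_decay_conv'[OF \<rho> D E1] \<rho>, of \<xi>] by simp
  moreover have "\<bar>conv G' (\<lambda>\<zeta>. conv (\<lambda>\<zeta>. G (- \<zeta>)) G \<zeta> - conv (\<lambda>\<zeta>. G' (- \<zeta>)) G' \<zeta>) \<xi>\<bar> \<le> X * (YD * X + X * YD)"
    unfolding c using exp_decay_le[OF exp_decay_conv[OF \<rho> G(2) exp_decay_add[OF F1 F2]] \<rho>, of \<xi>] by simp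
  ultimately show ?thesis by (simp add: algebra_simps)
qed

section \<open>The cubic nonlinearity on the Fourier side\<close>

lemma borel_measurable_cis [measurable]: "cis \<in> borel_measurable borel"
  by (intro borel_measurable_continuous_onI continuous_intros)

lemma borel_measurable_cnj [measurable]: "cnj \<in> borel_measurable borel"
  by (intro borel_measurable_continuous_onI continuous_intros)

text \<open>If \<open>v\<close> is the transform of u, this is the transform of |u|^2 u up to the
  factor 1/(2 pi)^2: \<open>triconv\<close> reflects its second argument, and the conjugate of
  v(-\<zeta>) is the transform of the conjugate of u.\<close>

definition cubic :: "(real \<Rightarrow> complex) \<Rightarrow> real \<Rightarrow> complex" where
  "cubic v = triconv v (\<lambda>\<xi>. cnj (v \<xi>)) v"

lemma cubic_compare:
  assumes \<rho>: "\<rho> \<ge> 0" and G: "exp_decay \<rho> X Y G" "exp_decay \<rho> X Y G'"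
    and [measurable]: "v \<in> borel_measurable borel" "v' \<in> borel_measurable borel"
    and le: "\<And>\<xi>. norm (v \<xi>) \<le> G \<xi>" "\<And>\<xi>. norm (v' \<xi>) \<le> G' \<xi>" "\<And>\<xi>. norm (v \<xi> - v' \<xi>) \<le> G \<xi> - G' \<xi>"
  shows "norm (cubic v \<xi>) \<le> triconv G G G \<xi>" "norm (cubic v \<xi> - cubic v' \<xi>) \<le> triconv G G G \<xi> - triconv G' G' G' \<xi>"
proof -
  have d: "norm (cnj (v \<xi>) - cnj (v' \<xi>)) \<le> G \<xi> - G' \<xi>" for \<xi>
    using le(3)[of \<xi>] by (metis complex_cnj_diff complex_mod_cnj)
  show "norm (cubic v \<xi>) \<le> triconv G G G \<xi>"
    unfolding cubic_def by (rule triconv_compare(1)[OF \<rho> G G G, where f = v and f' = v' and g = "\<lambda>\<xi>. cnj (v \<xi>)"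
        and g' = "\<lambda>\<xi>. cnj (v' \<xi>)" and h = v and h' = v']; use le d in simp)
  show "norm (cubic v \<xi> - cubic v' \<xi>) \<le> triconv G G G \<xi> - triconv G' G' G' \<xi>"
    unfolding cubic_def by (rule triconv_compare(2)[OF \<rho> G G G, where f = v and f' = v' and g = "\<lambda>\<xi>. cnj (v \<xi>)"
        and g' = "\<lambda>\<xi>. cnj (v' \<xi>)" and h = v and h' = v']; use le d in simp)
qed

lemma exp_decay_cubic: 
  assumes "\<rho> \<ge> 0" "exp_decay \<rho> X Y v"
  shows "exp_decay \<rho> (X * (X * X)) (X * (X * Y)) (cubic v)"
proof -
  have "exp_decay \<rho> X Y (\<lambda>\<xi>. cnj (v \<xi>))"
    using exp_decay_measurable[OF assms(2)] by (intro exp_decay_dominated[OF assms(2)]) auto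
  then show ?thesis unfolding cubic_def by (intro exp_decay_triconv(3)[OF assms(1) assms(2) _ assms(2)])
qed

text \<open>Dominated convergence twice: the inner convolution converges pointwise and stays below X
  Y, which is the uniform bound required of the second factor outside. The statement serves both the
  limit of the iteration and continuity in time.\<close>

lemma cubic_tendsto:
  assumes \<rho>: "\<rho> > 0"
    and [measurable]: "\<And>n. v n \<in> borel_measurable borel" "v' \<in> borel_measurable borel"
    and G: "exp_decay \<rho> X Y G" and le: "\<And>n \<xi>. norm (v n \<xi>) \<le> norm (G \<xi>)"
    and lim: "\<And>\<xi>. (\<lambda>n. v n \<xi>) \<longlonglongrightarrow> v' \<xi>"
  shows "(\<lambda>n. cubic (v n) \<xi>) \<longlonglongrightarrow> cubic v' \<xi>"
proof -
  have e: "exp_decay \<rho> X Y (v n)" for n by (rule exp_decay_dominated[OF G _ le]) simp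
  have ec: "exp_decay \<rho> X Y (\<lambda>\<xi>. cnj (v n \<xi>))" for n by (rule exp_decay_dominated[OF e[of n]]) auto
  note B = exp_decay_le[OF G less_imp_le[OF \<rho>]]
  note iG = exp_decay_integrable[OF exp_decay_norm[OF G] less_imp_le[OF \<rho>]]
  have 1: "(\<lambda>n. conv (\<lambda>\<zeta>. cnj (v n (- \<zeta>))) (v n) \<xi>) \<longlonglongrightarrow> conv (\<lambda>\<zeta>. cnj (v' (- \<zeta>))) v' \<xi>" for \<xi>
    by (rule conv_tendsto[where F = "\<lambda>\<zeta>. norm (G (- \<zeta>))" and B = Y])
      (use lim le B lborel_integrable_reflect[of "\<lambda>\<xi>. norm (G \<xi>)" 0] iG order_trans[OF le B] in \<open>auto intro: tendsto_cnj\<close>)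
  show ?thesis unfolding cubic_def triconv_def
  proof (rule conv_tendsto[OF iG, where B = "X * Y"])
    show "norm (conv (\<lambda>\<zeta>. cnj (v n (- \<zeta>))) (v n) \<xi>) \<le> X * Y" for n \<xi>
      by (rule exp_decay_le[OF exp_decay_conv[OF less_imp_le[OF \<rho>] exp_decay_reflect[OF ec[of n]] e[of n]]]) (use \<rho> in simp)
  qed (use le lim 1 in auto)
qed

section \<open>Differentiation under the integral sign\<close>

lemma has_vector_derivative_iff_quotient:
  fixes f :: "real \<Rightarrow> 'a::real_normed_vector"
  shows "(f has_vector_derivative D) (at t within S) \<longleftrightarrow> ((\<lambda>x. (f x - f t) /\<^sub>R (x - t)) \<longlongrightarrow> D) (at t within S)"
proof -
  have "norm (f x - f t - (x - t) *\<^sub>R D) / norm (x - t) = norm ((f x - f t) /\<^sub>R (x - t) - D)" if "x \<noteq> t" for x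
  proof -
    have "(f x - f t) /\<^sub>R (x - t) - D = (f x - f t - (x - t) *\<^sub>R D) /\<^sub>R (x - t)"
      using that by (simp add: scaleR_diff_right)
    then show ?thesis by (simp add: divide_inverse abs_inverse)
  qed
  then have "((\<lambda>x. norm (f x - f t - (x - t) *\<^sub>R D) / norm (x - t)) \<longlongrightarrow> 0) (at t within S)
      \<longleftrightarrow> ((\<lambda>x. norm ((f x - f t) /\<^sub>R (x - t) - D)) \<longlongrightarrow> 0) (at t within S)"
    by (intro Lim_cong_within) auto
  then show ?thesis
    unfolding has_vector_derivative_def has_derivative_iff_norm
    by (simp add: tendsto_norm_zero_iff LIM_zero_iff bounded_linear_scaleR_left)
qed

lemma has_vector_derivative_bound:
  fixes f :: "real \<Rightarrow> 'a::real_normed_vector"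
  assumes d: "\<And>t. t \<in> {a..b} \<Longrightarrow> (f has_vector_derivative f' t) (at t within {a..b})"
    and B: "\<And>t. t \<in> {a..b} \<Longrightarrow> norm (f' t) \<le> B" and "x \<in> {a..b}" "y \<in> {a..b}"
  shows "norm (f x - f y) \<le> B * \<bar>x - y\<bar>"
proof -
  have "norm (f x - f y) \<le> B * norm (x - y)"
  proof (rule differentiable_bound[where f' = "\<lambda>t h. h *\<^sub>R f' t"])
    show "(f has_derivative (\<lambda>h. h *\<^sub>R f' t)) (at t within {a..b})" if "t \<in> {a..b}" for t
      using d[OF that] by (simp add: has_vector_derivative_def)
    show "onorm (\<lambda>h. h *\<^sub>R f' t) \<le> B" if "t \<in> {a..b}" for t
      using B[OF that] by (intro onorm_bound) (auto intro: order_trans[OF norm_ge_zero] simp: mult.commute[of "\<bar>_\<bar>"] mult_right_mono)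
  qed (use assms in auto)
  then show ?thesis by simp
qed

text \<open>Dominated convergence for difference quotients, with the domination supplied by the mean
  value inequality. Working within \<open>{a..b}\<close> includes the one-sided derivatives at the
  end points, which the notion of solution asks for.\<close>

lemma has_vector_derivative_lebesgue_integral:
  fixes f f' :: "real \<Rightarrow> real \<Rightarrow> 'a::{banach,second_countable_topology}"
  assumes i: "\<And>t. t \<in> {a..b} \<Longrightarrow> integrable lborel (f t)"
    and [measurable]: "f' t \<in> borel_measurable borel"
    and d: "\<And>\<tau> \<xi>. \<tau> \<in> {a..b} \<Longrightarrow> ((\<lambda>\<tau>. f \<tau> \<xi>) has_vector_derivative f' \<tau> \<xi>) (at \<tau> within {a..b})"
    and B: "\<And>\<tau> \<xi>. \<tau> \<in> {a..b} \<Longrightarrow> norm (f' \<tau> \<xi>) \<le> H \<xi>" and H: "integrable lborel H"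
    and t: "t \<in> {a..b}"
  shows "((\<lambda>\<tau>. LINT \<xi>|lborel. f \<tau> \<xi>) has_vector_derivative (LINT \<xi>|lborel. f' t \<xi>)) (at t within {a..b})"
  unfolding has_vector_derivative_iff_quotient tendsto_at_iff_sequentially
proof (intro allI impI)
  fix x :: "nat \<Rightarrow> real" assume x: "\<forall>n. x n \<in> {a..b} - {t}" and lim: "x \<longlonglongrightarrow> t"
  have xm: "x n \<in> {a..b}" "x n \<noteq> t" for n using x by auto
  have m [measurable]: "f (x n) \<in> borel_measurable borel" "f t \<in> borel_measurable borel" for n
    using i[OF xm(1)] i[OF t] by (auto dest: borel_measurable_integrable)
  have "(\<lambda>n. LINT \<xi>|lborel. (f (x n) \<xi> - f t \<xi>) /\<^sub>R (x n - t)) \<longlonglongrightarrow> (LINT \<xi>|lborel. f' t \<xi>)"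
  proof (rule integral_dominated_convergence[OF _ _ H])
    show "AE \<xi> in lborel. (\<lambda>n. (f (x n) \<xi> - f t \<xi>) /\<^sub>R (x n - t)) \<longlonglongrightarrow> f' t \<xi>"
    proof (rule AE_I2)
      fix \<xi>
      show "(\<lambda>n. (f (x n) \<xi> - f t \<xi>) /\<^sub>R (x n - t)) \<longlonglongrightarrow> f' t \<xi>"
        using d[OF t, of \<xi>] x lim unfolding has_vector_derivative_iff_quotient tendsto_at_iff_sequentially
        by (auto simp: o_def)
    qed
    fix n
    show "AE \<xi> in lborel. norm ((f (x n) \<xi> - f t \<xi>) /\<^sub>R (x n - t)) \<le> H \<xi>"
    proof (rule AE_I2)
      fix \<xi>
      have "norm (f (x n) \<xi> - f t \<xi>) \<le> H \<xi> * \<bar>x n - t\<bar>"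
        by (rule has_vector_derivative_bound[OF d B xm(1) t])
      moreover have "norm ((f (x n) \<xi> - f t \<xi>) /\<^sub>R (x n - t)) = norm (f (x n) \<xi> - f t \<xi>) / \<bar>x n - t\<bar>"
        by (simp add: abs_inverse divide_inverse_commute)
      ultimately show "norm ((f (x n) \<xi> - f t \<xi>) /\<^sub>R (x n - t)) \<le> H \<xi>"
        using xm(2)[of n] by (simp add: pos_divide_le_eq)
    qed
  qed measurable
  moreover have "(LINT \<xi>|lborel. (f (x n) \<xi> - f t \<xi>) /\<^sub>R (x n - t)) = ((LINT \<xi>|lborel. f (x n) \<xi>) - (LINT \<xi>|lborel. f t \<xi>)) /\<^sub>R (x n - t)" for n
    using i[OF xm(1)] i[OF t] by simp
  ultimately show "((\<lambda>\<tau>. ((LINT \<xi>|lborel. f \<tau> \<xi>) - (LINT \<xi>|lborel. f t \<xi>)) /\<^sub>R (\<tau> - t)) \<circ> x) \<longlonglongrightarrow> (LINT \<xi>|lborel. f' t \<xi>)"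
    by (simp only: o_def)
qed

text \<open>Take logarithms: ln(1+\<xi>^2) \<le> 2 ln(1+|\<xi>|), and the tangent bound ln y \<le> y
  - 1 at y = d (1+|\<xi>|) yields linear growth of any prescribed slope.\<close>

lemma powr_exp_bounded:
  fixes a \<sigma> :: real
  assumes a: "a > 0"
  obtains C where "\<And>\<xi>. (1 + \<xi>\<^sup>2) powr \<sigma> * exp (- (a * \<bar>\<xi>\<bar>)) \<le> C"
proof
  \<comment> \<open>Positive and at least \<sigma>, so the power can be enlarged to
    \<open>k\<close>; then 2 k d = a lets the linear growth cancel the exponential exactly.\<close>
  define k where "k = \<bar>\<sigma>\<bar> + 1"
  define d where "d = a / (2 * k)"
  have k: "k > 0" "\<sigma> \<le> k" by (auto simp: k_def)
  have d: "d > 0" using a k by (simp add: d_def)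
  fix \<xi> :: real
  have "1 + \<xi>\<^sup>2 \<le> (1 + \<bar>\<xi>\<bar>)\<^sup>2" by (simp add: power2_eq_square algebra_simps)
  then have "ln (1 + \<xi>\<^sup>2) \<le> ln ((1 + \<bar>\<xi>\<bar>)\<^sup>2)" by (subst ln_le_cancel_iff) (auto simp: add_pos_nonneg)
  also have "\<dots> = 2 * ln (1 + \<bar>\<xi>\<bar>)" by (simp add: ln_realpow)
  also have "ln (1 + \<bar>\<xi>\<bar>) = ln (d * (1 + \<bar>\<xi>\<bar>)) - ln d" using d by (simp add: ln_mult add_nonneg_eq_0_iff)
  also have "ln (d * (1 + \<bar>\<xi>\<bar>)) \<le> d * (1 + \<bar>\<xi>\<bar>) - 1" using d by (intro ln_le_minus_one) (auto intro!: mult_pos_pos add_pos_nonneg)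
  finally have l: "ln (1 + \<xi>\<^sup>2) \<le> 2 * (d * (1 + \<bar>\<xi>\<bar>) - 1 - ln d)" by simp
  have "(1 + \<xi>\<^sup>2) powr \<sigma> \<le> (1 + \<xi>\<^sup>2) powr k" using k by (intro powr_mono) auto
  also have "\<dots> = exp (k * ln (1 + \<xi>\<^sup>2))" by (simp add: powr_def add_nonneg_eq_0_iff)
  also have "\<dots> \<le> exp (k * (2 * (d * (1 + \<bar>\<xi>\<bar>) - 1 - ln d)))" using l k by simp
  also have "k * (2 * (d * (1 + \<bar>\<xi>\<bar>) - 1 - ln d)) = a * \<bar>\<xi>\<bar> + (a - 2 * k * (1 + ln d))"
    using k by (simp add: d_def field_simps)
  finally have "(1 + \<xi>\<^sup>2) powr \<sigma> \<le> exp (a * \<bar>\<xi>\<bar>) * exp (a - 2 * k * (1 + ln d))" by (simp add: exp_add)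
  then have "(1 + \<xi>\<^sup>2) powr \<sigma> * exp (- (a * \<bar>\<xi>\<bar>)) \<le> exp (a * \<bar>\<xi>\<bar>) * exp (a - 2 * k * (1 + ln d)) * exp (- (a * \<bar>\<xi>\<bar>))"
    by (intro mult_right_mono) auto
  also have "\<dots> = exp (a - 2 * k * (1 + ln d))" by (simp add: exp_minus field_simps)
  finally show "(1 + \<xi>\<^sup>2) powr \<sigma> * exp (- (a * \<bar>\<xi>\<bar>)) \<le> exp (a - 2 * k * (1 + ln d))" .
qed

text \<open>One more power of 1 + \<xi>^2 is still bounded against the exponential; giving it back
  leaves the integrable 1/(1+\<xi>^2).\<close>

lemma powr_exp_integrable:
  fixes a \<sigma> :: real
  assumes a: "a > 0"
  shows "integrable lborel (\<lambda>\<xi>. (1 + \<xi>\<^sup>2) powr \<sigma> * exp (- (a * \<bar>\<xi>\<bar>)))"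
proof -
  obtain C where C: "\<And>\<xi>. (1 + \<xi>\<^sup>2) powr (\<sigma> + 1) * exp (- (a * \<bar>\<xi>\<bar>)) \<le> C"
    using powr_exp_bounded[OF a, of "\<sigma> + 1"] by blast
  have "integrable lborel (\<lambda>\<xi>. C * inverse (1 + \<xi>\<^sup>2))"
    using integrable_inverse_Suc_square by simp
  then show ?thesis
  proof (rule Bochner_Integration.integrable_bound)
    show "AE \<xi> in lborel. norm ((1 + \<xi>\<^sup>2) powr \<sigma> * exp (- (a * \<bar>\<xi>\<bar>))) \<le> norm (C * inverse (1 + \<xi>\<^sup>2))"
    proof (rule AE_I2)
      fix \<xi> :: real
      have p: "1 + \<xi>\<^sup>2 > 0" by (simp add: add_pos_nonneg)
      have "(1 + \<xi>\<^sup>2) powr \<sigma> * exp (- (a * \<bar>\<xi>\<bar>)) = (1 + \<xi>\<^sup>2) powr (\<sigma> + 1) * exp (- (a * \<bar>\<xi>\<bar>)) * inverse (1 + \<xi>\<^sup>2)"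
        using p by (simp add: powr_add)
      also have "\<dots> \<le> C * inverse (1 + \<xi>\<^sup>2)" using C[of \<xi>] p by (intro mult_right_mono) auto
      finally show "norm ((1 + \<xi>\<^sup>2) powr \<sigma> * exp (- (a * \<bar>\<xi>\<bar>))) \<le> norm (C * inverse (1 + \<xi>\<^sup>2))" by simp
    qed
  qed measurable
qed

lemma exp_integrable: "a > 0 \<Longrightarrow> integrable lborel (\<lambda>\<xi>::real. exp (- (a * \<bar>\<xi>\<bar>)))"
  using powr_exp_integrable[of a 0] by (simp add: add_nonneg_eq_0_iff)

lemma cis_has_vector_derivative:
  "((\<lambda>t. cis (- (t * b))) has_vector_derivative (- \<i> * of_real b * cis (- (t * b)))) (at t within S)"
proof -
  have "((\<lambda>z. exp (- \<i> * of_real b * z)) has_field_derivative (- \<i> * of_real b * exp (- \<i> * of_real b * of_real t))) (at (of_real t))"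
    by (auto intro!: derivative_eq_intros)
  from has_vector_derivative_real_field[OF this] show ?thesis
    by (simp add: cis_conv_exp algebra_simps)
qed

section \<open>Picard iteration\<close>

lemma integral_indicator_Icc: "(a::real) \<le> b \<Longrightarrow> (LINT \<xi>|lborel. indicator {a..b} \<xi> * (c::real)) = (b - a) * c"
  by simp

lemma integrable_indicator_Icc: "integrable lborel (\<lambda>\<xi>. indicator {a..b::real} \<xi> * (c::real))"
  by (intro integrable_mult_left integrable_real_indicator) (auto simp: emeasure_lborel_Icc_eq)

lemma set_integrable_bounded:
  fixes f :: "real \<Rightarrow> 'a::{banach,second_countable_topology}"
  assumes [measurable]: "f \<in> borel_measurable borel" and B: "\<And>\<tau>. \<tau> \<in> {a..b} \<Longrightarrow> norm (f \<tau>) \<le> B"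
  shows "set_integrable lborel {a..b} f"
  unfolding set_integrable_def
proof (rule Bochner_Integration.integrable_bound)
  show "integrable lborel (\<lambda>\<tau>. indicator {a..b} \<tau> * B :: real)"
    by (rule integrable_indicator_Icc)
  show "AE \<tau> in lborel. norm (indicator {a..b} \<tau> *\<^sub>R f \<tau>) \<le> norm (indicator {a..b} \<tau> * B)"
  proof (rule AE_I2)
    fix \<tau> show "norm (indicator {a..b} \<tau> *\<^sub>R f \<tau>) \<le> norm (indicator {a..b} \<tau> * B)"
      using B[of \<tau>] by (auto simp: indicator_def)
  qed
qed measurable

lemma norm_set_integral_le:
  fixes f :: "real \<Rightarrow> 'a::{banach,second_countable_topology}"
  assumes [measurable]: "f \<in> borel_measurable borel" and B: "\<And>\<tau>. \<tau> \<in> {a..b} \<Longrightarrow> norm (f \<tau>) \<le> B" and "a \<le> b"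
  shows "norm (LINT \<tau>:{a..b}|lborel. f \<tau>) \<le> (b - a) * B"
proof -
  have "norm (LINT \<tau>:{a..b}|lborel. f \<tau>) \<le> (LINT \<tau>|lborel. indicator {a..b} \<tau> * B)"
    unfolding set_lebesgue_integral_def
  proof (rule Bochner_Integration.integral_norm_bound_integral)
    show "integrable lborel (\<lambda>\<tau>. indicator {a..b} \<tau> *\<^sub>R f \<tau>)"
      using set_integrable_bounded[OF assms(1) B] unfolding set_integrable_def .
    fix \<tau> show "norm (indicator {a..b} \<tau> *\<^sub>R f \<tau>) \<le> indicator {a..b} \<tau> * B"
      using B[of \<tau>] by (auto simp: indicator_def)
  qed (rule integrable_indicator_Icc)
  also have "\<dots> = (b - a) * B" using \<open>a \<le> b\<close> by simp
  finally show ?thesis .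
qed

text \<open>\<open>small\<close> is what keeps the ball of radius 2X invariant: \<kappa> (2X)^3
  \<le> X with \<kappa> = T/(4 pi^2). It restricts the weighted L1 size of the datum, not its sup
  size.\<close>

locale fnls_picard =
  fixes \<beta> \<mu> T \<rho> X Y :: real and v0 :: "real \<Rightarrow> complex"
  assumes \<beta>: "\<beta> > 0" and \<mu>: "\<bar>\<mu>\<bar> = 1" and T: "T > 0" and \<rho>: "\<rho> > 0" and v0: "exp_decay \<rho> X Y v0"
    and small: "8 * (T / (4 * pi\<^sup>2)) * X\<^sup>2 \<le> 1"
begin

definition \<kappa> :: real where "\<kappa> = T / (4 * pi\<^sup>2)"

text \<open>From u_t = -i|D|^\<beta> u - i \<mu> |u|^2 u; the two convolutions in the transform of a
  triple product cost 1/(2 pi)^2.\<close>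

definition coef :: complex where "coef = - \<i> * of_real \<mu> / of_real (4 * pi\<^sup>2)"

text \<open>Time-independent majorants of the Picard iterates below: since the nonlinearity is a trilinear form with
  positive kernel, domination of values and of increments passes from one step to the next.\<close>

primrec G :: "nat \<Rightarrow> real \<Rightarrow> real" where
  "G 0 = (\<lambda>\<xi>. norm (v0 \<xi>))"
| "G (Suc n) = (\<lambda>\<xi>. norm (v0 \<xi>) + \<kappa> * triconv (G n) (G n) (G n) \<xi>)"

text \<open>The nonlinearity conjugated by the free flow. All phases have modulus one and drop out
  of upper bounds; their size counts only in the lower bound at low frequencies.\<close>

definition F :: "(real \<Rightarrow> real \<Rightarrow> complex) \<Rightarrow> real \<Rightarrow> real \<Rightarrow> complex" where
  "F w \<tau> \<xi> = cis (\<tau> * \<bar>\<xi>\<bar> powr \<beta>) * cubic (\<lambda>\<eta>. cis (- (\<tau> * \<bar>\<eta>\<bar> powr \<beta>)) * w \<tau> \<eta>) \<xi>"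

text \<open>The Picard iterates for the Fourier transform with the free evolution undone.\<close>

primrec W :: "nat \<Rightarrow> real \<Rightarrow> real \<Rightarrow> complex" where
  "W 0 = (\<lambda>t \<xi>. v0 \<xi>)"
| "W (Suc n) = (\<lambda>t \<xi>. v0 \<xi> + coef * (LINT \<tau>:{0..t}|lborel. F (W n) \<tau> \<xi>))"

lemma \<rho>0: "\<rho> \<ge> 0" using \<rho> by simp

lemma \<kappa>_pos: "\<kappa> > 0" unfolding \<kappa>_def using T by simp

lemma norm_coef: "norm coef * T = \<kappa>"
  unfolding coef_def \<kappa>_def using \<mu> by (simp add: norm_divide norm_mult power2_eq_square)

text \<open>Induction with \<open>small\<close>: the cubic term adds at most \<kappa> (2X)^3 \<le> X
  to the L1 bound and \<kappa> (2X)^2 (2Y) \<le> Y to the sup bound.\<close>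

lemma G_exp_decay: "exp_decay \<rho> (2 * X) (2 * Y) (G n)"
proof (induction n)
  case 0
  show ?case using exp_decay_mono[OF exp_decay_norm[OF v0], of "2 * X" "2 * Y"] exp_decay_nonneg[OF v0] by simp
next
  case (Suc n)
  note nn = exp_decay_nonneg[OF v0]
  have s: "8 * \<kappa> * X\<^sup>2 \<le> 1" using small by (simp add: \<kappa>_def)
  have "exp_decay \<rho> (X + \<kappa> * (2 * X * (2 * X * (2 * X)))) (Y + \<kappa> * (2 * X * (2 * X * (2 * Y)))) (G (Suc n))"
    using exp_decay_add[OF exp_decay_norm[OF v0] exp_decay_cmult[OF exp_decay_triconv(3)[OF \<rho>0 Suc Suc Suc] less_imp_le[OF \<kappa>_pos]]] by simp
  moreover have "X + \<kappa> * (2 * X * (2 * X * (2 * X))) \<le> 2 * X"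
    using mult_right_mono[OF s nn(1)] by (simp add: power2_eq_square algebra_simps)
  moreover have "Y + \<kappa> * (2 * X * (2 * X * (2 * Y))) \<le> 2 * Y"
    using mult_right_mono[OF s nn(2)] by (simp add: power2_eq_square algebra_simps)
  ultimately show ?case by (rule exp_decay_mono)
qed

lemma G_measurable [measurable]: "G n \<in> borel_measurable borel"
  by (rule exp_decay_measurable[OF G_exp_decay])

lemma G_nonneg_mono: "0 \<le> G n \<xi>" "G n \<xi> \<le> G (Suc n) \<xi>"
proof -
  have "(\<forall>\<xi>. 0 \<le> G n \<xi> \<and> G n \<xi> \<le> G (Suc n) \<xi>)"
  proof (induction n)
    case 0
    have "0 \<le> triconv (G 0) (G 0) (G 0) \<xi>" for \<xi>
      unfolding triconv_def conv_def by (intro integral_nonneg_AE AE_I2 mult_nonneg_nonneg) auto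
    then show ?case using \<kappa>_pos by simp
  next
    case (Suc n)
    then have l: "0 \<le> G n \<xi>" "G n \<xi> \<le> G (Suc n) \<xi>" "0 \<le> G (Suc n) \<xi>" for \<xi>
      by (auto intro: order_trans)
    \<comment> \<open>The majorants are compared with themselves: a conclusion of the form norm d
      \<le> d forces d \<ge> 0, which is the monotonicity wanted.\<close>
    have "norm (triconv (G (Suc n)) (G (Suc n)) (G (Suc n)) \<xi> - triconv (G n) (G n) (G n) \<xi>)
        \<le> triconv (G (Suc n)) (G (Suc n)) (G (Suc n)) \<xi> - triconv (G n) (G n) (G n) \<xi>" for \<xi>
      by (rule triconv_compare(2)[OF \<rho>0 G_exp_decay G_exp_decay G_exp_decay G_exp_decay G_exp_decay G_exp_decay]; (use l in \<open>simp del: G.simps\<close>))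
    then have "triconv (G n) (G n) (G n) \<xi> \<le> triconv (G (Suc n)) (G (Suc n)) (G (Suc n)) \<xi>" for \<xi>
      using norm_ge_zero order_trans by (meson diff_ge_0_iff_ge)
    then have "G (Suc n) \<xi> \<le> G (Suc (Suc n)) \<xi>" for \<xi>
      unfolding G.simps(2)[of "Suc n"] by (subst G.simps(2)) (use \<kappa>_pos in \<open>auto intro: mult_left_mono\<close>)
    then show ?case using l by blast
  qed
  then show "0 \<le> G n \<xi>" "G n \<xi> \<le> G (Suc n) \<xi>" by blast+
qed

lemma G_le: "G n \<xi> \<le> 2 * Y * exp (- (\<rho> * \<bar>\<xi>\<bar>))"
  using exp_decay_bound[OF G_exp_decay[of n], of \<xi>] by simp

text \<open>At a fixed time both arguments carry the same unimodular phase, so it factors out of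
  their difference and the comparison for \<open>cubic\<close> applies.\<close>

lemma F_compare:
  assumes [measurable]: "w \<tau> \<in> borel_measurable borel" "w' \<tau> \<in> borel_measurable borel"
    and le: "\<And>\<xi>. norm (w \<tau> \<xi>) \<le> H \<xi>" "\<And>\<xi>. norm (w' \<tau> \<xi>) \<le> H' \<xi>" "\<And>\<xi>. norm (w \<tau> \<xi> - w' \<tau> \<xi>) \<le> H \<xi> - H' \<xi>"
    and H: "exp_decay \<rho> X' Y' H" "exp_decay \<rho> X' Y' H'"
  shows "norm (F w \<tau> \<xi>) \<le> triconv H H H \<xi>" "norm (F w \<tau> \<xi> - F w' \<tau> \<xi>) \<le> triconv H H H \<xi> - triconv H' H' H' \<xi>"
proof -
  let ?v = "\<lambda>\<eta>. cis (- (\<tau> * \<bar>\<eta>\<bar> powr \<beta>)) * w \<tau> \<eta>" and ?v' = "\<lambda>\<eta>. cis (- (\<tau> * \<bar>\<eta>\<bar> powr \<beta>)) * w' \<tau> \<eta>"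
  have "norm (?v \<eta> - ?v' \<eta>) = norm (w \<tau> \<eta> - w' \<tau> \<eta>)" for \<eta>
    unfolding right_diff_distrib[symmetric] by (simp add: norm_mult)
  then have d: "norm (?v \<eta> - ?v' \<eta>) \<le> H \<eta> - H' \<eta>" for \<eta> using le by simp
  have "norm (cubic ?v \<xi>) \<le> triconv H H H \<xi>"
    by (rule cubic_compare(1)[OF \<rho>0 H _ _ _ _ d]) (use le in \<open>auto simp: norm_mult\<close>)
  then show "norm (F w \<tau> \<xi>) \<le> triconv H H H \<xi>" by (simp add: F_def norm_mult)
  have "norm (cubic ?v \<xi> - cubic ?v' \<xi>) \<le> triconv H H H \<xi> - triconv H' H' H' \<xi>"
    by (rule cubic_compare(2)[OF \<rho>0 H _ _ _ _ d]) (use le in \<open>auto simp: norm_mult\<close>)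
  then show "norm (F w \<tau> \<xi> - F w' \<tau> \<xi>) \<le> triconv H H H \<xi> - triconv H' H' H' \<xi>"
    unfolding F_def right_diff_distrib[symmetric] by (simp add: norm_mult)
qed

lemma F_measurable:
  assumes [measurable]: "(\<lambda>(t, \<xi>). w t \<xi>) \<in> borel_measurable (borel \<Otimes>\<^sub>M borel)"
  shows "(\<lambda>(t, \<xi>). F w t \<xi>) \<in> borel_measurable (borel \<Otimes>\<^sub>M borel)"
  unfolding F_def cubic_def triconv_def conv_def by measurable

lemma W_measurable [measurable]: "(\<lambda>(t, \<xi>). W n t \<xi>) \<in> borel_measurable (borel \<Otimes>\<^sub>M borel)"
proof (induction n)
  case 0
  note [measurable] = exp_decay_measurable[OF v0]
  show ?case by simp
next
  case (Suc n)
  note [measurable] = exp_decay_measurable[OF v0] F_measurable[OF Suc]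
  \<comment> \<open>The domain of integration moves with t; turned into a condition on \<tau> and t
    inside an integral over the whole line, it is jointly measurable.\<close>
  have "(\<lambda>(t, \<xi>). v0 \<xi> + coef * (LINT \<tau>|lborel. (if 0 \<le> \<tau> \<and> \<tau> \<le> t then 1 else 0) *\<^sub>R F (W n) \<tau> \<xi>)) \<in> borel_measurable (borel \<Otimes>\<^sub>M borel)"
    by measurable
  then show ?case by (simp add: set_lebesgue_integral_def indicator_def)
qed

lemma measurable_section:
  assumes [measurable]: "(\<lambda>(t, \<xi>). w t \<xi>) \<in> borel_measurable (borel \<Otimes>\<^sub>M borel)"
  shows "w t \<in> borel_measurable borel" "(\<lambda>t. w t \<xi>) \<in> borel_measurable borel"
proof -
  have "(\<lambda>\<xi>. (\<lambda>(t, \<xi>). w t \<xi>) (t, \<xi>)) \<in> borel_measurable borel" by measurable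
  then show "w t \<in> borel_measurable borel" by simp
  have "(\<lambda>t. (\<lambda>(t, \<xi>). w t \<xi>) (t, \<xi>)) \<in> borel_measurable borel" by measurable
  then show "(\<lambda>t. w t \<xi>) \<in> borel_measurable borel" by simp
qed

text \<open>Values and increments go together: the value bound at n + 1 is the sum of the two claims
  at n, and \<open>F_compare\<close> turns increments of iterates into increments of
  \<open>triconv\<close>. Integration over time costs at most \<open>norm coef * T\<close>, which is
  \<kappa>, the factor in \<open>G\<close>.\<close>

lemma W_bounds:
  assumes "t \<in> {0..T}"
  shows "norm (W n t \<xi>) \<le> G n \<xi>" "norm (W (Suc n) t \<xi> - W n t \<xi>) \<le> G (Suc n) \<xi> - G n \<xi>"
proof -
  have "\<forall>t\<in>{0..T}. \<forall>\<xi>. norm (W n t \<xi>) \<le> G n \<xi> \<and> norm (W (Suc n) t \<xi> - W n t \<xi>) \<le> G (Suc n) \<xi> - G n \<xi>"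
  proof (induction n)
    case 0
    show ?case
    proof (intro ballI allI conjI)
      fix t \<xi> assume t: "t \<in> {0..T}"
      show "norm (W 0 t \<xi>) \<le> G 0 \<xi>" by simp
      have Fb: "norm (F (W 0) \<tau> \<xi>) \<le> triconv (G 0) (G 0) (G 0) \<xi>" for \<tau>
        by (rule F_compare(1)[where w' = "W 0" and H' = "G 0", OF _ _ _ _ _ G_exp_decay[of 0] G_exp_decay[of 0]])
          (use measurable_section[OF W_measurable[of 0]] in auto)
      have "norm (W (Suc 0) t \<xi> - W 0 t \<xi>) = norm coef * norm (LINT \<tau>:{0..t}|lborel. F (W 0) \<tau> \<xi>)"
        by (simp add: norm_mult)
      also have "\<dots> \<le> norm coef * (t * triconv (G 0) (G 0) (G 0) \<xi>)"
        using norm_set_integral_le[OF measurable_section(2)[OF F_measurable[OF W_measurable[of 0]]] Fb, where a = 0 and b = t] t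
        by (intro mult_left_mono) auto
      also have "\<dots> \<le> norm coef * (T * triconv (G 0) (G 0) (G 0) \<xi>)"
        using t order_trans[OF norm_ge_zero Fb] by (intro mult_left_mono mult_right_mono) auto
      also have "\<dots> = G (Suc 0) \<xi> - G 0 \<xi>"
        using norm_coef by simp
      finally show "norm (W (Suc 0) t \<xi> - W 0 t \<xi>) \<le> G (Suc 0) \<xi> - G 0 \<xi>" .
    qed
  next
    case (Suc n)
    show ?case
    proof (intro ballI allI conjI)
      fix t \<xi> assume t: "t \<in> {0..T}"
      let ?N = "\<lambda>n. triconv (G n) (G n) (G n) \<xi>"
      have A: "norm (F (W n) \<tau> \<xi>) \<le> ?N n" if "\<tau> \<in> {0..t}" for \<tau>
        by (rule F_compare(1)[where w' = "W n" and H' = "G n", OF _ _ _ _ _ G_exp_decay[of n] G_exp_decay[of n]])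
          (use measurable_section[OF W_measurable[of n]] Suc that t in auto)
      have W: "norm (W (Suc n) \<tau> \<eta>) \<le> G (Suc n) \<eta>" if "\<tau> \<in> {0..T}" for \<tau> \<eta>
      proof -
        have "norm (W (Suc n) \<tau> \<eta>) \<le> norm (W n \<tau> \<eta>) + norm (W (Suc n) \<tau> \<eta> - W n \<tau> \<eta>)"
          by (metis norm_triangle_sub add.commute)
        also have "\<dots> \<le> G n \<eta> + (G (Suc n) \<eta> - G n \<eta>)" using Suc that by (intro add_mono) blast+
        finally show ?thesis by simp
      qed
      show "norm (W (Suc n) t \<xi>) \<le> G (Suc n) \<xi>" using W t by blast
      have B: "norm (F (W (Suc n)) \<tau> \<xi> - F (W n) \<tau> \<xi>) \<le> ?N (Suc n) - ?N n" "norm (F (W (Suc n)) \<tau> \<xi>) \<le> ?N (Suc n)"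
        if "\<tau> \<in> {0..t}" for \<tau>
        by (rule F_compare[OF _ _ _ _ _ G_exp_decay[of "Suc n"] G_exp_decay[of n]];
            (use measurable_section[OF W_measurable] Suc that t W in \<open>auto simp del: G.simps W.simps\<close>))+
      have m: "(\<lambda>\<tau>. F (W n) \<tau> \<xi>) \<in> borel_measurable borel" for n
        by (rule measurable_section(2)[OF F_measurable[OF W_measurable]])
      have si: "set_integrable lborel {0..t} (\<lambda>\<tau>. F (W n) \<tau> \<xi>)" "set_integrable lborel {0..t} (\<lambda>\<tau>. F (W (Suc n)) \<tau> \<xi>)"
        using set_integrable_bounded[OF m A] set_integrable_bounded[OF m B(2)] by auto
      have "W (Suc (Suc n)) t \<xi> - W (Suc n) t \<xi> = coef * ((LINT \<tau>:{0..t}|lborel. F (W (Suc n)) \<tau> \<xi>) - (LINT \<tau>:{0..t}|lborel. F (W n) \<tau> \<xi>))"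
        unfolding W.simps(2)[of "Suc n"] by (subst (2) W.simps(2)) (simp add: right_diff_distrib del: W.simps)
      also have "\<dots> = coef * (LINT \<tau>:{0..t}|lborel. F (W (Suc n)) \<tau> \<xi> - F (W n) \<tau> \<xi>)"
        using si by (simp add: set_integral_diff del: W.simps)
      finally have "norm (W (Suc (Suc n)) t \<xi> - W (Suc n) t \<xi>) = norm coef * norm (LINT \<tau>:{0..t}|lborel. F (W (Suc n)) \<tau> \<xi> - F (W n) \<tau> \<xi>)"
        by (simp only: norm_mult)
      also have "\<dots> \<le> norm coef * ((t - 0) * (?N (Suc n) - ?N n))"
        using t m[of "Suc n"] m[of n] B(1) by (intro mult_left_mono norm_set_integral_le borel_measurable_diff) auto
      also have "\<dots> \<le> norm coef * (T * (?N (Suc n) - ?N n))"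
        using t order_trans[OF norm_ge_zero B(1)[of 0]] by (intro mult_left_mono mult_right_mono) auto
      also have "\<dots> = \<kappa> * (?N (Suc n) - ?N n)"
        using norm_coef by (simp add: mult.assoc[symmetric] del: G.simps)
      also have "\<dots> = G (Suc (Suc n)) \<xi> - G (Suc n) \<xi>"
        unfolding G.simps(2)[of "Suc n"] by (subst (6) G.simps(2)) (simp add: right_diff_distrib del: G.simps)
      finally show "norm (W (Suc (Suc n)) t \<xi> - W (Suc n) t \<xi>) \<le> G (Suc (Suc n)) \<xi> - G (Suc n) \<xi>" .
    qed
  qed
  then show "norm (W n t \<xi>) \<le> G n \<xi>" "norm (W (Suc n) t \<xi> - W n t \<xi>) \<le> G (Suc n) \<xi> - G n \<xi>" using assms by blast+
qed

end

section \<open>The solution\<close>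

context fnls_picard
begin

lemma W_diff_le:
  assumes "n \<le> m" "t \<in> {0..T}"
  shows "norm (W m t \<xi> - W n t \<xi>) \<le> G m \<xi> - G n \<xi>"
  using assms(1)
proof (induction m rule: dec_induct)
  case (step m)
  have "norm (W (Suc m) t \<xi> - W n t \<xi>) \<le> norm (W (Suc m) t \<xi> - W m t \<xi>) + norm (W m t \<xi> - W n t \<xi>)"
    using norm_triangle_ineq[of "W (Suc m) t \<xi> - W m t \<xi>" "W m t \<xi> - W n t \<xi>"] by (simp del: W.simps)
  then show ?case using W_bounds(2)[OF assms(2), of m \<xi>] step by linarith
qed simp

definition w :: "real \<Rightarrow> real \<Rightarrow> complex" where
  "w t \<xi> = lim (\<lambda>n. W n t \<xi>)"

text \<open>At a fixed frequency the majorants increase and stay below an exponential envelope,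
  hence form a Cauchy sequence; differences of the iterates are bounded by differences of the
  majorants.\<close>

lemma W_tendsto:
  assumes t: "t \<in> {0..T}"
  shows "(\<lambda>n. W n t \<xi>) \<longlonglongrightarrow> w t \<xi>"
proof -
  have "incseq (\<lambda>n. G n \<xi>)" by (rule incseq_SucI) (rule G_nonneg_mono(2))
  then obtain L where "(\<lambda>n. G n \<xi>) \<longlonglongrightarrow> L"
    using incseq_convergent[of "\<lambda>n. G n \<xi>" "2 * Y * exp (- (\<rho> * \<bar>\<xi>\<bar>))"] G_le by blast
  then have C: "Cauchy (\<lambda>n. G n \<xi>)" by (rule LIMSEQ_imp_Cauchy)
  have le: "norm (W m t \<xi> - W n t \<xi>) \<le> norm (G m \<xi> - G n \<xi>)" for m n
  proof (cases "n \<le> m")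
    case True then show ?thesis using W_diff_le[OF True t, of \<xi>] by simp
  next
    case False
    then show ?thesis using W_diff_le[of m n t \<xi>] t by (simp add: norm_minus_commute)
  qed
  have "Cauchy (\<lambda>n. W n t \<xi>)"
    using C unfolding Cauchy_iff by (meson le le_less_trans)
  then show ?thesis unfolding w_def by (simp add: Cauchy_convergent convergent_LIMSEQ_iff[symmetric])
qed

lemma w_measurable: "(\<lambda>(t, \<xi>). w t \<xi>) \<in> borel_measurable (borel \<Otimes>\<^sub>M borel)"
proof -
  have "(\<lambda>p. lim (\<lambda>n. (\<lambda>(t, \<xi>). W n t \<xi>) p)) \<in> borel_measurable (borel \<Otimes>\<^sub>M borel)"
    by (intro borel_measurable_lim_metric W_measurable)
  then show ?thesis by (simp add: w_def case_prod_unfold)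
qed

lemma w_section_measurable [measurable]: "w t \<in> borel_measurable borel"
  by (rule measurable_section(1)[OF w_measurable])

text \<open>A single envelope for all iterates and all times. The sup bound gives decay at rate
  \<rho>; half of it is spent on making the weighted L1 norm \<open>X2\<close> finite, so the
  regularity estimates run at rate \<rho>/2. Finiteness is enough for them; the quantitative bounds
  stay with \<open>G\<close>.\<close>

definition E :: "real \<Rightarrow> real" where "E \<xi> = 2 * Y * exp (- (\<rho> * \<bar>\<xi>\<bar>))"

definition X2 :: real where "X2 = (LINT \<xi>|lborel. exp (\<rho> / 2 * \<bar>\<xi>\<bar>) * norm (E \<xi>))"

lemma Y_nonneg: "Y \<ge> 0" using exp_decay_nonneg[OF v0] by simp

lemma E_nonneg: "E \<xi> \<ge> 0" unfolding E_def using Y_nonneg by simp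

lemma E_exp_decay: "exp_decay (\<rho> / 2) X2 (2 * Y) E"
proof -
  have e: "exp (\<rho> / 2 * \<bar>\<xi>\<bar>) * norm (E \<xi>) = 2 * Y * exp (- (\<rho> / 2 * \<bar>\<xi>\<bar>))" for \<xi>
  proof -
    have "exp (\<rho> / 2 * \<bar>\<xi>\<bar>) * exp (- (\<rho> * \<bar>\<xi>\<bar>)) = exp (- (\<rho> / 2 * \<bar>\<xi>\<bar>))"
      by (simp add: exp_add[symmetric])
    then show ?thesis using Y_nonneg by (simp add: E_def abs_mult algebra_simps)
  qed
  have m: "E \<in> borel_measurable borel" unfolding E_def by measurable
  have i: "integrable lborel (\<lambda>\<xi>. exp (\<rho> / 2 * \<bar>\<xi>\<bar>) * norm (E \<xi>))"
    unfolding e using exp_integrable[of "\<rho> / 2"] \<rho> by simp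
  have "exp (\<rho> / 2 * \<bar>\<xi>\<bar>) * norm (E \<xi>) \<le> 2 * Y" for \<xi>
    unfolding e using Y_nonneg \<rho> by (simp add: mult_left_le)
  then show ?thesis unfolding exp_decay_def X2_def using m i by auto
qed

lemma W_le_E: "t \<in> {0..T} \<Longrightarrow> norm (W n t \<xi>) \<le> E \<xi>"
  using W_bounds(1) G_le unfolding E_def by (meson order_trans)

lemma w_le_E: "t \<in> {0..T} \<Longrightarrow> norm (w t \<xi>) \<le> E \<xi>"
  by (rule tendsto_upperbound[OF tendsto_norm[OF W_tendsto] always_eventually]) (auto intro!: W_le_E)

definition v :: "real \<Rightarrow> real \<Rightarrow> complex" where
  "v t \<xi> = cis (- (t * \<bar>\<xi>\<bar> powr \<beta>)) * w t \<xi>"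

lemma v_measurable [measurable]: "v t \<in> borel_measurable borel"
  unfolding v_def by measurable

lemma norm_v: "norm (v t \<xi>) = norm (w t \<xi>)" by (simp add: v_def norm_mult)

lemma v_exp_decay: "t \<in> {0..T} \<Longrightarrow> exp_decay (\<rho> / 2) X2 (2 * Y) (v t)"
  by (rule exp_decay_dominated[OF E_exp_decay]) (auto simp: norm_v E_nonneg w_le_E)

lemma cubic_v_exp_decay: "t \<in> {0..T} \<Longrightarrow> exp_decay (\<rho> / 2) (X2 * (X2 * X2)) (X2 * (X2 * (2 * Y))) (cubic (v t))"
  using \<rho> by (intro exp_decay_cubic v_exp_decay) auto

lemma F_bound:
  assumes [measurable]: "z \<tau> \<in> borel_measurable borel" and le: "\<And>\<eta>. norm (z \<tau> \<eta>) \<le> E \<eta>"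
  shows "norm (F z \<tau> \<xi>) \<le> X2 * (X2 * (2 * Y))"
proof -
  have "exp_decay (\<rho> / 2) X2 (2 * Y) (\<lambda>\<eta>. cis (- (\<tau> * \<bar>\<eta>\<bar> powr \<beta>)) * z \<tau> \<eta>)"
    by (rule exp_decay_dominated[OF E_exp_decay]) (use le E_nonneg in \<open>auto simp: norm_mult\<close>)
  from exp_decay_le[OF exp_decay_cubic[OF _ this]] show ?thesis using \<rho> by (simp add: F_def norm_mult)
qed

lemma F_w: "F w \<tau> \<xi> = cis (\<tau> * \<bar>\<xi>\<bar> powr \<beta>) * cubic (v \<tau>) \<xi>"
  unfolding F_def v_def ..

lemma F_W_tendsto:
  assumes "\<tau> \<in> {0..T}"
  shows "(\<lambda>n. F (W n) \<tau> \<xi>) \<longlonglongrightarrow> F w \<tau> \<xi>"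
  unfolding F_def
proof (intro tendsto_mult tendsto_const cubic_tendsto[OF _ _ _ E_exp_decay])
  show "(\<lambda>\<eta>. cis (- (\<tau> * \<bar>\<eta>\<bar> powr \<beta>)) * W n \<tau> \<eta>) \<in> borel_measurable borel" for n
    using measurable_section(1)[OF W_measurable] by measurable
  show "norm (cis (- (\<tau> * \<bar>\<eta>\<bar> powr \<beta>)) * W n \<tau> \<eta>) \<le> norm (E \<eta>)" for n \<eta>
    using W_le_E[OF assms] E_nonneg by (simp add: norm_mult)
  show "(\<lambda>n. W n \<tau> \<eta>) \<longlonglongrightarrow> w \<tau> \<eta>" for \<eta> by (rule W_tendsto[OF assms])
qed (use \<rho> in auto)

lemma F_section_measurable: "(\<lambda>\<tau>. F w \<tau> \<xi>) \<in> borel_measurable borel" "(\<lambda>\<tau>. F (W n) \<tau> \<xi>) \<in> borel_measurable borel"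
  using measurable_section(2)[OF F_measurable[OF w_measurable]] measurable_section(2)[OF F_measurable[OF W_measurable]] by auto

text \<open>Dominated convergence in time, with \<open>F_W_tendsto\<close> for the integrand and a
  constant as dominating function, passes to the limit in the recursion for
  \<open>W (Suc n)\<close>.\<close>

lemma w_integral_equation:
  assumes t: "t \<in> {0..T}"
  shows "w t \<xi> = v0 \<xi> + coef * (LINT \<tau>:{0..t}|lborel. F w \<tau> \<xi>)"
proof -
  note [measurable] = F_section_measurable
  have "(\<lambda>n. LINT \<tau>:{0..t}|lborel. F (W n) \<tau> \<xi>) \<longlonglongrightarrow> (LINT \<tau>:{0..t}|lborel. F w \<tau> \<xi>)"
    unfolding set_lebesgue_integral_def
  proof (rule integral_dominated_convergence[where w = "\<lambda>\<tau>. indicator {0..t} \<tau> * (X2 * (X2 * (2 * Y)))"])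
    show "integrable lborel (\<lambda>\<tau>. indicator {0..t} \<tau> * (X2 * (X2 * (2 * Y))))"
      by (rule integrable_indicator_Icc)
    show "AE \<tau> in lborel. (\<lambda>n. indicator {0..t} \<tau> *\<^sub>R F (W n) \<tau> \<xi>) \<longlonglongrightarrow> indicator {0..t} \<tau> *\<^sub>R F w \<tau> \<xi>"
      using t F_W_tendsto by (intro AE_I2) (auto simp: indicator_def)
    show "AE \<tau> in lborel. norm (indicator {0..t} \<tau> *\<^sub>R F (W n) \<tau> \<xi>) \<le> indicator {0..t} \<tau> * (X2 * (X2 * (2 * Y)))" for n
      using t F_bound[of "W n"] measurable_section(1)[OF W_measurable] W_le_E by (intro AE_I2) (auto simp: indicator_def)
  qed measurable
  then have "(\<lambda>n. W (Suc n) t \<xi>) \<longlonglongrightarrow> v0 \<xi> + coef * (LINT \<tau>:{0..t}|lborel. F w \<tau> \<xi>)"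
    by (auto intro!: tendsto_intros)
  then show ?thesis using LIMSEQ_unique LIMSEQ_Suc[OF W_tendsto[OF t, of \<xi>]] by blast
qed

section \<open>Regularity in time of the limit\<close>

lemma F_w_bound: "\<tau> \<in> {0..T} \<Longrightarrow> norm (F w \<tau> \<xi>) \<le> X2 * (X2 * (2 * Y))"
  using w_le_E by (intro F_bound) auto

lemma w_integral_HK:
  assumes t: "t \<in> {0..T}"
  shows "w t \<xi> = v0 \<xi> + coef * integral {0..t} (\<lambda>\<tau>. F w \<tau> \<xi>)" "(\<lambda>\<tau>. F w \<tau> \<xi>) integrable_on {0..t}"
proof -
  have "set_integrable lborel {0..t} (\<lambda>\<tau>. F w \<tau> \<xi>)"
    by (rule set_integrable_bounded[OF F_section_measurable(1) F_w_bound]) (use t in auto)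
  note this[THEN set_borel_integral_eq_integral(1)] this[THEN set_borel_integral_eq_integral(2)]
  then show "w t \<xi> = v0 \<xi> + coef * integral {0..t} (\<lambda>\<tau>. F w \<tau> \<xi>)" "(\<lambda>\<tau>. F w \<tau> \<xi>) integrable_on {0..t}"
    using w_integral_equation[OF t] by auto
qed

text \<open>Start of a bootstrap: integrability in time alone makes \<open>w\<close> continuous,
  hence \<open>v\<close> and, by \<open>cubic_tendsto\<close>, the nonlinearity; only then does the
  fundamental theorem of calculus give a derivative.\<close>

lemma w_continuous: "continuous_on {0..T} (\<lambda>t. w t \<xi>)"
proof -
  have "continuous_on {0..T} (\<lambda>t. v0 \<xi> + coef * integral {0..t} (\<lambda>\<tau>. F w \<tau> \<xi>))"
    using w_integral_HK(2)[of T] T by (intro continuous_intros indefinite_integral_continuous_1) auto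
  then show ?thesis by (rule continuous_on_eq) (rule w_integral_HK(1)[symmetric])
qed

lemma v_continuous: "continuous_on {0..T} (\<lambda>t. v t \<xi>)"
  unfolding v_def by (intro continuous_intros w_continuous)

lemma cubic_v_continuous: "continuous_on {0..T} (\<lambda>t. cubic (v t) \<xi>)"
proof (rule continuous_on_sequentiallyI)
  fix x :: "nat \<Rightarrow> real" and a assume x: "\<forall>n. x n \<in> {0..T}" "a \<in> {0..T}" "x \<longlonglongrightarrow> a"
  show "(\<lambda>n. cubic (v (x n)) \<xi>) \<longlonglongrightarrow> cubic (v a) \<xi>"
  proof (rule cubic_tendsto[OF _ _ _ E_exp_decay])
    show "norm (v (x n) \<eta>) \<le> norm (E \<eta>)" for n \<eta>
      using w_le_E x E_nonneg by (simp add: norm_v)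
    show "(\<lambda>n. v (x n) \<eta>) \<longlonglongrightarrow> v a \<eta>" for \<eta>
      using v_continuous[of \<eta>] x unfolding continuous_on_sequentially by (auto simp: o_def)
  qed (use \<rho> in auto)
qed

lemma w_has_vector_derivative:
  assumes t: "t \<in> {0..T}"
  shows "((\<lambda>t. w t \<xi>) has_vector_derivative coef * F w t \<xi>) (at t within {0..T})"
proof -
  have "continuous_on {0..T} (\<lambda>\<tau>. F w \<tau> \<xi>)"
    unfolding F_w by (intro continuous_intros cubic_v_continuous)
  from integral_has_vector_derivative[OF this t]
  have "((\<lambda>t. v0 \<xi> + coef * integral {0..t} (\<lambda>\<tau>. F w \<tau> \<xi>)) has_vector_derivative 0 + coef * F w t \<xi>) (at t within {0..T})"
    by (intro derivative_intros)
  then show ?thesis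
    using has_vector_derivative_transform[OF t, of "\<lambda>t. w t \<xi>"] w_integral_HK(1) by auto
qed

lemma v_has_vector_derivative:
  assumes t: "t \<in> {0..T}"
  shows "((\<lambda>t. v t \<xi>) has_vector_derivative
     (coef * cubic (v t) \<xi> - \<i> * of_real (\<bar>\<xi>\<bar> powr \<beta>) * v t \<xi>)) (at t within {0..T})"
proof -
  have c: "cis (- (t * \<bar>\<xi>\<bar> powr \<beta>)) * cis (t * \<bar>\<xi>\<bar> powr \<beta>) = 1" by (simp add: cis_mult)
  have D: "((\<lambda>t. v t \<xi>) has_vector_derivative
     (cis (- (t * \<bar>\<xi>\<bar> powr \<beta>)) * (coef * F w t \<xi>) + (- \<i> * of_real (\<bar>\<xi>\<bar> powr \<beta>) * cis (- (t * \<bar>\<xi>\<bar> powr \<beta>))) * w t \<xi>)) (at t within {0..T})"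
    unfolding v_def by (intro has_vector_derivative_mult cis_has_vector_derivative w_has_vector_derivative t)
  have e: "cis (- (t * \<bar>\<xi>\<bar> powr \<beta>)) * (coef * F w t \<xi>) = coef * cubic (v t) \<xi>"
    unfolding F_w using c by (simp add: ac_simps)
  show ?thesis
    by (rule has_vector_derivative_eq_rhs[OF D]) (simp only: e, simp add: v_def)
qed

section \<open>The solution in physical space\<close>

definition u :: "real \<Rightarrow> real \<Rightarrow> complex" where
  "u t x = (1 / (2 * pi)) *\<^sub>R (LINT \<xi>|lborel. cis (x * \<xi>) * v t \<xi>)"

lemma weight_E_integrable: "integrable lborel (\<lambda>\<xi>. (1 + \<xi>\<^sup>2) powr \<sigma> * (E \<xi>)\<^sup>2)"
proof -
  have eq: "(1 + \<xi>\<^sup>2) powr \<sigma> * (E \<xi>)\<^sup>2 = 4 * Y\<^sup>2 * ((1 + \<xi>\<^sup>2) powr \<sigma> * exp (- (2 * \<rho> * \<bar>\<xi>\<bar>)))" for \<xi>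
  proof -
    have "(exp (- (\<rho> * \<bar>\<xi>\<bar>)))\<^sup>2 = exp (- (2 * \<rho> * \<bar>\<xi>\<bar>))" by (simp add: power2_eq_square exp_add[symmetric])
    then show ?thesis by (simp add: E_def power_mult_distrib)
  qed
  show ?thesis unfolding eq using powr_exp_integrable[of "2 * \<rho>" \<sigma>] \<rho> by simp
qed

text \<open>The exponential envelope beats every polynomial weight, so domination by a multiple of
  it settles all \<sigma> at once.\<close>

lemma fourier_rep_dominated:
  assumes [measurable]: "g \<in> borel_measurable borel" and le: "\<And>\<xi>. norm (g \<xi>) \<le> c * E \<xi>"
    and f: "\<And>x. f x = (1 / (2 * pi)) *\<^sub>R (LINT \<xi>|lborel. cis (x * \<xi>) * g \<xi>)"
  shows "fourier_rep f g"
  unfolding fourier_rep_def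
proof (intro conjI allI f)
  fix \<sigma> :: real
  have "integrable lborel (\<lambda>\<xi>. c\<^sup>2 * ((1 + \<xi>\<^sup>2) powr \<sigma> * (E \<xi>)\<^sup>2))" using weight_E_integrable by simp
  then show "integrable lborel (\<lambda>\<xi>. (1 + \<xi>\<^sup>2) powr \<sigma> * (cmod (g \<xi>))\<^sup>2)"
  proof (rule Bochner_Integration.integrable_bound)
    show "AE \<xi> in lborel. norm ((1 + \<xi>\<^sup>2) powr \<sigma> * (cmod (g \<xi>))\<^sup>2) \<le> norm (c\<^sup>2 * ((1 + \<xi>\<^sup>2) powr \<sigma> * (E \<xi>)\<^sup>2))"
    proof (rule AE_I2)
      fix \<xi>
      have "(cmod (g \<xi>))\<^sup>2 \<le> (c * E \<xi>)\<^sup>2" using le by (intro power_mono) auto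
      then have "(1 + \<xi>\<^sup>2) powr \<sigma> * (cmod (g \<xi>))\<^sup>2 \<le> (1 + \<xi>\<^sup>2) powr \<sigma> * (c * E \<xi>)\<^sup>2" by (intro mult_left_mono) auto
      then show "norm ((1 + \<xi>\<^sup>2) powr \<sigma> * (cmod (g \<xi>))\<^sup>2) \<le> norm (c\<^sup>2 * ((1 + \<xi>\<^sup>2) powr \<sigma> * (E \<xi>)\<^sup>2))"
        by (simp add: power_mult_distrib ac_simps)
    qed
  qed measurable
qed simp

lemma u_fourier_rep: "t \<in> {0..T} \<Longrightarrow> fourier_rep (u t) (v t)"
  by (rule fourier_rep_dominated[where c = 1]) (auto simp: norm_v w_le_E u_def)

lemma v_integrable: "t \<in> {0..T} \<Longrightarrow> integrable lborel (v t)"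
  using fourier_rep_integrable u_fourier_rep by blast

lemma u_diff_fourier_rep:
  assumes "t \<in> {0..T}" "\<tau> \<in> {0..T}"
  shows "fourier_rep (\<lambda>x. u \<tau> x - u t x) (\<lambda>\<xi>. v \<tau> \<xi> - v t \<xi>)"
proof (rule fourier_rep_dominated[where c = 2])
  show "norm (v \<tau> \<xi> - v t \<xi>) \<le> 2 * E \<xi>" for \<xi>
    using norm_triangle_ineq4[of "v \<tau> \<xi>" "v t \<xi>"] w_le_E[OF assms(1), of \<xi>] w_le_E[OF assms(2), of \<xi>] by (simp add: norm_v)
  show "u \<tau> x - u t x = (1 / (2 * pi)) *\<^sub>R (LINT \<xi>|lborel. cis (x * \<xi>) * (v \<tau> \<xi> - v t \<xi>))" for x
    using integrable_cis_mult[OF v_integrable[OF assms(1)], of x] integrable_cis_mult[OF v_integrable[OF assms(2)], of x]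
    by (simp add: u_def right_diff_distrib scaleR_diff_right)
qed measurable

text \<open>At each frequency \<open>v\<close> is continuous in time, and the squared difference
  stays below (2E)^2, which is integrable against every polynomial weight; dominated convergence
  along sequences concludes.\<close>

lemma u_Hs_continuous:
  assumes t: "t \<in> {0..T}"
  shows "((\<lambda>\<tau>. hs_norm \<sigma> (\<lambda>x. u \<tau> x - u t x)) \<longlongrightarrow> 0) (at t within {0..T})"
  unfolding tendsto_at_iff_sequentially
proof (intro allI impI)
  fix x :: "nat \<Rightarrow> real" assume x: "\<forall>n. x n \<in> {0..T} - {t}" and lim: "x \<longlonglongrightarrow> t"
  have xm: "x n \<in> {0..T}" for n using x by auto
  have "(\<lambda>n. LINT \<xi>|lborel. (1 + \<xi>\<^sup>2) powr \<sigma> * (cmod (v (x n) \<xi> - v t \<xi>))\<^sup>2) \<longlonglongrightarrow> (LINT \<xi>|(lborel :: real measure). 0)"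
  proof (rule integral_dominated_convergence[where w = "\<lambda>\<xi>. 4 * ((1 + \<xi>\<^sup>2) powr \<sigma> * (E \<xi>)\<^sup>2)"])
    show "integrable lborel (\<lambda>\<xi>. 4 * ((1 + \<xi>\<^sup>2) powr \<sigma> * (E \<xi>)\<^sup>2))" using weight_E_integrable by simp
    show "AE \<xi> in lborel. (\<lambda>n. (1 + \<xi>\<^sup>2) powr \<sigma> * (cmod (v (x n) \<xi> - v t \<xi>))\<^sup>2) \<longlonglongrightarrow> 0"
    proof (rule AE_I2)
      fix \<xi>
      have "(\<lambda>n. v (x n) \<xi>) \<longlonglongrightarrow> v t \<xi>"
        using v_continuous[of \<xi>] xm t lim unfolding continuous_on_sequentially by (auto simp: o_def)
      then have "(\<lambda>n. (1 + \<xi>\<^sup>2) powr \<sigma> * (cmod (v (x n) \<xi> - v t \<xi>))\<^sup>2) \<longlonglongrightarrow> (1 + \<xi>\<^sup>2) powr \<sigma> * (cmod (v t \<xi> - v t \<xi>))\<^sup>2"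
        by (intro tendsto_intros)
      then show "(\<lambda>n. (1 + \<xi>\<^sup>2) powr \<sigma> * (cmod (v (x n) \<xi> - v t \<xi>))\<^sup>2) \<longlonglongrightarrow> 0" by simp
    qed
    fix n
    show "AE \<xi> in lborel. norm ((1 + \<xi>\<^sup>2) powr \<sigma> * (cmod (v (x n) \<xi> - v t \<xi>))\<^sup>2) \<le> 4 * ((1 + \<xi>\<^sup>2) powr \<sigma> * (E \<xi>)\<^sup>2)"
    proof (rule AE_I2)
      fix \<xi>
      have "cmod (v (x n) \<xi> - v t \<xi>) \<le> 2 * E \<xi>"
        using norm_triangle_ineq4[of "v (x n) \<xi>" "v t \<xi>"] w_le_E[OF t, of \<xi>] w_le_E[OF xm[of n], of \<xi>] by (simp add: norm_v)
      then have "(cmod (v (x n) \<xi> - v t \<xi>))\<^sup>2 \<le> (2 * E \<xi>)\<^sup>2" by (intro power_mono) auto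
      then have "(1 + \<xi>\<^sup>2) powr \<sigma> * (cmod (v (x n) \<xi> - v t \<xi>))\<^sup>2 \<le> (1 + \<xi>\<^sup>2) powr \<sigma> * (2 * E \<xi>)\<^sup>2" by (intro mult_left_mono) auto
      then show "norm ((1 + \<xi>\<^sup>2) powr \<sigma> * (cmod (v (x n) \<xi> - v t \<xi>))\<^sup>2) \<le> 4 * ((1 + \<xi>\<^sup>2) powr \<sigma> * (E \<xi>)\<^sup>2)"
        by (simp add: power_mult_distrib ac_simps)
    qed
  qed measurable
  then have "(\<lambda>n. (1 / sqrt (2 * pi)) * sqrt (LINT \<xi>|lborel. (1 + \<xi>\<^sup>2) powr \<sigma> * (cmod (v (x n) \<xi> - v t \<xi>))\<^sup>2)) \<longlonglongrightarrow> (1 / sqrt (2 * pi)) * sqrt 0"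
    by (intro tendsto_intros) simp
  then show "((\<lambda>\<tau>. hs_norm \<sigma> (\<lambda>x. u \<tau> x - u t x)) \<circ> x) \<longlonglongrightarrow> 0"
    by (simp add: o_def hs_norm_eq[OF u_diff_fourier_rep[OF t xm]])
qed

text \<open>By the convolution theorem the integral is a product of three inversion integrals, each
  equal to 2 pi u or its conjugate; the conjugate arises from the reflected slot.\<close>

lemma fourier_cubic_v:
  assumes t: "t \<in> {0..T}"
  shows "(LINT \<xi>|lborel. cis (x * \<xi>) * cubic (v t) \<xi>) = of_real ((2 * pi)^3 * (cmod (u t x))\<^sup>2) * u t x"
proof -
  let ?I = "LINT \<xi>|lborel. cis (x * \<xi>) * v t \<xi>"
  have iv: "integrable lborel (v t)" by (rule v_integrable[OF t])
  have ic: "integrable lborel (\<lambda>\<zeta>. cnj (v t (- \<zeta>)))"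
    using lborel_integrable_reflect[of "v t" 0] iv by simp
  have "(LINT \<zeta>|lborel. cis (x * \<zeta>) * cnj (v t (- \<zeta>))) = (LINT \<zeta>|lborel. cnj (cis (x * (- \<zeta>)) * v t (- \<zeta>)))"
    by (simp add: cis_cnj)
  also have "\<dots> = (LINT \<zeta>|lborel. cnj (cis (x * \<zeta>) * v t \<zeta>))"
    using lborel_integral_reflect[of "\<lambda>\<zeta>. cnj (cis (x * \<zeta>) * v t \<zeta>)" 0] by simp
  also have "\<dots> = cnj ?I"
    by (rule integral_bounded_linear[OF bounded_linear_cnj integrable_cis_mult[OF iv]])
  finally have c: "(LINT \<zeta>|lborel. cis (x * \<zeta>) * cnj (v t (- \<zeta>))) = cnj ?I" .
  have "(LINT \<xi>|lborel. cis (x * \<xi>) * cubic (v t) \<xi>) = ?I * (cnj ?I * ?I)"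
    unfolding cubic_def triconv_def
    by (simp only: fourier_conv[OF iv integrable_conv[OF ic iv]] fourier_conv[OF ic iv] c)
  also have "?I = of_real (2 * pi) * u t x"
    by (simp add: u_def scaleR_conv_of_real)
  also have "of_real (2 * pi) * u t x * (cnj (of_real (2 * pi) * u t x) * (of_real (2 * pi) * u t x))
      = of_real ((2 * pi)^3) * (u t x * cnj (u t x)) * u t x"
    by (simp add: power3_eq_cube ac_simps)
  also have "u t x * cnj (u t x) = of_real ((cmod (u t x))\<^sup>2)"
    by (rule complex_norm_square[symmetric])
  finally show ?thesis by simp
qed

lemma powr_E_integrable: "integrable lborel (\<lambda>\<xi>. \<bar>\<xi>\<bar> powr \<beta> * E \<xi>)"
proof (rule Bochner_Integration.integrable_bound)
  show "integrable lborel (\<lambda>\<xi>. 2 * Y * ((1 + \<xi>\<^sup>2) powr (\<beta> / 2) * exp (- (\<rho> * \<bar>\<xi>\<bar>))))"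
    using powr_exp_integrable[OF \<rho>, of "\<beta> / 2"] by simp
  show "(\<lambda>\<xi>. \<bar>\<xi>\<bar> powr \<beta> * E \<xi>) \<in> borel_measurable lborel" unfolding E_def by measurable
  show "AE \<xi> in lborel. norm (\<bar>\<xi>\<bar> powr \<beta> * E \<xi>) \<le> norm (2 * Y * ((1 + \<xi>\<^sup>2) powr (\<beta> / 2) * exp (- (\<rho> * \<bar>\<xi>\<bar>))))"
  proof (rule AE_I2)
    fix \<xi> :: real
    have "\<bar>\<xi>\<bar> powr \<beta> = (\<xi>\<^sup>2) powr (\<beta> / 2)"
    proof (cases "\<xi> = 0")
      case False
      then have "(\<xi>\<^sup>2) powr (\<beta> / 2) = (\<bar>\<xi>\<bar> powr 2) powr (\<beta> / 2)" by simp
      then show ?thesis by (simp only: powr_powr) simp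
    qed simp
    also have "\<dots> \<le> (1 + \<xi>\<^sup>2) powr (\<beta> / 2)" using \<beta> by (intro powr_mono2) auto
    finally have "\<bar>\<xi>\<bar> powr \<beta> * E \<xi> \<le> (1 + \<xi>\<^sup>2) powr (\<beta> / 2) * E \<xi>" using E_nonneg by (intro mult_right_mono) auto
    then show "norm (\<bar>\<xi>\<bar> powr \<beta> * E \<xi>) \<le> norm (2 * Y * ((1 + \<xi>\<^sup>2) powr (\<beta> / 2) * exp (- (\<rho> * \<bar>\<xi>\<bar>))))"
      using E_nonneg[of \<xi>] Y_nonneg unfolding E_def by (simp add: abs_mult ac_simps)
  qed
qed

lemma u_equation:
  assumes t: "t \<in> {0..T}"
  shows "\<exists>d. ((\<lambda>\<tau>. u \<tau> x) has_vector_derivative d) (at t within {0..T}) \<and>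
        \<i> * d - fracD \<beta> (u t) x = complex_of_real \<mu> * complex_of_real ((cmod (u t x))\<^sup>2) * u t x"
proof -
  define f' where "f' = (\<lambda>t \<xi>. cis (x * \<xi>) * (coef * cubic (v t) \<xi> - \<i> * of_real (\<bar>\<xi>\<bar> powr \<beta>) * v t \<xi>))"
  define B where "B = norm coef * (X2 * (X2 * (2 * Y)))"
  have m [measurable]: "cubic (v t) \<in> borel_measurable borel" if "t \<in> {0..T}" for t
    using cubic_v_exp_decay[OF that] by (rule exp_decay_measurable)
  have D: "((\<lambda>\<tau>. LINT \<xi>|lborel. cis (x * \<xi>) * v \<tau> \<xi>) has_vector_derivative (LINT \<xi>|lborel. f' t \<xi>)) (at t within {0..T})"
  proof (rule has_vector_derivative_lebesgue_integral[OF _ _ _ _ _ t])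
    show "integrable lborel (\<lambda>\<xi>. cis (x * \<xi>) * v \<tau> \<xi>)" if "\<tau> \<in> {0..T}" for \<tau>
      by (rule integrable_cis_mult[OF v_integrable[OF that]])
    show "f' t \<in> borel_measurable borel" unfolding f'_def using m[OF t] by measurable
    show "((\<lambda>\<tau>. cis (x * \<xi>) * v \<tau> \<xi>) has_vector_derivative f' \<tau> \<xi>) (at \<tau> within {0..T})" if "\<tau> \<in> {0..T}" for \<tau> \<xi>
      unfolding f'_def by (intro has_vector_derivative_mult_right v_has_vector_derivative that)
    \<comment> \<open>A bound uniform in \<tau>: the cubic part decays at rate \<rho>/2, and the
      dispersive part is at most |\<xi>|^\<beta> times the envelope.\<close>
    show "norm (f' \<tau> \<xi>) \<le> B * exp (- (\<rho> / 2 * \<bar>\<xi>\<bar>)) + \<bar>\<xi>\<bar> powr \<beta> * E \<xi>" if "\<tau> \<in> {0..T}" for \<tau> \<xi>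
    proof -
      have "norm (f' \<tau> \<xi>) \<le> norm (coef * cubic (v \<tau>) \<xi>) + norm (\<i> * of_real (\<bar>\<xi>\<bar> powr \<beta>) * v \<tau> \<xi>)"
        unfolding f'_def by (simp add: norm_mult norm_triangle_ineq4[THEN order_trans])
      also have "norm (coef * cubic (v \<tau>) \<xi>) \<le> norm coef * (X2 * (X2 * (2 * Y)) * exp (- (\<rho> / 2 * \<bar>\<xi>\<bar>)))"
        unfolding norm_mult by (intro mult_left_mono exp_decay_bound[OF cubic_v_exp_decay[OF that]]) auto
      also have "norm (\<i> * of_real (\<bar>\<xi>\<bar> powr \<beta>) * v \<tau> \<xi>) \<le> \<bar>\<xi>\<bar> powr \<beta> * E \<xi>"
        using w_le_E[OF that, of \<xi>] by (simp add: norm_mult norm_v mult_left_mono)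
      finally show ?thesis by (simp add: B_def ac_simps)
    qed
    show "integrable lborel (\<lambda>\<xi>. B * exp (- (\<rho> / 2 * \<bar>\<xi>\<bar>)) + \<bar>\<xi>\<bar> powr \<beta> * E \<xi>)"
      using powr_E_integrable exp_integrable[of "\<rho> / 2"] \<rho> by simp
  qed
  let ?d = "(1 / (2 * pi)) *\<^sub>R (LINT \<xi>|lborel. f' t \<xi>)"
  have "((\<lambda>\<tau>. u \<tau> x) has_vector_derivative ?d) (at t within {0..T})"
    unfolding u_def by (rule bounded_linear.has_vector_derivative[OF bounded_linear_scaleR_right D])
  moreover have "\<i> * ?d - fracD \<beta> (u t) x = complex_of_real \<mu> * complex_of_real ((cmod (u t x))\<^sup>2) * u t x"
  proof -
    have i1: "integrable lborel (\<lambda>\<xi>. cis (x * \<xi>) * cubic (v t) \<xi>)"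
      using \<rho> by (intro integrable_cis_mult exp_decay_integrable[OF cubic_v_exp_decay[OF t]]) auto
    have "integrable lborel (\<lambda>\<xi>. of_real (\<bar>\<xi>\<bar> powr \<beta>) * v t \<xi>)"
      by (rule Bochner_Integration.integrable_bound[OF powr_E_integrable])
        (use w_le_E[OF t] E_nonneg in \<open>auto simp: norm_mult norm_v intro!: mult_left_mono\<close>)
    then have i2: "integrable lborel (\<lambda>\<xi>. cis (x * \<xi>) * (of_real (\<bar>\<xi>\<bar> powr \<beta>) * v t \<xi>))"
      by (rule integrable_cis_mult)
    have "(LINT \<xi>|lborel. f' t \<xi>) = (LINT \<xi>|lborel. coef * (cis (x * \<xi>) * cubic (v t) \<xi>) - \<i> * (cis (x * \<xi>) * (of_real (\<bar>\<xi>\<bar> powr \<beta>) * v t \<xi>)))"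
      unfolding f'_def by (intro Bochner_Integration.integral_cong) (auto simp: algebra_simps)
    also have "\<dots> = coef * (LINT \<xi>|lborel. cis (x * \<xi>) * cubic (v t) \<xi>) - \<i> * (LINT \<xi>|lborel. cis (x * \<xi>) * (of_real (\<bar>\<xi>\<bar> powr \<beta>) * v t \<xi>))"
      using i1 i2 by simp
    also have "(LINT \<xi>|lborel. cis (x * \<xi>) * (of_real (\<bar>\<xi>\<bar> powr \<beta>) * v t \<xi>)) = of_real (2 * pi) * fracD \<beta> (u t) x"
      unfolding fracD_eq[OF u_fourier_rep[OF t]] by (simp add: scaleR_conv_of_real mult.assoc)
    finally have eq: "(LINT \<xi>|lborel. f' t \<xi>) = coef * (of_real ((2 * pi)^3 * (cmod (u t x))\<^sup>2) * u t x) - \<i> * (of_real (2 * pi) * fracD \<beta> (u t) x)"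
      unfolding fourier_cubic_v[OF t] .
    have "\<i> * ?d = (\<i> * coef * of_real ((2 * pi)^2)) * of_real ((cmod (u t x))\<^sup>2) * u t x + fracD \<beta> (u t) x"
      unfolding eq by (simp add: scaleR_conv_of_real field_simps power2_eq_square power3_eq_cube)
    \<comment> \<open>Three inversions give (2 pi)^3 and the prefactor of u takes away one 2 pi; the
      remaining 4 pi^2 cancels the denominator of \<open>coef\<close>.\<close>
    also have "\<i> * coef * of_real ((2 * pi)^2) = of_real \<mu>"
      unfolding coef_def by (simp add: power_mult_distrib)
    finally show ?thesis by simp
  qed
  ultimately show ?thesis by blast
qed

lemma u_smooth_solution: "smooth_solution \<beta> \<mu> T u"
  unfolding smooth_solution_def Hinf_def using u_fourier_rep u_Hs_continuous u_equation by blast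

lemma w_zero: "w 0 \<xi> = v0 \<xi>"
  using w_integral_HK(1)[of 0 \<xi>] T by simp

lemma u_zero_fourier_rep: "fourier_rep (u 0) v0"
proof -
  have "v 0 = v0" by (rule ext) (simp add: v_def w_zero)
  then show ?thesis using u_fourier_rep[of 0] T by simp
qed

text \<open>Controls the tail of the iteration beyond the first Duhamel term. The difference
  \<open>G n - G 0\<close> has sup bound \<kappa> (2X)^2 (2Y) = 8 \<kappa> X^2 Y, and one more cubic
  step multiplies by 3 \<kappa> (2X)^2; hence the 96.\<close>

lemma w_minus_W1:
  assumes t: "t \<in> {0..T}"
  shows "norm (w t \<xi> - W 1 t \<xi>) \<le> 96 * \<kappa>\<^sup>2 * X ^ 4 * Y"
proof -
  have Gb: "G (Suc n) \<xi> - G (Suc 0) \<xi> \<le> 96 * \<kappa>\<^sup>2 * X ^ 4 * Y" for n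
  proof -
    have "exp_decay \<rho> (\<kappa> * (2 * X * (2 * X * (2 * X)))) (\<kappa> * (2 * X * (2 * X * (2 * Y)))) (\<lambda>\<xi>. G n \<xi> - G 0 \<xi>)"
    proof (cases n)
      case 0
      have "exp_decay \<rho> 0 0 (\<lambda>\<xi>::real. 0::real)" by (simp add: exp_decay_def)
      then show ?thesis using 0 exp_decay_nonneg[OF v0] \<kappa>_pos by (auto intro: exp_decay_mono)
    next
      case (Suc m)
      then show ?thesis
        using exp_decay_cmult[OF exp_decay_triconv(3)[OF \<rho>0 G_exp_decay[of m] G_exp_decay[of m] G_exp_decay[of m]] less_imp_le[OF \<kappa>_pos]] by simp
    qed
    from triconv_diff_bound[OF \<rho>0 G_exp_decay G_exp_decay this, of \<xi>]
    have "\<kappa> * (triconv (G n) (G n) (G n) \<xi> - triconv (G 0) (G 0) (G 0) \<xi>) \<le> \<kappa> * (3 * (2 * X * (2 * X) * (\<kappa> * (2 * X * (2 * X * (2 * Y))))))"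
      using \<kappa>_pos by (intro mult_left_mono) auto
    then show ?thesis by (simp add: algebra_simps power2_eq_square power4_eq_xxxx)
  qed
  have "norm (W (Suc n) t \<xi> - W 1 t \<xi>) \<le> 96 * \<kappa>\<^sup>2 * X ^ 4 * Y" for n
    using W_diff_le[of "Suc 0" "Suc n" t \<xi>] Gb[of n] t unfolding One_nat_def by linarith
  moreover have "(\<lambda>n. norm (W (Suc n) t \<xi> - W 1 t \<xi>)) \<longlonglongrightarrow> norm (w t \<xi> - W 1 t \<xi>)"
    by (intro tendsto_intros LIMSEQ_Suc W_tendsto t)
  ultimately show ?thesis by (intro tendsto_upperbound[of _ _ sequentially]) auto
qed

end

section \<open>Growth of low frequencies\<close>

lemma norm_cis_minus_one_le: "norm (cis x - 1) \<le> \<bar>x\<bar>"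
  using iexp_approx1[of x 0] by (simp add: cis_conv_exp)

lemma conv_of_real: "conv (\<lambda>\<xi>. complex_of_real (f \<xi>)) (\<lambda>\<xi>. complex_of_real (g \<xi>)) = (\<lambda>\<xi>. complex_of_real (conv f g \<xi>))"
  unfolding conv_def of_real_mult[symmetric] by (rule ext) (rule integral_complex_of_real)

lemma triconv_of_real: "triconv (\<lambda>\<xi>. complex_of_real (f \<xi>)) (\<lambda>\<xi>. complex_of_real (g \<xi>)) (\<lambda>\<xi>. complex_of_real (h \<xi>)) \<xi>
    = complex_of_real (triconv f g h \<xi>)"
  unfolding triconv_def conv_of_real ..

lemma triconv_scale:
  fixes c :: real
  shows "triconv (\<lambda>\<xi>. c * f \<xi>) (\<lambda>\<xi>. c * g \<xi>) (\<lambda>\<xi>. c * h \<xi>) \<xi> = c ^ 3 * triconv f g h \<xi>"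
proof -
  have *: "conv (\<lambda>\<xi>. a * f \<xi>) (\<lambda>\<xi>. b * g \<xi>) \<xi> = (a * b) * conv f g \<xi>" for a b :: real and f g \<xi>
  proof -
    have "conv (\<lambda>\<xi>. a * f \<xi>) (\<lambda>\<xi>. b * g \<xi>) \<xi> = (LINT \<eta>|lborel. (a * b) * (f \<eta> * g (\<xi> - \<eta>)))"
      unfolding conv_def by (intro Bochner_Integration.integral_cong) (auto simp: ac_simps)
    then show ?thesis unfolding conv_def by simp
  qed
  show ?thesis unfolding triconv_def * by (simp add: power3_eq_cube)
qed

text \<open>As \<open>N - 2 * N + N = 0\<close>, the cubic interaction of the two bumps feeds frequencies of size at most \<open>A\<close>.\<close>

definition bumps :: "real \<Rightarrow> real \<Rightarrow> real \<Rightarrow> real \<Rightarrow> real" where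
  "bumps R N A \<xi> = R * indicator ({N..N + A} \<union> {2 * N..2 * N + A}) \<xi>"

lemma bumps_measurable [measurable]: "bumps R N A \<in> borel_measurable borel"
  unfolding bumps_def by measurable

lemma bumps_nonneg: "R \<ge> 0 \<Longrightarrow> bumps R N A \<xi> \<ge> 0"
  unfolding bumps_def by simp

lemma bumps_zero: "0 < A \<Longrightarrow> A \<le> N \<Longrightarrow> \<xi> \<le> A / 2 \<Longrightarrow> bumps R N A \<xi> = 0"
  unfolding bumps_def by (simp add: indicator_def)

lemma bumps_eq: "\<xi> \<in> {N..N + A} \<or> \<xi> \<in> {2 * N..2 * N + A} \<Longrightarrow> bumps R N A \<xi> = R"
  unfolding bumps_def by (auto simp: indicator_def)

text \<open>The support lies in [0, 3N], where the weight at rate 1/(3N) is at most e \<le> 3; two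
  intervals of length \<open>A\<close> then give 6RA.\<close>

lemma bumps_exp_decay:
  assumes "0 < A" "A \<le> N" "R > 0"
  shows "exp_decay (1 / (3 * N)) (6 * R * A) (3 * R) (bumps R N A)"
proof -
  let ?\<rho> = "1 / (3 * N)"
  let ?I = "\<lambda>\<xi>. indicator {N..N + A} \<xi> * (3 * R) + indicator {2 * N..2 * N + A} \<xi> * (3 * R)"
  have N: "N > 0" using assms by simp
  have ex: "exp (?\<rho> * \<bar>\<xi>\<bar>) \<le> 3" if "\<xi> \<in> {N..N + A} \<union> {2 * N..2 * N + A}" for \<xi>
  proof -
    have "\<bar>\<xi>\<bar> \<le> 3 * N" using that assms by auto
    then have "exp (?\<rho> * \<bar>\<xi>\<bar>) \<le> exp 1" using N by (simp add: field_simps)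
    then show ?thesis using exp_le by linarith
  qed
  have le: "exp (?\<rho> * \<bar>\<xi>\<bar>) * norm (bumps R N A \<xi>) \<le> ?I \<xi>" for \<xi>
    using ex[of \<xi>] assms by (auto simp: bumps_def indicator_def)
  have Ii: "integrable lborel ?I" by (intro Bochner_Integration.integrable_add integrable_indicator_Icc)
  have i: "integrable lborel (\<lambda>\<xi>. exp (?\<rho> * \<bar>\<xi>\<bar>) * norm (bumps R N A \<xi>))"
    by (rule Bochner_Integration.integrable_bound[OF Ii]) (use le in \<open>auto intro!: AE_I2 order_trans[OF _ abs_ge_self]\<close>)
  have "(LINT \<xi>|lborel. exp (?\<rho> * \<bar>\<xi>\<bar>) * norm (bumps R N A \<xi>)) \<le> integral\<^sup>L lborel ?I"
    by (rule integral_mono[OF i Ii le])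
  also have "\<dots> = 6 * R * A"
    using assms by (subst Bochner_Integration.integral_add[OF integrable_indicator_Icc integrable_indicator_Icc]) (simp add: integral_indicator_Icc)
  finally have 1: "(LINT \<xi>|lborel. exp (?\<rho> * \<bar>\<xi>\<bar>) * norm (bumps R N A \<xi>)) \<le> 6 * R * A" .
  have "exp (?\<rho> * \<bar>\<xi>\<bar>) * norm (bumps R N A \<xi>) \<le> 3 * R" for \<xi>
    using ex[of \<xi>] assms by (auto simp: bumps_def indicator_def)
  then show ?thesis unfolding exp_decay_def using i 1 by auto
qed

text \<open>All terms are nonnegative, so it suffices to integrate over a rectangle of frequency
  pairs on which all three factors equal \<open>R\<close>. Its sides are A/4, whence A^2/16.\<close>

lemma triconv_bumps_ge:
  assumes A: "0 < A" "A \<le> N" and R: "R > 0" and \<xi>: "\<xi> \<in> {0..A / 2}"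
  shows "R ^ 3 * A\<^sup>2 / 16 \<le> triconv (bumps R N A) (bumps R N A) (bumps R N A) \<xi>"
proof -
  let ?b = "bumps R N A"
  note e = bumps_exp_decay[OF A R]
  have \<rho>: "0 \<le> 1 / (3 * N)" using A by simp
  have bi: "integrable lborel ?b" by (rule exp_decay_integrable[OF e \<rho>])
  have bri: "integrable lborel (\<lambda>\<zeta>. ?b (- \<zeta>))" by (rule exp_decay_integrable[OF exp_decay_reflect[OF e] \<rho>])
  define k where "k = conv (\<lambda>\<zeta>. ?b (- \<zeta>)) ?b"
  have ke: "exp_decay (1 / (3 * N)) (6 * R * A * (6 * R * A)) (6 * R * A * (3 * R)) k"
    unfolding k_def by (rule exp_decay_conv[OF \<rho> exp_decay_reflect[OF e] e])
  have k0: "k z \<ge> 0" for z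
    unfolding k_def conv_def using R by (intro integral_nonneg_AE AE_I2 mult_nonneg_nonneg bumps_nonneg) auto
  have k1: "k (\<xi> - \<eta>) \<ge> R\<^sup>2 * A / 4" if \<eta>: "\<eta> \<in> {N..N + A / 4}" for \<eta>
  proof -
    \<comment> \<open>For \<xi> in [0, A/2] and \<eta> in [N, N + A/4] these \<zeta> put -\<zeta>
      into the bump at 2N and \<xi> - \<eta> - \<zeta> into [N, N + A], with both ends
      attained.\<close>
    let ?J = "{- (2 * N + A / 2)..- (2 * N + A / 4)}"
    have "(LINT \<zeta>|lborel. indicator ?J \<zeta> * R\<^sup>2) \<le> k (\<xi> - \<eta>)"
      unfolding k_def conv_def
    proof (rule integral_mono[OF integrable_indicator_Icc])
      show "integrable lborel (\<lambda>\<zeta>. ?b (- \<zeta>) * ?b (\<xi> - \<eta> - \<zeta>))"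
        using exp_decay_le[OF e \<rho>] by (intro conv_integrand_integrable[OF bri]) auto
      fix \<zeta>
      show "indicator ?J \<zeta> * R\<^sup>2 \<le> ?b (- \<zeta>) * ?b (\<xi> - \<eta> - \<zeta>)"
      proof (cases "\<zeta> \<in> ?J")
        case True
        then have "?b (- \<zeta>) = R" "?b (\<xi> - \<eta> - \<zeta>) = R"
          using \<xi> \<eta> A by (auto intro!: bumps_eq)
        then show ?thesis using True by (simp add: power2_eq_square)
      next
        case False then show ?thesis using R by (simp add: bumps_nonneg)
      qed
    qed
    then show ?thesis using A by (subst (asm) integral_indicator_Icc) (auto simp: algebra_simps)
  qed
  have "(LINT \<eta>|lborel. indicator {N..N + A / 4} \<eta> * (R * (R\<^sup>2 * A / 4))) \<le> conv ?b k \<xi>"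
    unfolding conv_def
  proof (rule integral_mono[OF integrable_indicator_Icc])
    show "integrable lborel (\<lambda>\<eta>. ?b \<eta> * k (\<xi> - \<eta>))"
      using exp_decay_le[OF ke \<rho>] by (intro conv_integrand_integrable[OF bi exp_decay_measurable[OF ke]]) auto
    fix \<eta>
    show "indicator {N..N + A / 4} \<eta> * (R * (R\<^sup>2 * A / 4)) \<le> ?b \<eta> * k (\<xi> - \<eta>)"
    proof (cases "\<eta> \<in> {N..N + A / 4}")
      case True
      then have "?b \<eta> = R" using A by (auto intro!: bumps_eq)
      then show ?thesis using True k1[OF True] R by (simp add: mult_left_mono)
    next
      case False then show ?thesis using R k0 by (simp add: bumps_nonneg)
    qed
  qed
  then have "A / 4 * (R * (R\<^sup>2 * A / 4)) \<le> triconv ?b ?b ?b \<xi>"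
    unfolding triconv_def k_def[symmetric] using A by (subst (asm) integral_indicator_Icc) auto
  then show ?thesis by (simp add: power2_eq_square power3_eq_cube algebra_simps)
qed

text \<open>Up to 1/(2 pi), the squared H^s norm of the function whose transform is the indicator of
  [0, b]. As b grows it is of power type for s > -1/2, logarithmic at s = -1/2 and bounded for s <
  -1/2.\<close>

definition low_mass :: "real \<Rightarrow> real \<Rightarrow> real" where
  "low_mass s b = (LINT \<xi>:{0..b}|lborel. (1 + \<xi>\<^sup>2) powr s)"

lemma low_mass_integrable: "set_integrable lborel {0..b} (\<lambda>\<xi>::real. (1 + \<xi>\<^sup>2) powr s)"
  by (rule borel_integrable_atLeastAtMost') (auto intro!: continuous_intros simp: add_nonneg_eq_0_iff)

text \<open>\<open>phase\<close> keeps the phases at frequencies up to 3N below 1/16. The constant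
  in \<open>amplitude\<close> serves twice: it gives \<open>small\<close> for X = 6RA, and it pushes
  the tail of the iteration below half of the main term.\<close>

locale fnls_bumps =
  fixes \<beta> \<mu> T N A R :: real
  assumes \<beta>: "\<beta> > 0" and \<mu>: "\<bar>\<mu>\<bar> = 1" and T: "T > 0" and A: "0 < A" "A \<le> N" and R: "R > 0"
    and phase: "16 * T * (3 * N) powr \<beta> \<le> 1" and amplitude: "T * R\<^sup>2 * A\<^sup>2 \<le> 1 / 10 ^ 6"
begin

definition v0 :: "real \<Rightarrow> complex" where "v0 \<xi> = of_real (bumps R N A \<xi>)"

lemma v0_exp_decay: "exp_decay (1 / (3 * N)) (6 * R * A) (3 * R) v0"
  unfolding v0_def by (rule exp_decay_dominated[OF bumps_exp_decay[OF A R]]) auto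

sublocale fnls_picard \<beta> \<mu> T "1 / (3 * N)" "6 * R * A" "3 * R" v0
proof
  have p: "pi\<^sup>2 \<ge> 9" using pi_gt3 power_mono[of 3 pi 2] by simp
  have "8 * (T / (4 * pi\<^sup>2)) * (6 * R * A)\<^sup>2 = 72 * (T * R\<^sup>2 * A\<^sup>2) / pi\<^sup>2"
    by (simp add: power_mult_distrib)
  also have "\<dots> \<le> 1" using amplitude p by (simp add: field_simps)
  finally show "8 * (T / (4 * pi\<^sup>2)) * (6 * R * A)\<^sup>2 \<le> 1" .
qed (use \<beta> \<mu> T A v0_exp_decay in auto)

lemma phase_le:
  assumes "\<tau> \<in> {0..T}" "\<bar>\<xi>\<bar> \<le> 3 * N"
  shows "\<tau> * \<bar>\<xi>\<bar> powr \<beta> \<le> 1 / 16"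
proof -
  have "\<tau> * \<bar>\<xi>\<bar> powr \<beta> \<le> T * (3 * N) powr \<beta>"
    using assms \<beta> A by (intro mult_mono powr_mono2) auto
  then show ?thesis using phase by simp
qed

text \<open>Writing b for the bumps, phases of at most 1/16 change the datum by at most b/16 =
  (17/16) b - b, so the comparison of majorants applies with (17/16) b and b. Together with the
  outer phase the error is at most ((17/16)^3 - 1 + 1/16) B, about 0.26 B.\<close>

lemma F_W0_close:
  assumes \<tau>: "\<tau> \<in> {0..T}" and \<xi>: "\<xi> \<in> {0..A / 2}"
  defines "B \<equiv> triconv (bumps R N A) (bumps R N A) (bumps R N A) \<xi>"
  shows "norm (F (W 0) \<tau> \<xi> - of_real B) \<le> B / 2"
proof -
  let ?b = "bumps R N A" and ?f = "\<lambda>\<eta>. cis (- (\<tau> * \<bar>\<eta>\<bar> powr \<beta>)) * v0 \<eta>" and ?c = "17 / 16 :: real"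
  have \<rho>: "0 \<le> 1 / (3 * N)" using A by simp
  have B0: "B \<ge> 0" unfolding B_def using A R by (intro order_trans[OF _ triconv_bumps_ge[OF A R \<xi>]]) simp
  have [measurable]: "v0 \<in> borel_measurable borel" unfolding v0_def by measurable
  have nv: "norm (v0 \<eta>) = ?b \<eta>" for \<eta> unfolding v0_def using bumps_nonneg R by simp
  have b1: "norm (?f \<eta>) \<le> ?c * ?b \<eta>" for \<eta>
    using bumps_nonneg[of R N A \<eta>] R by (simp add: norm_mult nv)
  have b2: "norm (v0 \<eta>) \<le> ?b \<eta>" for \<eta> by (simp add: nv)
  have b3: "norm (?f \<eta> - v0 \<eta>) \<le> ?c * ?b \<eta> - ?b \<eta>" for \<eta>
  proof (cases "\<eta> \<in> {N..N + A} \<union> {2 * N..2 * N + A}")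
    case True
    then have "\<bar>\<eta>\<bar> \<le> 3 * N" using A by auto
    note ph = phase_le[OF \<tau> this]
    have "?f \<eta> - v0 \<eta> = (cis (- (\<tau> * \<bar>\<eta>\<bar> powr \<beta>)) - 1) * v0 \<eta>" by (simp add: algebra_simps)
    then have "norm (?f \<eta> - v0 \<eta>) = norm (cis (- (\<tau> * \<bar>\<eta>\<bar> powr \<beta>)) - 1) * ?b \<eta>" by (simp add: norm_mult nv)
    also have "\<dots> \<le> 1 / 16 * ?b \<eta>"
      using norm_cis_minus_one_le[of "- (\<tau> * \<bar>\<eta>\<bar> powr \<beta>)"] ph \<tau> bumps_nonneg[of R N A \<eta>] R by (intro mult_right_mono) auto
    finally show ?thesis by simp
  next
    case False
    then have "?b \<eta> = 0" by (simp add: bumps_def)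
    then show ?thesis by (simp add: v0_def)
  qed
  have e1: "exp_decay (1 / (3 * N)) (12 * R * A) (6 * R) (\<lambda>\<xi>. ?c * ?b \<xi>)"
    by (rule exp_decay_mono[OF exp_decay_cmult[OF bumps_exp_decay[OF A R]]]) (use A R in auto)
  have e2: "exp_decay (1 / (3 * N)) (12 * R * A) (6 * R) ?b"
    by (rule exp_decay_mono[OF bumps_exp_decay[OF A R]]) (use A R in auto)
  have "norm (cubic ?f \<xi> - cubic v0 \<xi>) \<le> triconv (\<lambda>\<xi>. ?c * ?b \<xi>) (\<lambda>\<xi>. ?c * ?b \<xi>) (\<lambda>\<xi>. ?c * ?b \<xi>) \<xi> - triconv ?b ?b ?b \<xi>"
    by (rule cubic_compare(2)[OF \<rho> e1 e2 _ _ b1 b2 b3]) measurable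
  also have "\<dots> = (?c ^ 3 - 1) * B" unfolding triconv_scale B_def by (simp add: algebra_simps)
  finally have 1: "norm (cubic ?f \<xi> - of_real B) \<le> (?c ^ 3 - 1) * B"
    unfolding cubic_def v0_def complex_cnj_complex_of_real triconv_of_real B_def .
  let ?p = "cis (\<tau> * \<bar>\<xi>\<bar> powr \<beta>)"
  have "\<bar>\<xi>\<bar> \<le> 3 * N" using \<xi> A by auto
  from phase_le[OF \<tau> this] have "norm (?p - 1) \<le> 1 / 16"
    using norm_cis_minus_one_le[of "\<tau> * \<bar>\<xi>\<bar> powr \<beta>"] \<tau> by simp
  then have "norm (?p - 1) * B \<le> 1 / 16 * B" using B0 by (rule mult_right_mono)
  then have 2: "norm ((?p - 1) * of_real B) \<le> 1 / 16 * B"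
    using B0 by (simp add: norm_mult)
  have "F (W 0) \<tau> \<xi> - of_real B = ?p * (cubic ?f \<xi> - of_real B) + (?p - 1) * of_real B"
    unfolding F_def by (simp add: algebra_simps)
  then have "norm (F (W 0) \<tau> \<xi> - of_real B) \<le> norm (?p * (cubic ?f \<xi> - of_real B)) + norm ((?p - 1) * of_real B)"
    by (metis norm_triangle_ineq)
  also have "\<dots> \<le> (?c ^ 3 - 1) * B + 1 / 16 * B" using 1 2 by (simp add: norm_mult)
  also have "\<dots> \<le> B / 2" using B0 by (simp add: field_simps)
  finally show ?thesis .
qed

text \<open>The datum vanishes at low frequencies, so \<open>W 1\<close> is the Duhamel term alone;
  its integrand stays within B/2 of the fixed number B > 0, so there is no cancellation in
  time.\<close>

lemma W1_ge:
  assumes \<xi>: "\<xi> \<in> {0..A / 2}"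
  shows "norm (W 1 T \<xi>) \<ge> \<kappa> * (R ^ 3 * A\<^sup>2) / 32"
proof -
  define B where "B = triconv (bumps R N A) (bumps R N A) (bumps R N A) \<xi>"
  have B: "B \<ge> R ^ 3 * A\<^sup>2 / 16" unfolding B_def by (rule triconv_bumps_ge[OF A R \<xi>])
  have m: "(\<lambda>\<tau>. F (W 0) \<tau> \<xi>) \<in> borel_measurable borel" by (rule F_section_measurable(2))
  have cl: "norm (F (W 0) \<tau> \<xi> - of_real B) \<le> B / 2" if "\<tau> \<in> {0..T}" for \<tau>
    unfolding B_def by (rule F_W0_close[OF that \<xi>])
  have bd: "norm (F (W 0) \<tau> \<xi>) \<le> B / 2 + \<bar>B\<bar>" if "\<tau> \<in> {0..T}" for \<tau>
    using cl[OF that] norm_triangle_ineq2[of "F (W 0) \<tau> \<xi>" "of_real B"] by simp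
  have i: "set_integrable lborel {0..T} (\<lambda>\<tau>. F (W 0) \<tau> \<xi>)" by (rule set_integrable_bounded[OF m bd])
  have ic: "set_integrable lborel {0..T} (\<lambda>\<tau>. complex_of_real B)" by (rule set_integrable_bounded[where B = "\<bar>B\<bar>"]) auto
  have c: "(LINT \<tau>:{0..T}|lborel. complex_of_real B) = of_real (T * B)"
    unfolding set_lebesgue_integral_def using T by (simp add: scaleR_conv_of_real)
  have "norm (LINT \<tau>:{0..T}|lborel. F (W 0) \<tau> \<xi> - of_real B) \<le> (T - 0) * (B / 2)"
    using m T by (intro norm_set_integral_le cl) auto
  then have "norm ((LINT \<tau>:{0..T}|lborel. F (W 0) \<tau> \<xi>) - of_real (T * B)) \<le> T * B / 2"
    using set_integral_diff(2)[OF i ic] c by simp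
  moreover have "norm (complex_of_real (T * B)) = T * B"
  proof -
    have "B \<ge> 0" using A R by (intro order_trans[OF _ B]) simp
    then show ?thesis using T by (simp add: norm_mult)
  qed
  moreover have "norm (complex_of_real (T * B)) \<le> norm (LINT \<tau>:{0..T}|lborel. F (W 0) \<tau> \<xi>) + norm ((LINT \<tau>:{0..T}|lborel. F (W 0) \<tau> \<xi>) - of_real (T * B))"
    by (metis add.commute norm_minus_commute norm_triangle_sub)
  ultimately have "norm (LINT \<tau>:{0..T}|lborel. F (W 0) \<tau> \<xi>) \<ge> T * B / 2" by linarith
  then have "norm coef * norm (LINT \<tau>:{0..T}|lborel. F (W 0) \<tau> \<xi>) \<ge> norm coef * (T * B / 2)"
    by (intro mult_left_mono) auto
  also have "norm coef * (T * B / 2) = \<kappa> * B / 2" using norm_coef by (simp add: mult.assoc[symmetric])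
  also have "norm coef * norm (LINT \<tau>:{0..T}|lborel. F (W 0) \<tau> \<xi>) = norm (W 1 T \<xi>)"
  proof -
    have "v0 \<xi> = 0" unfolding v0_def using bumps_zero[OF A] \<xi> by simp
    then show ?thesis unfolding One_nat_def W.simps(2) by (simp add: norm_mult del: W.simps)
  qed
  finally have "\<kappa> * B / 2 \<le> norm (W 1 T \<xi>)" .
  moreover have "\<kappa> * (R ^ 3 * A\<^sup>2 / 16) \<le> \<kappa> * B" using B \<kappa>_pos by (intro mult_left_mono) auto
  ultimately show ?thesis by simp
qed

text \<open>For X = 6RA and Y = 3R the tail bound is 373248 \<kappa> R^2 A^2 times \<kappa> R^3 A^2;
  \<open>amplitude\<close> makes it at most half of the lower bound for \<open>W 1\<close>.\<close>

lemma v_ge: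
  assumes \<xi>: "\<xi> \<in> {0..A / 2}"
  shows "norm (v T \<xi>) \<ge> \<kappa> * (R ^ 3 * A\<^sup>2) / 64"
proof -
  have p: "pi\<^sup>2 \<ge> 9" using pi_gt3 power_mono[of 3 pi 2] by simp
  have "\<kappa> * (R\<^sup>2 * A\<^sup>2) = T * R\<^sup>2 * A\<^sup>2 / (4 * pi\<^sup>2)" by (simp add: \<kappa>_def)
  also have "\<dots> \<le> (1 / 10 ^ 6) / (4 * 9)" using amplitude p T by (intro frac_le) auto
  finally have k: "\<kappa> * (R\<^sup>2 * A\<^sup>2) \<le> 1 / 36000000" by simp
  have "96 * \<kappa>\<^sup>2 * (6 * R * A) ^ 4 * (3 * R) = 373248 * (\<kappa> * (R\<^sup>2 * A\<^sup>2)) * (\<kappa> * (R ^ 3 * A\<^sup>2))"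
    by (simp add: power_mult_distrib power2_eq_square power3_eq_cube power4_eq_xxxx)
  also have "\<dots> \<le> 373248 * (1 / 36000000) * (\<kappa> * (R ^ 3 * A\<^sup>2))"
    using k \<kappa>_pos A R by (intro mult_right_mono mult_left_mono) auto
  also have "\<dots> \<le> 1 / 64 * (\<kappa> * (R ^ 3 * A\<^sup>2))"
    using \<kappa>_pos A R by (intro mult_right_mono) auto
  finally have e: "96 * \<kappa>\<^sup>2 * (6 * R * A) ^ 4 * (3 * R) \<le> \<kappa> * (R ^ 3 * A\<^sup>2) / 64" by simp
  have "norm (w T \<xi> - W 1 T \<xi>) \<le> \<kappa> * (R ^ 3 * A\<^sup>2) / 64"
    using w_minus_W1[of T \<xi>] e T by auto
  moreover have "norm (W 1 T \<xi>) \<le> norm (w T \<xi>) + norm (w T \<xi> - W 1 T \<xi>)"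
    by (metis norm_minus_commute norm_triangle_sub)
  ultimately show ?thesis using W1_ge[OF \<xi>] by (simp add: norm_v)
qed

lemma hs_norm_u_ge:
  "hs_norm s (u T) \<ge> T * R ^ 3 * A\<^sup>2 / 20000 * sqrt (low_mass s (A / 2))"
proof -
  define q where "q = \<kappa> * (R ^ 3 * A\<^sup>2) / 64"
  define J where "J = low_mass s (A / 2)"
  have q0: "q \<ge> 0" unfolding q_def using \<kappa>_pos A R by simp
  have Tm: "T \<in> {0..T}" using T by simp
  have ji: "integrable lborel (\<lambda>\<xi>. q\<^sup>2 * (indicator {0..A / 2} \<xi> *\<^sub>R (1 + \<xi>\<^sup>2) powr s))"
    using low_mass_integrable[of "A / 2" s] unfolding set_integrable_def by simp
  have "q\<^sup>2 * J = (LINT \<xi>|lborel. q\<^sup>2 * (indicator {0..A / 2} \<xi> *\<^sub>R (1 + \<xi>\<^sup>2) powr s))"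
    unfolding J_def low_mass_def set_lebesgue_integral_def by simp
  also have "\<dots> \<le> (LINT \<xi>|lborel. (1 + \<xi>\<^sup>2) powr s * (cmod (v T \<xi>))\<^sup>2)"
  proof (rule integral_mono[OF ji])
    show "integrable lborel (\<lambda>\<xi>. (1 + \<xi>\<^sup>2) powr s * (cmod (v T \<xi>))\<^sup>2)"
      using u_fourier_rep[OF Tm] unfolding fourier_rep_def by blast
    fix \<xi>
    show "q\<^sup>2 * (indicator {0..A / 2} \<xi> *\<^sub>R (1 + \<xi>\<^sup>2) powr s) \<le> (1 + \<xi>\<^sup>2) powr s * (cmod (v T \<xi>))\<^sup>2"
    proof (cases "\<xi> \<in> {0..A / 2}")
      case True
      then have "q\<^sup>2 \<le> (cmod (v T \<xi>))\<^sup>2" using v_ge[OF True] q0 unfolding q_def by (intro power_mono) auto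
      then have "(1 + \<xi>\<^sup>2) powr s * q\<^sup>2 \<le> (1 + \<xi>\<^sup>2) powr s * (cmod (v T \<xi>))\<^sup>2" by (rule mult_left_mono) simp
      then show ?thesis using True by (simp add: mult.commute)
    qed simp
  qed
  finally have "sqrt (q\<^sup>2 * J) \<le> sqrt (LINT \<xi>|lborel. (1 + \<xi>\<^sup>2) powr s * (cmod (v T \<xi>))\<^sup>2)" by simp
  then have "1 / sqrt (2 * pi) * (q * sqrt J) \<le> hs_norm s (u T)"
    unfolding hs_norm_eq[OF u_fourier_rep[OF Tm]] using q0 by (intro mult_left_mono) (auto simp: real_sqrt_mult)
  moreover have "T * R ^ 3 * A\<^sup>2 / 20000 * sqrt J \<le> 1 / sqrt (2 * pi) * (q * sqrt J)"
  proof -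
    have J0: "J \<ge> 0" unfolding J_def low_mass_def set_lebesgue_integral_def by (intro integral_nonneg_AE) auto
    have "sqrt (2 * pi) \<le> sqrt (3\<^sup>2)" using pi_less_4 by (intro real_sqrt_le_mono) simp
    then have s3: "sqrt (2 * pi) \<le> 3" by simp
    have p16: "pi\<^sup>2 \<le> 16" using pi_less_4 power_mono[of pi 4 2] by simp
    \<comment> \<open>Collects 1/sqrt(2 pi) from the norm, 1/(4 pi^2) from \<kappa>, and 1/64. The
      product on the right is 12288, so 20000 is a safe round number.\<close>
    have "sqrt (2 * pi) * (4 * pi\<^sup>2 * 64) \<le> 3 * (4 * 16 * 64)" using s3 p16 by (intro mult_mono) auto
    then have "T * R ^ 3 * A\<^sup>2 / 20000 \<le> T * R ^ 3 * A\<^sup>2 / (sqrt (2 * pi) * (4 * pi\<^sup>2 * 64))"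
      using T R A by (intro divide_left_mono) auto
    also have "\<dots> = 1 / sqrt (2 * pi) * q" unfolding q_def \<kappa>_def by simp
    finally have "T * R ^ 3 * A\<^sup>2 / 20000 * sqrt J \<le> (1 / sqrt (2 * pi) * q) * sqrt J"
      using J0 by (intro mult_right_mono) auto
    then show ?thesis by (simp only: mult.assoc)
  qed
  ultimately show ?thesis unfolding J_def by linarith
qed

text \<open>All frequencies of the datum are at least \<open>N\<close>, so for s \<le> 0 the weight
  is at most N^(2s); the total length 2A gives a factor 2, absorbed by 1/(2 pi).\<close>

lemma hs_norm_data_le:
  assumes s: "s \<le> 0"
  shows "hs_norm s (u 0) \<le> R * sqrt A * N powr s"
proof -
  have N: "N > 0" using A by simp
  let ?I = "\<lambda>\<xi>. indicator {N..N + A} \<xi> * (N powr (2 * s) * R\<^sup>2) + indicator {2 * N..2 * N + A} \<xi> * (N powr (2 * s) * R\<^sup>2)"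
  have Ii: "integrable lborel ?I" by (intro Bochner_Integration.integrable_add integrable_indicator_Icc)
  have "(LINT \<xi>|lborel. (1 + \<xi>\<^sup>2) powr s * (cmod (v0 \<xi>))\<^sup>2) \<le> integral\<^sup>L lborel ?I"
  proof (rule integral_mono[OF _ Ii])
    show "integrable lborel (\<lambda>\<xi>. (1 + \<xi>\<^sup>2) powr s * (cmod (v0 \<xi>))\<^sup>2)"
      using u_zero_fourier_rep unfolding fourier_rep_def by blast
    fix \<xi>
    show "(1 + \<xi>\<^sup>2) powr s * (cmod (v0 \<xi>))\<^sup>2 \<le> ?I \<xi>"
    proof (cases "\<xi> \<in> {N..N + A} \<union> {2 * N..2 * N + A}")
      case True
      then have \<xi>: "\<xi> \<ge> N" using N by auto
      have "(1 + \<xi>\<^sup>2) powr s \<le> (N\<^sup>2) powr s"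
        using \<xi> N s by (intro powr_mono2') (auto intro: order_trans[OF power_mono])
      also have "(N\<^sup>2) powr s = (N powr 2) powr s" using N by simp
      also have "\<dots> = N powr (2 * s)" by (simp only: powr_powr)
      finally have l: "(1 + \<xi>\<^sup>2) powr s * R\<^sup>2 \<le> N powr (2 * s) * R\<^sup>2" by (intro mult_right_mono) auto
      have "(cmod (v0 \<xi>))\<^sup>2 = R\<^sup>2" unfolding v0_def using bumps_eq[of \<xi> N A R] True by simp
      then have "(1 + \<xi>\<^sup>2) powr s * (cmod (v0 \<xi>))\<^sup>2 \<le> N powr (2 * s) * R\<^sup>2" using l by simp
      also have "\<dots> \<le> ?I \<xi>" using True by (auto simp: indicator_def)
      finally show ?thesis .
    next
      case False
      then show ?thesis by (simp add: v0_def bumps_def)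
    qed
  qed
  also have "\<dots> = 2 * A * (N powr (2 * s) * R\<^sup>2)"
    using A by (subst Bochner_Integration.integral_add[OF integrable_indicator_Icc integrable_indicator_Icc]) (simp add: integral_indicator_Icc)
  finally have "hs_norm s (u 0) \<le> (1 / sqrt (2 * pi)) * sqrt (2 * A * (N powr (2 * s) * R\<^sup>2))"
    unfolding hs_norm_eq[OF u_zero_fourier_rep] by (intro mult_left_mono real_sqrt_le_mono) auto
  also have "sqrt (2 * A * (N powr (2 * s) * R\<^sup>2)) = sqrt 2 * (R * sqrt A * N powr s)"
  proof -
    have "N powr (2 * s) = (N powr s)\<^sup>2" by (simp add: power2_eq_square powr_add[symmetric])
    then show ?thesis using R by (simp add: real_sqrt_mult)
  qed
  also have "1 / sqrt (2 * pi) * (sqrt 2 * (R * sqrt A * N powr s)) \<le> 1 * (R * sqrt A * N powr s)"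
  proof -
    have "sqrt 2 \<le> sqrt (2 * pi)" using pi_gt3 by (intro real_sqrt_le_mono) simp
    then have "1 / sqrt (2 * pi) * sqrt 2 \<le> 1" using pi_gt_zero by (simp add: divide_le_eq)
    then have "(1 / sqrt (2 * pi) * sqrt 2) * (R * sqrt A * N powr s) \<le> 1 * (R * sqrt A * N powr s)"
      using R A by (intro mult_right_mono) auto
    then show ?thesis by (simp only: mult.assoc)
  qed
  finally show ?thesis by simp
qed

end

text \<open>Condenses the analysis into inequalities between \<open>T\<close>, \<open>N\<close>,
  \<open>A\<close>, \<open>R\<close>; what remains is asymptotics in \<open>N\<close>.\<close>

lemma norm_inflation_criterion:
  fixes \<beta> \<mu> s \<epsilon> T N A R :: real
  assumes "\<beta> > 0" "\<bar>\<mu>\<bar> = 1" "s \<le> 0" "0 < A" "A \<le> N" "R > 0" "0 < T" "T < \<epsilon>"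
    and "16 * T * (3 * N) powr \<beta> \<le> 1" "T * R\<^sup>2 * A\<^sup>2 \<le> 1 / 10 ^ 6"
    and "R * sqrt A * N powr s < \<epsilon>"
    and "T * R ^ 3 * A\<^sup>2 / 20000 * sqrt (low_mass s (A / 2)) > 1 / \<epsilon>"
  shows "\<exists>\<phi> T u. \<phi> \<in> Hinf \<and> hs_norm s \<phi> < \<epsilon> \<and> 0 < T \<and> T < \<epsilon> \<and>
              smooth_solution \<beta> \<mu> T u \<and> u 0 = \<phi> \<and> hs_norm s (u T) > 1 / \<epsilon>"
proof -
  interpret fnls_bumps \<beta> \<mu> T N A R by unfold_locales (use assms in auto)
  have "u 0 \<in> Hinf" unfolding Hinf_def using u_zero_fourier_rep by blast
  moreover have "hs_norm s (u 0) < \<epsilon>" using hs_norm_data_le[of s] assms by linarith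
  moreover have "hs_norm s (u T) > 1 / \<epsilon>" using hs_norm_u_ge[of s] assms by linarith
  ultimately show ?thesis using u_smooth_solution assms by blast
qed

section \<open>Choice of parameters\<close>

text \<open>For s \<le> 0 the weight decreases on the half line, so on [0, c] it is at least its
  value at c. The free \<open>c\<close> serves two regimes: c = b for power growth, c = 1 for mere
  positivity.\<close>

lemma low_mass_ge:
  assumes "s \<le> 0" "0 \<le> c" "c \<le> b"
  shows "c * (1 + c\<^sup>2) powr s \<le> low_mass s b"
proof -
  have "(LINT \<xi>|lborel. indicator {0..c} \<xi> * (1 + c\<^sup>2) powr s) \<le> low_mass s b"
    unfolding low_mass_def set_lebesgue_integral_def
  proof (rule integral_mono[OF integrable_indicator_Icc])
    show "integrable lborel (\<lambda>\<xi>. indicator {0..b} \<xi> *\<^sub>R (1 + \<xi>\<^sup>2) powr s)"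
      using low_mass_integrable unfolding set_integrable_def .
    fix \<xi> :: real
    show "indicator {0..c} \<xi> * (1 + c\<^sup>2) powr s \<le> indicator {0..b} \<xi> *\<^sub>R (1 + \<xi>\<^sup>2) powr s"
    proof (cases "\<xi> \<in> {0..c}")
      case True
      then have "(1 + c\<^sup>2) powr s \<le> (1 + \<xi>\<^sup>2) powr s"
        using assms by (intro powr_mono2') (auto simp: add_pos_nonneg intro: power_mono)
      then show ?thesis using True assms by simp
    qed simp
  qed
  then show ?thesis using assms by (subst (asm) integral_indicator_Icc) auto
qed

text \<open>At this exponent the weight is at least 1/(1 + \<xi>), whose primitive is the logarithm
  that settles the end point.\<close>

lemma low_mass_half_ge:
  assumes "0 \<le> b"
  shows "ln (1 + b) \<le> low_mass (- 1 / 2) b"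
proof -
  have 1: "((\<lambda>\<xi>. 1 / (1 + \<xi>)) has_integral (ln (1 + b) - ln (1 + 0))) {0..b}"
    using assms by (intro fundamental_theorem_of_calculus)
      (auto intro!: derivative_eq_intros simp: has_real_derivative_iff_has_vector_derivative[symmetric])
  have "integral {0..b} (\<lambda>\<xi>. 1 / (1 + \<xi>)) \<le> integral {0..b} (\<lambda>\<xi>::real. (1 + \<xi>\<^sup>2) powr (- 1 / 2))"
  proof (rule Henstock_Kurzweil_Integration.integral_le)
    fix \<xi> assume \<xi>: "\<xi> \<in> {0..b}"
    have "1 + \<xi>\<^sup>2 \<le> (1 + \<xi>)\<^sup>2" using \<xi> by (simp add: power2_eq_square algebra_simps)
    then have "((1 + \<xi>)\<^sup>2) powr (- 1 / 2) \<le> (1 + \<xi>\<^sup>2) powr (- 1 / 2)"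
      by (intro powr_mono2') (auto simp: add_pos_nonneg)
    moreover have "((1 + \<xi>)\<^sup>2) powr (- 1 / 2) = 1 / (1 + \<xi>)"
    proof -
      have "((1 + \<xi>)\<^sup>2) powr (- 1 / 2) = ((1 + \<xi>) powr 2) powr (- 1 / 2)" using \<xi> by simp
      also have "\<dots> = (1 + \<xi>) powr (- 1)" by (simp only: powr_powr) simp
      also have "\<dots> = 1 / (1 + \<xi>)" using \<xi> by (simp add: powr_minus_divide)
      finally show ?thesis .
    qed
    ultimately show "1 / (1 + \<xi>) \<le> (1 + \<xi>\<^sup>2) powr (- 1 / 2)" by simp
  qed (use 1 set_borel_integral_eq_integral(1)[OF low_mass_integrable] in auto)
  then show ?thesis
    unfolding low_mass_def set_borel_integral_eq_integral(2)[OF low_mass_integrable]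
    using integral_unique[OF 1] by simp
qed

lemma norm_inflation_from_exponents:
  fixes \<beta> \<mu> s a m \<epsilon> :: real
  assumes \<beta>: "\<beta> > 0" and \<mu>: "\<bar>\<mu>\<bar> = 1" and s: "s < 0" and a: "0 < a" "a \<le> 1" and m: "\<beta> \<le> m" "a - 2 * s \<le> m"
    and div: "filterlim (\<lambda>N. N powr (a / 2 - 3 * s - m) * sqrt (low_mass s (N powr a / 2))) at_top at_top"
    and \<epsilon>: "0 < \<epsilon>" "\<epsilon> < 1"
  shows "\<exists>\<phi> T u. \<phi> \<in> Hinf \<and> hs_norm s \<phi> < \<epsilon> \<and> 0 < T \<and> T < \<epsilon> \<and>
              smooth_solution \<beta> \<mu> T u \<and> u 0 = \<phi> \<and> hs_norm s (u T) > 1 / \<epsilon>"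
proof -
  \<comment> \<open>The norm of the datum will be at most \<epsilon>/2, strictly below
    \<epsilon>.\<close>
  define r where "r = \<epsilon> / 2"
  \<comment> \<open>One constant for two conditions: 16 \<tau> 3^\<beta> \<le> 1 for the phases and
    \<tau> \<le> 10^(-6) for the amplitude.\<close>
  define \<tau> where "\<tau> = 1 / (10 ^ 6 * (16 * 3 powr \<beta>))"
  have r: "0 < r" "r < \<epsilon>" "r < 1" using \<epsilon> by (auto simp: r_def)
  have b3: "3 powr \<beta> \<ge> 1" using \<beta> by (simp add: ge_one_powr_ge_zero)
  have \<tau>: "0 < \<tau>" "\<tau> \<le> 1 / 10 ^ 6" "16 * \<tau> * 3 powr \<beta> \<le> 1"
    using b3 by (auto simp: \<tau>_def field_simps)
  have m0: "m > 0" using \<beta> m by simp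
  have "((\<lambda>N::real. \<tau> * N powr (- m)) \<longlongrightarrow> 0) at_top"
    using m0 by real_asymp
  then have "eventually (\<lambda>N. \<tau> * N powr (- m) < \<epsilon>) at_top"
    using \<epsilon> by (intro order_tendstoD) auto
  moreover have "eventually (\<lambda>N. N powr (a / 2 - 3 * s - m) * sqrt (low_mass s (N powr a / 2)) > 20000 / (\<tau> * r ^ 3 * \<epsilon>)) at_top"
    using div by (simp add: filterlim_at_top_dense)
  moreover have "eventually (\<lambda>N::real. N \<ge> 1) at_top" by (rule eventually_ge_at_top)
  ultimately have "eventually (\<lambda>N. \<tau> * N powr (- m) < \<epsilon> \<and> N powr (a / 2 - 3 * s - m) * sqrt (low_mass s (N powr a / 2)) > 20000 / (\<tau> * r ^ 3 * \<epsilon>) \<and> N \<ge> 1) at_top"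
    by eventually_elim auto
  then obtain N where N: "\<tau> * N powr (- m) < \<epsilon>" "N \<ge> 1"
    and big: "N powr (a / 2 - 3 * s - m) * sqrt (low_mass s (N powr a / 2)) > 20000 / (\<tau> * r ^ 3 * \<epsilon>)"
    by (auto dest!: eventually_happens)
  define A where "A = N powr a"
  \<comment> \<open>Makes \<open>R * sqrt A * N powr s\<close> equal to \<open>r\<close> for every
    \<open>N\<close>.\<close>
  define R where "R = r * N powr (- s - a / 2)"
  define T where "T = \<tau> * N powr (- m)"
  have N0: "N > 0" using N by simp
  have le1: "N powr e \<le> 1" if "e \<le> 0" for e using that N powr_mono[of e 0 N] by simp
  have p2: "(N powr x)\<^sup>2 = N powr (2 * x)" and p3: "(N powr x) ^ 3 = N powr (3 * x)" for x
    by (simp_all add: power2_eq_square power3_eq_cube powr_add[symmetric])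
  show ?thesis
  proof (rule norm_inflation_criterion[OF \<beta> \<mu>])
    show "s \<le> 0" using s by simp
    show "0 < A" "R > 0" "0 < T" using N0 r \<tau> by (auto simp: A_def R_def T_def)
    show "A \<le> N" unfolding A_def using powr_mono[of a 1 N] a N by simp
    show "T < \<epsilon>" using N by (simp add: T_def)
    have "16 * T * (3 * N) powr \<beta> = (16 * \<tau> * 3 powr \<beta>) * N powr (\<beta> - m)"
      using N0 by (simp add: T_def powr_mult powr_diff powr_minus field_simps)
    also have "\<dots> \<le> 1 * 1" using \<tau> m b3 by (intro mult_mono le1) auto
    finally show "16 * T * (3 * N) powr \<beta> \<le> 1" by simp
    have "T * R\<^sup>2 * A\<^sup>2 = (\<tau> * r\<^sup>2) * (N powr (- m) * N powr (2 * (- s - a / 2)) * N powr (2 * a))"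
      by (simp add: T_def R_def A_def power_mult_distrib p2)
    also have "\<dots> = (\<tau> * r\<^sup>2) * N powr (a - 2 * s - m)"
      by (simp add: powr_add[symmetric] algebra_simps)
    also have "\<dots> \<le> (1 / 10 ^ 6 * 1) * 1"
      using \<tau> r m by (intro mult_mono le1) (auto simp: power_le_one)
    finally show "T * R\<^sup>2 * A\<^sup>2 \<le> 1 / 10 ^ 6" by simp
    have "sqrt A = N powr (a / 2)" unfolding A_def by (simp add: powr_half_sqrt[symmetric] powr_powr)
    then have "R * sqrt A * N powr s = r * (N powr (- s - a / 2) * N powr (a / 2) * N powr s)"
      by (simp add: R_def)
    also have "\<dots> = r" using N0 by (simp add: powr_add[symmetric])
    finally show "R * sqrt A * N powr s < \<epsilon>" using r by simp
    have "T * R ^ 3 * A\<^sup>2 = (\<tau> * r ^ 3) * (N powr (- m) * N powr (3 * (- s - a / 2)) * N powr (2 * a))"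
      by (simp add: T_def R_def A_def power_mult_distrib p2 p3)
    also have "\<dots> = (\<tau> * r ^ 3) * N powr (a / 2 - 3 * s - m)"
      by (simp add: powr_add[symmetric] algebra_simps)
    finally have "T * R ^ 3 * A\<^sup>2 / 20000 * sqrt (low_mass s (A / 2))
       = (\<tau> * r ^ 3) / 20000 * (N powr (a / 2 - 3 * s - m) * sqrt (low_mass s (N powr a / 2)))"
      by (simp add: A_def)
    also have "\<dots> > (\<tau> * r ^ 3) / 20000 * (20000 / (\<tau> * r ^ 3 * \<epsilon>))"
      using big \<tau> r by (intro mult_strict_left_mono) auto
    finally show "1 / \<epsilon> < T * R ^ 3 * A\<^sup>2 / 20000 * sqrt (low_mass s (A / 2))"
      using \<tau> r by simp
  qed
qed

section \<open>Divergence in the three ranges of s\<close>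

lemma low_mass_divergence_above_half:
  fixes s a :: real
  assumes s: "- 1 / 2 < s" "s < 0" and a: "0 < a" "a < 1"
  shows "filterlim (\<lambda>N. N powr (a / 2 - 3 * s - (a - 2 * s)) * sqrt (low_mass s (N powr a / 2))) at_top at_top"
proof (rule filterlim_at_top_mono)
  \<comment> \<open>The resulting exponent: the prefactor contributes -a/2 - s and the root of the
    low mass a/2 + a s. The sum is positive because a < 1; with a = 1 it would vanish.\<close>
  have e: "- s * (1 - a) > 0" using s a by (intro mult_pos_pos) auto
  have "filterlim (\<lambda>N::real. sqrt ((1 / 2) * (1 / 2) powr (- s)) * N powr (- s * (1 - a))) at_top at_top"
    using e by real_asymp
  then show "filterlim (\<lambda>N::real. sqrt ((1 / 2) * (1 / 2) powr (- s)) * N powr (- s * (1 - a))) at_top at_top" .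
  show "eventually (\<lambda>N. sqrt ((1 / 2) * (1 / 2) powr (- s)) * N powr (- s * (1 - a)) \<le> N powr (a / 2 - 3 * s - (a - 2 * s)) * sqrt (low_mass s (N powr a / 2))) at_top"
    using eventually_ge_at_top[of "1::real"]
  proof eventually_elim
    case (elim N)
    define b where "b = N powr a"
    have b: "b \<ge> 1" unfolding b_def using elim a by (simp add: ge_one_powr_ge_zero)
    have "1 \<le> b\<^sup>2" using b by (rule one_le_power)
    \<comment> \<open>A crude comparison for b \<ge> 1; it produces the constant 2^s, written as
      (1/2)^(-s).\<close>
    then have "1 + (b / 2)\<^sup>2 \<le> 2 * b\<^sup>2" by (simp add: power_divide)
    then have "(2 * b\<^sup>2) powr s \<le> (1 + (b / 2)\<^sup>2) powr s" using s b by (intro powr_mono2') (auto simp: add_pos_nonneg)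
    moreover have "(2 * b\<^sup>2) powr s = (1 / 2) powr (- s) * b powr (2 * s)"
    proof -
      have "(b\<^sup>2) powr s = (b powr 2) powr s" using b by simp
      also have "\<dots> = b powr (2 * s)" by (simp only: powr_powr)
      finally have "(b\<^sup>2) powr s = b powr (2 * s)" .
      moreover have "(2::real) powr s = (1 / 2) powr (- s)" by (simp add: powr_divide powr_minus_divide)
      ultimately show ?thesis by (simp add: powr_mult)
    qed
    ultimately have "b / 2 * ((1 / 2) powr (- s) * b powr (2 * s)) \<le> b / 2 * (1 + (b / 2)\<^sup>2) powr s"
      using b by (intro mult_left_mono) auto
    also have "\<dots> \<le> low_mass s (b / 2)" using s b by (intro low_mass_ge) auto
    finally have "sqrt ((1 / 2 * (1 / 2) powr (- s)) * b powr (1 + 2 * s)) \<le> sqrt (low_mass s (b / 2))"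
      using b by (simp add: powr_add ac_simps)
    moreover have "sqrt (b powr (1 + 2 * s)) = N powr (a / 2 + a * s)"
      unfolding b_def by (simp add: powr_half_sqrt[symmetric] powr_powr algebra_simps)
    ultimately have "sqrt (1 / 2 * (1 / 2) powr (- s)) * N powr (a / 2 + a * s) \<le> sqrt (low_mass s (N powr a / 2))"
      unfolding b_def[symmetric] by (simp only: real_sqrt_mult)
    then have "N powr (a / 2 - 3 * s - (a - 2 * s)) * (sqrt (1 / 2 * (1 / 2) powr (- s)) * N powr (a / 2 + a * s))
        \<le> N powr (a / 2 - 3 * s - (a - 2 * s)) * sqrt (low_mass s (N powr a / 2))"
      by (intro mult_left_mono) auto
    moreover have "N powr (a / 2 - 3 * s - (a - 2 * s)) * (sqrt (1 / 2 * (1 / 2) powr (- s)) * N powr (a / 2 + a * s))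
       = sqrt (1 / 2 * (1 / 2) powr (- s)) * N powr (- s * (1 - a))"
    proof -
      have "N powr (a / 2 - 3 * s - (a - 2 * s)) * N powr (a / 2 + a * s) = N powr (- s * (1 - a))"
        unfolding powr_add[symmetric] by (simp add: algebra_simps)
      then show ?thesis by (simp only: mult.left_commute)
    qed
    ultimately show ?case by (simp only:)
  qed
qed

text \<open>For a = 1 and m = 2 the exponent of \<open>N\<close> in front is 0, so the divergence
  comes from the root of the logarithm alone.\<close>

lemma low_mass_divergence_half:
  "filterlim (\<lambda>N. N powr (1 / 2 - 3 * (- 1 / 2) - 2) * sqrt (low_mass (- 1 / 2) (N powr 1 / 2))) at_top at_top"
proof (rule filterlim_at_top_mono)
  show "filterlim (\<lambda>N::real. sqrt (ln (1 + N / 2))) at_top at_top" by real_asymp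
  show "eventually (\<lambda>N. sqrt (ln (1 + N / 2)) \<le> N powr (1 / 2 - 3 * (- 1 / 2) - 2) * sqrt (low_mass (- 1 / 2) (N powr 1 / 2))) at_top"
    using eventually_ge_at_top[of "1::real"]
  proof eventually_elim
    case (elim N)
    then show ?case using low_mass_half_ge[of "N / 2"] by simp
  qed
qed

text \<open>The mass on [0, 1] is already bounded below by 2^s, so any positive power of
  \<open>N\<close> in front suffices.\<close>

lemma low_mass_divergence_below_half:
  fixes s e :: real
  assumes s: "s < 0" and e: "e > 0"
  shows "filterlim (\<lambda>N. N powr e * sqrt (low_mass s (N powr 1 / 2))) at_top at_top"
proof (rule filterlim_at_top_mono)
  show "filterlim (\<lambda>N::real. N powr e * sqrt (2 powr s)) at_top at_top" using e by real_asymp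
  show "eventually (\<lambda>N. N powr e * sqrt (2 powr s) \<le> N powr e * sqrt (low_mass s (N powr 1 / 2))) at_top"
    using eventually_ge_at_top[of "2::real"]
  proof eventually_elim
    case (elim N)
    then show ?case using low_mass_ge[of s 1 "N / 2"] s by (intro mult_left_mono) auto
  qed
qed

text \<open>The four cases are regrouped by the position of s relative to -1/2, which decides how
  the low mass grows. In the last two cases s never lies above -1/2.\<close>

theorem theorem1p4:
  fixes \<beta> \<mu> s :: real
  assumes "\<beta> > 0" and "\<mu> \<in> {-1, 1}"
    and "(0 < \<beta> \<and> \<beta> < 1 \<and> s < 0) \<or>
         (1 \<le> \<beta> \<and> \<beta> < 2 \<and> s < (1 - \<beta>) / 2) \<or>
         (\<beta> = 2 \<and> s \<le> (1 - \<beta>) / 2) \<or>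
         (\<beta> > 2 \<and> s < (1 - 2 * \<beta>) / 6)"
  shows "\<exists>\<epsilon>0>0. \<forall>\<epsilon>. 0 < \<epsilon> \<and> \<epsilon> < \<epsilon>0 \<longrightarrow>
           (\<exists>\<phi> T u. \<phi> \<in> Hinf \<and> hs_norm s \<phi> < \<epsilon> \<and> 0 < T \<and> T < \<epsilon> \<and>
              smooth_solution \<beta> \<mu> T u \<and> u 0 = \<phi> \<and> hs_norm s (u T) > 1 / \<epsilon>)"
proof -
  have \<mu>: "\<bar>\<mu>\<bar> = 1" using assms(2) by auto
  have s: "s < 0" using assms by auto
  have "\<exists>a m. 0 < a \<and> a \<le> 1 \<and> \<beta> \<le> m \<and> a - 2 * s \<le> m \<and>
      filterlim (\<lambda>N. N powr (a / 2 - 3 * s - m) * sqrt (low_mass s (N powr a / 2))) at_top at_top"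
  proof (cases s "- 1 / 2 :: real" rule: linorder_cases)
    case greater
    \<comment> \<open>Above -1/2 only the cases with \<beta> < 2 occur, and both give s <
      (1-\<beta>)/2. The maximum with 0 below is there because \<open>a\<close> must be positive
      while \<beta> + 2s may be negative.\<close>
    have "\<beta> + 2 * s < 1" using assms(1,3) greater by auto
    then have "max 0 (\<beta> + 2 * s) < 1" by simp
    then obtain a where "max 0 (\<beta> + 2 * s) < a" "a < 1" using dense by blast
    then have a: "0 < a" "a < 1" "\<beta> \<le> a - 2 * s" by auto
    then show ?thesis
      using low_mass_divergence_above_half[OF greater s a(1,2)] by (intro exI[of _ a] exI[of _ "a - 2 * s"]) auto
  next
    case equal
    \<comment> \<open>For \<beta> > 2 the hypothesis puts s strictly below -1/2. With a = 1 the
      value m = 2 = 1 - 2s meets both lower bounds on \<open>m\<close>.\<close>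
    have "\<beta> \<le> 2" using assms(1,3) equal by auto
    then show ?thesis
      using low_mass_divergence_half equal by (intro exI[of _ 1] exI[of _ 2]) auto
  next
    case less
    define m where "m = max \<beta> (1 - 2 * s)"
    \<comment> \<open>For \<beta> \<le> 2 the right side is at least -1/2 and so exceeds s; for
      \<beta> > 2 it is the hypothesis. Together with s < -1/2 it handles the two entries of the
      maximum.\<close>
    have "s < (1 - 2 * \<beta>) / 6" using assms(1,3) less by auto
    then have "1 / 2 - 3 * s - m > 0" unfolding m_def using less by auto
    then show ?thesis
      using low_mass_divergence_below_half[OF s] by (intro exI[of _ 1] exI[of _ m]) (auto simp: m_def)
  qed
  then obtain a m where "0 < a" "a \<le> 1" "\<beta> \<le> m" "a - 2 * s \<le> m"
    "filterlim (\<lambda>N. N powr (a / 2 - 3 * s - m) * sqrt (low_mass s (N powr a / 2))) at_top at_top"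
    by blast
  from norm_inflation_from_exponents[OF assms(1) \<mu> s this]
  show ?thesis by (intro exI[of _ 1]) simp
qed

end
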